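(* Let $\Bbbk$ be a field, $S = \Bbbk[x_1,x_2,y_1,y_2,z]$ and let $\mathfrak{a} \subset S$ be the ideal generated by the monomials $$m_a := x_1x_2^2,\quad m_b := y_1y_2^2,\quad m_c := z^3,\quad m_{ab} := x_1x_2y_1y_2,\quad m_{bc} := y_2^2z^2,\quad m_{ca} := x_2^2z^2,$$ $$m_{ab\#c} := x_1y_1z,\quad m_{bc\#a} := x_2^2y_2^2z.$$ Then the product in $H_*(K_{S/\mathfrak{a}}) = \operatorname{Tor}^S_*(S/\mathfrak{a}, \Bbbk)$ is trivial, but $S/\mathfrak{a}$ is not Golod. More precisely, the ternary Massey product $\mu_3([\widehat{\mathbf{e}}_{\{m_a\}}], [\widehat{\mathbf{e}}_{\{m_b\}}], [\widehat{\mathbf{e}}_{\{m_c\}}])$ is nonzero (that is, it is defined and is not equal to $\{0\}$).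
   Context: Here $ab, bc, ca, ab\#c, bc\#a$ are just index names. Koszul homology: for a homogeneous ideal $\mathfrak{a}$ in a polynomial ring $S$ over $\Bbbk$ in $n$ variables and $R = S/\mathfrak{a}$, $K_R$ is the Koszul complex over $R$ on (the images of) all $n$ variables of $S$, a differential graded algebra (DGA). The product in $H_*(K_R)$ is trivial if the product of any two elements of positive homological degree is zero. Golod: $R$ is Golod if $$\sum_{j\ge 0}\dim_\Bbbk \operatorname{Tor}^R_j(\Bbbk,\Bbbk)\,t^j = \frac{(1+t)^n}{1-\sum_{j\ge 1}\dim_\Bbbk H_j(K_R)\,t^{j+1}}.$$ (By a theorem of Golod this holds if and only if the product and all higher Massey products on $H_*(K_R)$ are trivial.) Massey products: let $A$ be a DGA with differential $d$, and write $|\cdot|$ for homological degree and $\bar a = (-1)^{|a|+1}a$. For $r\ge 3$ and homogeneous $a_1,\dots,a_r\in H_*(A)$, $\mu_r(a_1,\dots,a_r)$ is defined if there are elements $a_{ij}\in A$ for $1\le i\le j\le r$, $(i,j)\ne(1,r)$, with $da_{ii}=0$, $[a_{ii}]=a_i$ and $da_{ij}=\sum_{v=i}^{j-1}\bar a_{iv}a_{v+1,j}$ for $i<j$; then $\mu_r(a_1,\dots,a_r)\subset H_*(A)$ is the set of all classes $[\sum_{v=1}^{r-1}\bar a_{1v}a_{v+1,r}]$ obtained from all such choices. Taylor resolution: let $G(\mathfrak{a})$ be the set of minimal monomial generators of $\mathfrak{a}$, with a fixed total order $\prec$ (its choice only affects signs). For $I\subseteq G(\mathfrak{a})$ put $m_I=\operatorname{lcm}(m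 : m\in I)$. The Taylor resolution $T_\bullet$ of $S/\mathfrak{a}$ is the complex of free $S$-modules with basis $\{\mathbf{e}_I : I\subseteq G(\mathfrak{a})\}$, $|\mathbf{e}_I|=\#I$, and differential $$\partial\mathbf{e}_I=\sum_{m\in I}(-1)^{\#\{m'\in I : m'\prec m\}}\frac{m_I}{m_{I\setminus\{m\}}}\mathbf{e}_{I\setminus\{m\}}.$$ It is a DGA with $\mathbf{e}_I\cdot\mathbf{e}_J=(-1)^{\sigma(I,J)}\frac{m_Im_J}{m_{I\cup J}}\mathbf{e}_{I\cup J}$ if $I\cap J=\emptyset$ and $0$ otherwise, where $\sigma(I,J)=\#\{(m,m')\in I\times J : m'\prec m\}$. Write $\widehat{\mathbf{e}}_I:=\mathbf{e}_I\otimes_S 1_\Bbbk\in T_\bullet\otimes_S\Bbbk$. The DGAs $T_\bullet\otimes_S\Bbbk$ and $K_R$ are connected by quasi-isomorphisms of DGAs $T_\bullet\otimes_S\Bbbk \leftarrow T_\bullet\otimes_S K_S\to K_R$, so $H_*(K_R)=\operatorname{Tor}^S_*(R,\Bbbk)=H_*(T_\bullet\otimes_S\Bbbk)$ as algebras and Massey products may be computed in $T_\bullet\otimes_S\Bbbk$. *)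

theory Defs
  imports "HOL-Library.Poly_Mapping" "HOL-Computational_Algebra.Formal_Power_Series"
begin

section \<open>Polynomials and ideals\<close>

text \<open>A monomial is its exponent vector, a polynomial a finitely supported function on monomials.\<close>

type_synonym 'v monomial = "'v \<Rightarrow>\<^sub>0 nat"
type_synonym ('v, 'k) mpoly = "'v monomial \<Rightarrow>\<^sub>0 'k"

abbreviation mono_poly :: "'v monomial \<Rightarrow> ('v, 'k::comm_ring_1) mpoly" where
  "mono_poly u \<equiv> Poly_Mapping.single u 1"

abbreviation var_poly :: "'v \<Rightarrow> ('v, 'k::comm_ring_1) mpoly" where
  "var_poly i \<equiv> mono_poly (Poly_Mapping.single i 1)"

abbreviation const_poly :: "'k \<Rightarrow> ('v, 'k::comm_ring_1) mpoly" where
  "const_poly c \<equiv> Poly_Mapping.single 0 c"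

abbreviation const_coeff :: "('v, 'k::comm_ring_1) mpoly \<Rightarrow> 'k" where
  "const_coeff p \<equiv> Poly_Mapping.lookup p 0"

definition ideal_gen :: "'a::comm_ring_1 set \<Rightarrow> 'a set" where
  "ideal_gen M = module.span (*) M"

definition mono_dvd :: "'v monomial \<Rightarrow> 'v monomial \<Rightarrow> bool" where
  "mono_dvd u v \<longleftrightarrow> (\<forall>i. Poly_Mapping.lookup u i \<le> Poly_Mapping.lookup v i)"

definition min_gens :: "('v, 'k::comm_ring_1) mpoly set \<Rightarrow> 'v monomial set" where
  "min_gens \<aa> = {u. mono_poly u \<in> \<aa> \<and> (\<forall>v. mono_poly v \<in> \<aa> \<and> mono_dvd v u \<longrightarrow> v = u)}"

lift_definition mono_lcm :: "'v::finite monomial set \<Rightarrow> 'v monomial" is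
  "\<lambda>I i. Max (insert 0 ((\<lambda>u. u i) ` I))"
  by simp


section \<open>Free modules\<close>

text \<open>The free module over a ring with basis \<open>B\<close> consists of the finitely supported functions
  \<open>u\<close> with \<open>keys u \<subseteq> B\<close>; the basis vector belonging to \<open>b\<close> is \<open>Poly_Mapping.single b 1\<close>.\<close>

definition free_mod :: "'b set \<Rightarrow> ('b \<Rightarrow>\<^sub>0 'c::comm_ring_1) set" where
  "free_mod B = {u. Poly_Mapping.keys u \<subseteq> B}"

definition smul :: "'c \<Rightarrow> ('b \<Rightarrow>\<^sub>0 'c) \<Rightarrow> ('b \<Rightarrow>\<^sub>0 'c::comm_ring_1)" where
  "smul c u = Poly_Mapping.map ((*) c) u"

definition lin_ext :: "('b \<Rightarrow> ('e \<Rightarrow>\<^sub>0 'c)) \<Rightarrow> ('b \<Rightarrow>\<^sub>0 'c::comm_ring_1) \<Rightarrow> ('e \<Rightarrow>\<^sub>0 'c)" where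
  "lin_ext f u = (\<Sum>b\<in>Poly_Mapping.keys u. smul (Poly_Mapping.lookup u b) (f b))"

text \<open>The dimension of \<open>Z / B\<close> for subspaces \<open>B \<subseteq> Z\<close>: the cardinality of a subset of \<open>Z\<close> whose
  residue classes form a basis of the quotient. As for \<open>dim\<close>, the value is 0 if it is infinite.\<close>

definition basis_modulo :: "('k::field \<Rightarrow> 'a::ab_group_add \<Rightarrow> 'a) \<Rightarrow> 'a set \<Rightarrow> 'a set \<Rightarrow> 'a set \<Rightarrow> bool" where
  "basis_modulo scl Z B C \<longleftrightarrow> C \<subseteq> Z \<and> module.span scl (B \<union> C) = Z \<and>
     (\<forall>c\<in>C. c \<notin> module.span scl (B \<union> (C - {c})))"

definition quot_dim :: "('k::field \<Rightarrow> 'a::ab_group_add \<Rightarrow> 'a) \<Rightarrow> 'a set \<Rightarrow> 'a set \<Rightarrow> nat" where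
  "quot_dim scl Z B = card (SOME C. basis_modulo scl Z B C)"


section \<open>Differential graded algebras\<close>

record 'a dga =
  elems :: "'a set"
  component :: "nat \<Rightarrow> 'a set"
  mul :: "'a \<Rightarrow> 'a \<Rightarrow> 'a"
  diff :: "'a \<Rightarrow> 'a"

definition cycles :: "'a::ab_group_add dga \<Rightarrow> nat \<Rightarrow> 'a set" where
  "cycles A n = {z \<in> component A n. diff A z = 0}"

definition boundaries :: "'a::ab_group_add dga \<Rightarrow> nat \<Rightarrow> 'a set" where
  "boundaries A n = diff A ` component A (Suc n)"

definition hclass :: "'a::ab_group_add dga \<Rightarrow> 'a \<Rightarrow> 'a set" where
  "hclass A z = {z + diff A b | b. b \<in> elems A}"

definition trivial_homology_product :: "'a::ab_group_add dga \<Rightarrow> bool" where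
  "trivial_homology_product A \<longleftrightarrow>
     (\<forall>i j z w. 0 < i \<and> 0 < j \<and> z \<in> cycles A i \<and> w \<in> cycles A j \<longrightarrow>
        hclass A (mul A z w) = hclass A 0)"

text \<open>\<open>bar p a\<close> is \<open>(-1)^(p+1) a\<close>, to be used for \<open>a\<close> homogeneous of degree \<open>p\<close>.\<close>

definition bar :: "nat \<Rightarrow> 'a::ab_group_add \<Rightarrow> 'a" where
  "bar p a = (if even (Suc p) then a else - a)"

text \<open>Massey products of the homology classes in the list \<open>cs\<close>, whose members carry the indices
  \<open>1, \<dots>, r\<close>. The elements \<open>a i j\<close> are homogeneous, of degree \<open>p i j\<close>; the condition on \<open>p\<close> says
  that the equations for \<open>diff A (a i j)\<close> are homogeneous, i.e. that \<open>a i j\<close> has degree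
  \<open>p i i + \<dots> + p j j + (j - i)\<close>.\<close>

definition defining_system ::
    "'a::ab_group_add dga \<Rightarrow> 'a set list \<Rightarrow> (nat \<Rightarrow> nat \<Rightarrow> nat) \<Rightarrow> (nat \<Rightarrow> nat \<Rightarrow> 'a) \<Rightarrow> bool" where
  "defining_system A cs p a \<longleftrightarrow> (let r = length cs in
     (\<forall>i j. 1 \<le> i \<and> i \<le> j \<and> j \<le> r \<and> (i, j) \<noteq> (1, r) \<longrightarrow> a i j \<in> component A (p i j)) \<and>
     (\<forall>i v j. 1 \<le> i \<and> i \<le> v \<and> v < j \<and> j \<le> r \<longrightarrow> p i j = p i v + p (Suc v) j + 1) \<and>
     (\<forall>i. 1 \<le> i \<and> i \<le> r \<longrightarrow> diff A (a i i) = 0 \<and> hclass A (a i i) = cs ! (i - 1)) \<and>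
     (\<forall>i j. 1 \<le> i \<and> i < j \<and> j \<le> r \<and> (i, j) \<noteq> (1, r) \<longrightarrow>
        diff A (a i j) = (\<Sum>v=i..<j. mul A (bar (p i v) (a i v)) (a (Suc v) j))))"

definition massey :: "'a::ab_group_add dga \<Rightarrow> 'a set list \<Rightarrow> 'a set set" where
  "massey A cs = (let r = length cs in
     {hclass A (\<Sum>v=1..<r. mul A (bar (p 1 v) (a 1 v)) (a (Suc v) r)) | p a.
        defining_system A cs p a})"

text \<open>The free module on the subsets \<open>I\<close> of \<open>V\<close>, with an exterior-algebra-like structure given by
  \<open>d e_I = \<Sum>\<^bsub>m \<in> I\<^esub> \<plusminus> \<delta> I m e_(I - {m})\<close> and \<open>e_I e_J = \<plusminus> \<pi> I J e_(I \<union> J)\<close> for disjoint \<open>I\<close>, \<open>J\<close>.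
  The signs are determined by the total order \<open>r\<close> on \<open>V\<close>. The Koszul complex and the Taylor
  resolution are both of this form, and differ only in the coefficients.\<close>

definition ext_dga ::
    "'b set \<Rightarrow> 'b rel \<Rightarrow> ('b set \<Rightarrow> 'b \<Rightarrow> 'c) \<Rightarrow> ('b set \<Rightarrow> 'b set \<Rightarrow> 'c) \<Rightarrow> ('b set \<Rightarrow>\<^sub>0 'c::comm_ring_1) dga" where
  "ext_dga V r \<delta> \<pi> =
    \<lparr> elems = free_mod (Pow V),
      component = (\<lambda>n. free_mod {I. I \<subseteq> V \<and> card I = n}),
      mul = (\<lambda>u w. lin_ext (\<lambda>I. lin_ext (\<lambda>J.
               if I \<inter> J = {}
               then Poly_Mapping.single (I \<union> J)
                      ((-1) ^ card {(m, m'). m \<in> I \<and> m' \<in> J \<and> (m', m) \<in> r} * \<pi> I J)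
               else 0) w) u),
      diff = lin_ext (\<lambda>I. \<Sum>m\<in>I.
               Poly_Mapping.single (I - {m}) ((-1) ^ card {m' \<in> I. (m', m) \<in> r} * \<delta> I m)) \<rparr>"

text \<open>In the following, an algebra \<open>R = S / \<aa>\<close> is given by the quotient map \<open>q : S \<rightarrow> R\<close>, where \<open>S\<close>
  is the polynomial ring in the variables \<open>UNIV :: 'v set\<close>.\<close>

definition koszul :: "(('v::{finite,linorder}, 'k::field) mpoly \<Rightarrow> 'r::comm_ring_1) \<Rightarrow> ('v set \<Rightarrow>\<^sub>0 'r) dga" where
  "koszul q = ext_dga UNIV {(i, j). i < j} (\<lambda>I i. q (var_poly i)) (\<lambda>I J. 1)"

definition koszul_betti :: "(('v::{finite,linorder}, 'k::field) mpoly \<Rightarrow> 'r::comm_ring_1) \<Rightarrow> nat \<Rightarrow> nat" where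
  "koszul_betti q j = quot_dim (\<lambda>c. smul (q (const_poly c)))
     (cycles (koszul q) j) (boundaries (koszul q) j)"

text \<open>The base change of the Taylor resolution on the set \<open>G\<close> of monomials along a ring homomorphism
  \<open>\<phi>\<close> from \<open>S\<close> to \<open>C\<close>. For \<open>\<phi> = id\<close> this is the Taylor resolution itself. Subtraction
  of exponent vectors is division of monomials.\<close>

definition taylor :: "'v::finite monomial set \<Rightarrow> 'v monomial rel \<Rightarrow> (('v, 'k::field) mpoly \<Rightarrow> 'c::comm_ring_1) \<Rightarrow>
    ('v monomial set \<Rightarrow>\<^sub>0 'c) dga" where
  "taylor G r \<phi> = ext_dga G r
     (\<lambda>I m. \<phi> (mono_poly (mono_lcm I - mono_lcm (I - {m}))))
     (\<lambda>I J. \<phi> (mono_poly (mono_lcm I + mono_lcm J - mono_lcm (I \<union> J))))"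

definition taylor_k :: "('v::finite, 'k::field) mpoly set \<Rightarrow> 'v monomial rel \<Rightarrow> ('v monomial set \<Rightarrow>\<^sub>0 'k) dga" where
  "taylor_k \<aa> r = taylor (min_gens \<aa>) r (const_coeff :: ('v, 'k) mpoly \<Rightarrow> 'k)"


section \<open>Tor over the residue field and Golod rings\<close>

text \<open>The residue map \<open>R \<rightarrow> R / (x_1, \<dots>, x_n) R\<close>, whose target is identified with the ground field.\<close>

definition residue :: "(('v, 'k::field) mpoly \<Rightarrow> 'r::comm_ring_1) \<Rightarrow> 'r \<Rightarrow> 'k" where
  "residue q x = (THE c. \<exists>p. q p = x \<and> const_coeff p = c)"

text \<open>A free resolution \<open>\<dots> \<rightarrow> F_1 \<rightarrow> F_0 \<rightarrow> k \<rightarrow> 0\<close> over \<open>R\<close>, where \<open>R\<close> acts on the field \<open>k\<close> through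
  \<open>\<rho>\<close>. The module \<open>F_j\<close> is free on \<open>B j\<close>, the map \<open>F_(j+1) \<rightarrow> F_j\<close> sends the basis vector
  \<open>b\<close> to \<open>D j b\<close>, and the augmentation sends the basis vector \<open>b\<close> of \<open>F_0\<close> to \<open>\<eta> b\<close>.\<close>

definition augmentation :: "('r::comm_ring_1 \<Rightarrow> 'k::field) \<Rightarrow> ('b \<Rightarrow> 'k) \<Rightarrow> ('b \<Rightarrow>\<^sub>0 'r) \<Rightarrow> 'k" where
  "augmentation \<rho> \<eta> u = (\<Sum>b\<in>Poly_Mapping.keys u. \<rho> (Poly_Mapping.lookup u b) * \<eta> b)"

definition free_resolution :: "('r::comm_ring_1 \<Rightarrow> 'k::field) \<Rightarrow>
    (nat \<Rightarrow> 'b set) \<Rightarrow> (nat \<Rightarrow> 'b \<Rightarrow> ('b \<Rightarrow>\<^sub>0 'r)) \<Rightarrow> ('b \<Rightarrow> 'k) \<Rightarrow> bool" where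
  "free_resolution \<rho> B D \<eta> \<longleftrightarrow>
     (\<forall>j. \<forall>b\<in>B (Suc j). D j b \<in> free_mod (B j)) \<and>
     augmentation \<rho> \<eta> ` free_mod (B 0) = UNIV \<and>
     {u \<in> free_mod (B 0). augmentation \<rho> \<eta> u = 0} = lin_ext (D 0) ` free_mod (B 1) \<and>
     (\<forall>j. {u \<in> free_mod (B (Suc j)). lin_ext (D j) u = 0} =
          lin_ext (D (Suc j)) ` free_mod (B (Suc (Suc j))))"

text \<open>The homology of \<open>F \<otimes>\<^sub>R k\<close>, for a chosen free resolution \<open>F\<close> of \<open>k\<close> over \<open>R\<close>. As \<open>R\<close> is
  Noetherian, there are resolutions whose modules have bases indexed by natural numbers.\<close>

definition tensor_diff :: "('r::comm_ring_1 \<Rightarrow> 'k::field) \<Rightarrow> (nat \<Rightarrow> 'b \<Rightarrow> ('b \<Rightarrow>\<^sub>0 'r)) \<Rightarrow>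
    nat \<Rightarrow> ('b \<Rightarrow>\<^sub>0 'k) \<Rightarrow> ('b \<Rightarrow>\<^sub>0 'k)" where
  "tensor_diff \<rho> D j = (case j of 0 \<Rightarrow> (\<lambda>u. 0) | Suc i \<Rightarrow> lin_ext (\<lambda>b. Poly_Mapping.map \<rho> (D i b)))"

definition tor_dim :: "('r::comm_ring_1 \<Rightarrow> 'k::field) \<Rightarrow> nat \<Rightarrow> nat" where
  "tor_dim \<rho> j =
    (let (B, D, \<eta>) = (SOME (B :: nat \<Rightarrow> nat set, D, \<eta>). free_resolution \<rho> B D \<eta>) in
     quot_dim smul {u \<in> free_mod (B j). tensor_diff \<rho> D j u = 0}
       (tensor_diff \<rho> D (Suc j) ` free_mod (B (Suc j))))"

definition golod :: "(('v::{finite,linorder}, 'k::field) mpoly \<Rightarrow> 'r::comm_ring_1) \<Rightarrow> bool" where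
  "golod q \<longleftrightarrow>
     Abs_fps (\<lambda>j. of_nat (tor_dim (residue q) j)) =
     (1 + fps_X) ^ card (UNIV :: 'v set) /
     (1 - Abs_fps (\<lambda>i. if 2 \<le> i then of_nat (koszul_betti q (i - 1)) else 0) :: rat fps)"


section \<open>The example\<close>

datatype var = X1 | X2 | Y1 | Y2 | Z

instance var :: finite
proof
  have "(UNIV :: var set) = {X1, X2, Y1, Y2, Z}"
    using var.exhaust by blast
  then show "finite (UNIV :: var set)"
    by (metis finite.emptyI finite_insert)
qed

primrec var_index :: "var \<Rightarrow> nat" where
  "var_index X1 = 1" | "var_index X2 = 2" | "var_index Y1 = 3" | "var_index Y2 = 4" | "var_index Z = 5"

instantiation var :: linorder
begin

definition less_eq_var :: "var \<Rightarrow> var \<Rightarrow> bool" where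
  "less_eq_var x y \<longleftrightarrow> var_index x \<le> var_index y"

definition less_var :: "var \<Rightarrow> var \<Rightarrow> bool" where
  "less_var x y \<longleftrightarrow> var_index x < var_index y"

instance
proof
  fix x y :: var
  show "x = y" if "x \<le> y" "y \<le> x"
    using that by (cases x; cases y) (simp_all add: less_eq_var_def)
qed (auto simp: less_eq_var_def less_var_def)

end

abbreviation pow :: "var \<Rightarrow> nat \<Rightarrow> var monomial" where
  "pow \<equiv> Poly_Mapping.single"

definition m_a :: "var monomial" where "m_a = pow X1 1 + pow X2 2"
definition m_b :: "var monomial" where "m_b = pow Y1 1 + pow Y2 2"
definition m_c :: "var monomial" where "m_c = pow Z 3"
definition m_ab :: "var monomial" where "m_ab = pow X1 1 + pow X2 1 + pow Y1 1 + pow Y2 1"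
definition m_bc :: "var monomial" where "m_bc = pow Y2 2 + pow Z 2"
definition m_ca :: "var monomial" where "m_ca = pow X2 2 + pow Z 2"
definition m_ab_c :: "var monomial" where "m_ab_c = pow X1 1 + pow Y1 1 + pow Z 1"
definition m_bc_a :: "var monomial" where "m_bc_a = pow X2 2 + pow Y2 2 + pow Z 1"

definition ideal_a :: "(var, 'k::field) mpoly set" where
  "ideal_a = ideal_gen (mono_poly ` {m_a, m_b, m_c, m_ab, m_bc, m_ca, m_ab_c, m_bc_a})"

lemma module_times: "module ((*) :: 'a::comm_ring_1 \<Rightarrow> 'a \<Rightarrow> 'a)"
  by standard (simp_all add: algebra_simps)

lemma ideal_a_diff: "p \<in> ideal_a \<Longrightarrow> p' \<in> ideal_a \<Longrightarrow> p - p' \<in> ideal_a"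
  unfolding ideal_a_def ideal_gen_def by (rule module.span_diff[OF module_times])

lemma ideal_a_add: "p \<in> ideal_a \<Longrightarrow> p' \<in> ideal_a \<Longrightarrow> p + p' \<in> ideal_a"
  unfolding ideal_a_def ideal_gen_def by (rule module.span_add[OF module_times])

lemma ideal_a_zero: "0 \<in> ideal_a"
  unfolding ideal_a_def ideal_gen_def by (rule module.span_zero[OF module_times])

lemma ideal_a_mult: "p \<in> ideal_a \<Longrightarrow> s * p \<in> ideal_a"
  unfolding ideal_a_def ideal_gen_def by (rule module.span_scale[OF module_times])

lemma monomial_add_eq_0: "u + v = 0 \<longleftrightarrow> u = 0 \<and> v = 0" for u v :: "'v monomial"
  by (auto simp: poly_mapping_eq_iff lookup_add fun_eq_iff)

lemma single_eq_0: "Poly_Mapping.single i n = 0 \<longleftrightarrow> n = 0"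
  by (auto simp: poly_mapping_eq_iff fun_eq_iff lookup_single when_def)

lemma const_coeff_times: "const_coeff (p * p') = const_coeff p * const_coeff p'"
  for p p' :: "('v, 'k::comm_ring_1) mpoly"
proof -
  have "(\<Sum>q. (Poly_Mapping.lookup p' q when (0 = l + q))) = (const_coeff p' when l = 0)" for l
  proof -
    have "(\<lambda>q. (Poly_Mapping.lookup p' q when (0 = l + q))) =
        (\<lambda>q. ((const_coeff p' when l = 0) when q = 0))"
      using monomial_add_eq_0[of l] by (fastforce simp: when_def)
    then show ?thesis by (simp only: Sum_any_when_equal)
  qed
  then show ?thesis
    by (simp add: times_poly_mapping.rep_eq prod_fun_def mult_when)
qed

lemma one_notin_ideal_a: "1 \<notin> (ideal_a :: (var, 'k::field) mpoly set)"
proof -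
  have nz: "u \<noteq> 0" if "u \<in> {m_a, m_b, m_c, m_ab, m_bc, m_ca, m_ab_c, m_bc_a}" for u
    using that
    by (auto simp: m_a_def m_b_def m_c_def m_ab_def m_bc_def m_ca_def m_ab_c_def m_bc_a_def
        monomial_add_eq_0 single_eq_0)
  have "const_coeff p = 0" if "p \<in> ideal_a" for p :: "(var, 'k) mpoly"
    using that unfolding ideal_a_def ideal_gen_def
  proof (induction rule: module.span_induct_alt[OF module_times, consumes 1])
    case 1
    show ?case by simp
  next
    case (2 c x y)
    from 2(1) obtain u where u: "x = mono_poly u" and "u \<noteq> 0" using nz by blast
    then have "const_coeff x = 0" by (simp add: lookup_single)
    with 2(2) show ?case by (simp add: lookup_add const_coeff_times)
  qed
  then show ?thesis by (metis lookup_one_zero zero_neq_one)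
qed

definition ideal_rel :: "(var, 'k::field) mpoly \<Rightarrow> (var, 'k) mpoly \<Rightarrow> bool" where
  "ideal_rel p p' \<longleftrightarrow> p - p' \<in> ideal_a"

lemma equivp_ideal_rel: "equivp ideal_rel"
proof (rule equivpI)
  show "reflp ideal_rel"
    by (simp add: reflp_def ideal_rel_def ideal_a_zero)
  show "symp ideal_rel"
    using ideal_a_diff[OF ideal_a_zero] by (fastforce simp: symp_def ideal_rel_def)
  show "transp ideal_rel"
    using ideal_a_add by (fastforce simp: transp_def ideal_rel_def)
qed

quotient_type (overloaded) 'k quot_ring = "(var, 'k::field) mpoly" / ideal_rel
  by (rule equivp_ideal_rel)

definition quot_map :: "(var, 'k::field) mpoly \<Rightarrow> 'k quot_ring" where
  "quot_map = abs_quot_ring"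

instantiation quot_ring :: (field) comm_ring_1
begin

lift_definition zero_quot_ring :: "'a quot_ring" is 0 .

lift_definition one_quot_ring :: "'a quot_ring" is 1 .

lift_definition plus_quot_ring :: "'a quot_ring \<Rightarrow> 'a quot_ring \<Rightarrow> 'a quot_ring" is "(+)"
proof -
  fix p p' s s' :: "(var, 'a) mpoly"
  assume "ideal_rel p p'" "ideal_rel s s'"
  then have "(p - p') + (s - s') \<in> ideal_a"
    unfolding ideal_rel_def by (intro ideal_a_add)
  then show "ideal_rel (p + s) (p' + s')"
    unfolding ideal_rel_def by (simp add: algebra_simps)
qed

lift_definition minus_quot_ring :: "'a quot_ring \<Rightarrow> 'a quot_ring \<Rightarrow> 'a quot_ring" is "(-)"
proof -
  fix p p' s s' :: "(var, 'a) mpoly"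
  assume "ideal_rel p p'" "ideal_rel s s'"
  then have "(p - p') - (s - s') \<in> ideal_a"
    unfolding ideal_rel_def by (rule ideal_a_diff)
  then show "ideal_rel (p - s) (p' - s')"
    unfolding ideal_rel_def by (simp add: algebra_simps)
qed

lift_definition uminus_quot_ring :: "'a quot_ring \<Rightarrow> 'a quot_ring" is "uminus"
proof -
  fix p p' :: "(var, 'a) mpoly"
  assume "ideal_rel p p'"
  then have "0 - (p - p') \<in> ideal_a"
    unfolding ideal_rel_def by (rule ideal_a_diff[OF ideal_a_zero])
  then show "ideal_rel (- p) (- p')"
    unfolding ideal_rel_def by (simp add: algebra_simps)
qed

lift_definition times_quot_ring :: "'a quot_ring \<Rightarrow> 'a quot_ring \<Rightarrow> 'a quot_ring" is "(*)"
proof -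
  fix p p' s s' :: "(var, 'a) mpoly"
  assume "ideal_rel p p'" "ideal_rel s s'"
  then have "s * (p - p') + p' * (s - s') \<in> ideal_a"
    unfolding ideal_rel_def by (intro ideal_a_add ideal_a_mult)
  then show "ideal_rel (p * s) (p' * s')"
    unfolding ideal_rel_def by (simp add: algebra_simps)
qed

instance
proof
  fix a b c :: "'a quot_ring"
  have eqI: "ideal_rel p p'" if "p = p'" for p p' :: "(var, 'a) mpoly"
    using that by (simp add: ideal_rel_def ideal_a_zero)
  show "a * b * c = a * (b * c)" by transfer (rule eqI, simp add: algebra_simps)
  show "a * b = b * a" by transfer (rule eqI, simp add: algebra_simps)
  show "1 * a = a" by transfer (rule eqI, simp)
  show "(a + b) * c = a * c + b * c" by transfer (rule eqI, simp add: algebra_simps)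
  show "a + b + c = a + (b + c)" by transfer (rule eqI, simp add: algebra_simps)
  show "a + b = b + a" by transfer (rule eqI, simp add: algebra_simps)
  show "0 + a = a" by transfer (rule eqI, simp)
  show "- a + a = 0" by transfer (rule eqI, simp)
  show "a - b = a + - b" by transfer (rule eqI, simp)
  show "(0 :: 'a quot_ring) \<noteq> 1"
  proof transfer
    have "\<not> ideal_rel (1 :: (var, 'a) mpoly) 0"
      by (simp add: ideal_rel_def one_notin_ideal_a)
    then show "\<not> ideal_rel (0 :: (var, 'a) mpoly) 1"
      using equivp_symp[OF equivp_ideal_rel] by blast
  qed
qed

end

end

theory Submission
  imports Defs "HOL-Library.Countable_Set"
begin

text \<open>
  The Koszul complex \<open>K\<close> of \<open>R = S / \<aa>\<close> has a basis of cells \<open>x\<^sup>u e_I\<close> with \<open>x\<^sup>u \<notin> \<aa>\<close>. Contracting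
  one variable after the other shows that every cycle is homologous to a sum of cycles whose
  monomials lie in prescribed ideals, and for a suitable choice of representatives all products of
  cycles of positive degree vanish.

  If \<open>R\<close> were Golod, the dimension of \<open>Tor\<^sub>5\<^sup>R(k, k)\<close> would be the rank in degree 5 of \<open>K \<otimes> T(V)\<close>,
  where \<open>V\<close> is the homology of \<open>K\<close> in positive degrees, shifted by 1. As products are
  trivial, this module carries a differential which, up to degree 5, makes it the beginning of a
  free resolution of \<open>k\<close>. But the Massey product of the classes of \<open>m_a\<close>, \<open>m_b\<close> and \<open>m_c\<close>
  makes one of the generators in degree 5 redundant, so the dimension is smaller.

  In the Taylor resolution, the Massey product is detected by a cocycle: colour the generators by
  the classes \<open>{m_a, m_ca, m_bc_a}\<close>, \<open>{m_ab, m_ab_c}\<close>, \<open>{m_b, m_bc}\<close>, \<open>{m_c}\<close> and pull back the top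
  form of the simplex whose vertices are the four colours.
\<close>

section \<open>Linear algebra of free modules\<close>

text \<open>Degree 5 is the first place where the triple product can be felt: classes of degree 1
  have their Massey product in \<open>H_4\<close>, and a class of degree 4 gives a generator of
  \<open>T(V)\<close> in degree 5. Generators of \<open>V\<close> have degree at least 2 after the
  shift, so words of at most two letters reach degree 5, and a bounding chain for each product of
  two letters is the only correction to the differential. No Betti number is computed. The rank in
  degree 5 and the coefficient of the Golod series are the same polynomial in the unknown Betti
  numbers, so a strict upper bound for the dimension of Tor is all that is required. Comparison with
  a true resolution embeds Tor in degree 5 into the degree 5 term of any partial resolution tensored
  with \<open>k\<close>; the bound drops by one when a generator is dropped. The Koszul and the
  Taylor computations are independent of each other: the Massey product is realised once in each
  model, and no quasi-isomorphism between them is used.\<close>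

lemma lookup_smul [simp]:
  "Poly_Mapping.lookup (smul c u) b = c * Poly_Mapping.lookup u b"
  unfolding smul_def by (simp add: Poly_Mapping.map.rep_eq when_def)

lemma keys_smul: "Poly_Mapping.keys (smul c u) \<subseteq> Poly_Mapping.keys u"
  by (auto simp: in_keys_iff)

lemma smul_add_right: "smul c (u + w) = smul c u + smul c w"
  by (rule poly_mapping_eqI) (simp add: lookup_add algebra_simps)

lemma smul_add_left: "smul (c + d) u = smul c u + smul d u"
  by (rule poly_mapping_eqI) (simp add: lookup_add algebra_simps)

lemma smul_smul [simp]: "smul c (smul d u) = smul (c * d) u"
  by (rule poly_mapping_eqI) (simp add: algebra_simps)

lemma smul_one [simp]: "smul 1 u = u"
  by (rule poly_mapping_eqI) simp

lemma smul_zero_left [simp]: "smul 0 u = 0"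
  by (rule poly_mapping_eqI) simp

lemma smul_zero_right [simp]: "smul c 0 = 0"
  by (rule poly_mapping_eqI) simp

lemma smul_minus_left: "smul (- c) u = - smul c u"
  by (rule poly_mapping_eqI) simp

lemma smul_minus_right: "smul c (- u) = - smul c u"
  by (rule poly_mapping_eqI) simp

lemma smul_single [simp]: "smul c (Poly_Mapping.single b d) = Poly_Mapping.single b (c * d)"
  by (rule poly_mapping_eqI) (simp add: lookup_single when_def)

lemma smul_sum: "smul c (\<Sum>a\<in>A. f a) = (\<Sum>a\<in>A. smul c (f a))"
  by (rule poly_mapping_eqI) (simp add: lookup_sum sum_distrib_left)

lemma module_smul: "module (smul :: 'c::comm_ring_1 \<Rightarrow> ('b \<Rightarrow>\<^sub>0 'c) \<Rightarrow> _)"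
  by standard (simp_all add: smul_add_left smul_add_right)

lemma vector_space_smul: "vector_space (smul :: 'c::field \<Rightarrow> ('b \<Rightarrow>\<^sub>0 'c) \<Rightarrow> _)"
  by standard (simp_all add: smul_add_left smul_add_right)

lemma sum_singles:
  "(\<Sum>b\<in>Poly_Mapping.keys u. Poly_Mapping.single b (Poly_Mapping.lookup u b)) = u"
  by (rule poly_mapping_eqI)
    (auto simp: lookup_sum lookup_single when_def in_keys_iff)

lemma lin_ext_superset:
  assumes "finite K" "Poly_Mapping.keys u \<subseteq> K"
  shows "lin_ext f u = (\<Sum>b\<in>K. smul (Poly_Mapping.lookup u b) (f b))"
  unfolding lin_ext_def
  by (rule sum.mono_neutral_left) (use assms in \<open>auto simp: in_keys_iff\<close>)

lemma lin_ext_zero [simp]: "lin_ext f 0 = 0"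
  by (simp add: lin_ext_def)

lemma lin_ext_add: "lin_ext f (u + w) = lin_ext f u + lin_ext f w"
proof -
  let ?K = "Poly_Mapping.keys u \<union> Poly_Mapping.keys w"
  have "Poly_Mapping.keys (u + w) \<subseteq> ?K" by (rule keys_add)
  then show ?thesis
    by (simp add: lin_ext_superset[of ?K] lookup_add smul_add_left sum.distrib)
qed

lemma lin_ext_smul: "lin_ext f (smul c u) = smul c (lin_ext f u)"
  using keys_smul[of c u]
  by (simp add: lin_ext_superset[of "Poly_Mapping.keys u"] smul_sum)

lemma lin_ext_single [simp]: "lin_ext f (Poly_Mapping.single b c) = smul c (f b)"
  by (simp add: lin_ext_superset[of "{b}"])

lemma lin_ext_uminus: "lin_ext f (- u) = - lin_ext f u"
  using lin_ext_smul[of f "-1" u] by (simp add: smul_minus_left)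

lemma lin_ext_diff: "lin_ext f (u - w) = lin_ext f u - lin_ext f w"
  using lin_ext_add[of f u "- w"] by (simp add: lin_ext_uminus)

lemma lin_ext_sum: "lin_ext f (\<Sum>a\<in>A. g a) = (\<Sum>a\<in>A. lin_ext f (g a))"
  by (induction A rule: infinite_finite_induct) (simp_all add: lin_ext_add)

lemma lin_ext_eqI:
  assumes "\<And>b. b \<in> Poly_Mapping.keys u \<Longrightarrow> f b = g b"
  shows "lin_ext f u = lin_ext g u"
  unfolding lin_ext_def by (simp add: assms)

lemma lin_ext_lin_ext: "lin_ext f (lin_ext g u) = lin_ext (\<lambda>b. lin_ext f (g b)) u"
  by (simp add: lin_ext_def[of g] lin_ext_def[of "\<lambda>b. lin_ext f (g b)"] lin_ext_sum lin_ext_smul)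

lemma lin_ext_ident: "lin_ext (\<lambda>b. Poly_Mapping.single b 1) u = u"
  using sum_singles[of u] by (simp add: lin_ext_def)

lemma lin_ext_fun_add: "lin_ext (\<lambda>b. f b + g b) u = lin_ext f u + lin_ext g u"
  by (simp add: lin_ext_def smul_add_right sum.distrib)

lemma lin_ext_fun_smul: "lin_ext (\<lambda>b. smul c (f b)) u = smul c (lin_ext f u)"
  by (simp add: lin_ext_def smul_sum mult.commute)

lemma lin_ext_fun_zero [simp]: "lin_ext (\<lambda>b. 0) u = 0"
  by (simp add: lin_ext_def)

lemma lookup_lin_ext:
  "Poly_Mapping.lookup (lin_ext f u) a =
     (\<Sum>b\<in>Poly_Mapping.keys u. Poly_Mapping.lookup u b * Poly_Mapping.lookup (f b) a)"
  by (simp add: lin_ext_def lookup_sum)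

lemma free_mod_iff: "u \<in> free_mod B \<longleftrightarrow> (\<forall>b. Poly_Mapping.lookup u b \<noteq> 0 \<longrightarrow> b \<in> B)"
  by (auto simp: free_mod_def in_keys_iff)

lemma free_mod_UNIV [simp]: "free_mod UNIV = UNIV"
  by (auto simp: free_mod_def)

lemma free_mod_zero [simp]: "0 \<in> free_mod B"
  by (simp add: free_mod_iff)

lemma free_mod_add: "u \<in> free_mod B \<Longrightarrow> w \<in> free_mod B \<Longrightarrow> u + w \<in> free_mod B"
  using keys_add[of u w] by (auto simp: free_mod_def)

lemma free_mod_diff: "u \<in> free_mod B \<Longrightarrow> w \<in> free_mod B \<Longrightarrow> u - w \<in> free_mod B"
  using keys_diff[of u w] by (auto simp: free_mod_def)

lemma free_mod_uminus: "u \<in> free_mod B \<Longrightarrow> - u \<in> free_mod B"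
  by (simp add: free_mod_iff)

lemma free_mod_smul: "u \<in> free_mod B \<Longrightarrow> smul c u \<in> free_mod B"
  using keys_smul[of c u] by (auto simp: free_mod_def)

lemma free_mod_sum: "(\<And>a. a \<in> A \<Longrightarrow> f a \<in> free_mod B) \<Longrightarrow> (\<Sum>a\<in>A. f a) \<in> free_mod B"
  by (induction A rule: infinite_finite_induct) (auto intro: free_mod_add)

lemma free_mod_single: "b \<in> B \<Longrightarrow> Poly_Mapping.single b c \<in> free_mod B"
  by (auto simp: free_mod_iff lookup_single when_def)

lemma lin_ext_free_mod:
  "u \<in> free_mod B \<Longrightarrow> (\<And>b. b \<in> B \<Longrightarrow> f b \<in> free_mod C) \<Longrightarrow> lin_ext f u \<in> free_mod C"
  unfolding lin_ext_def by (rule free_mod_sum) (auto simp: free_mod_def intro!: free_mod_smul[unfolded free_mod_def, simplified])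

lemma lin_ext_cong_free_mod:
  "u \<in> free_mod B \<Longrightarrow> (\<And>b. b \<in> B \<Longrightarrow> f b = g b) \<Longrightarrow> lin_ext f u = lin_ext g u"
  by (rule lin_ext_eqI) (auto simp: free_mod_def)

lemma free_mod_subspace:
  "module.subspace (smul :: 'c::comm_ring_1 \<Rightarrow> ('b \<Rightarrow>\<^sub>0 'c) \<Rightarrow> _) (free_mod B)"
  by (simp add: module.subspace_def[OF module_smul] free_mod_add free_mod_smul)

lemma lookup_map [simp]:
  "\<rho> 0 = 0 \<Longrightarrow> Poly_Mapping.lookup (Poly_Mapping.map \<rho> u) b = \<rho> (Poly_Mapping.lookup u b)"
  by (simp add: Poly_Mapping.map.rep_eq when_def)

text \<open>Needed to tensor chain maps and homotopies over \<open>R\<close> with the residue field: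
  both sides are finite sums of products, which \<open>\<rho>\<close> preserves.\<close>

lemma map_lin_ext:
  fixes \<rho> :: "'r::comm_ring_1 \<Rightarrow> 's::comm_ring_1"
  assumes add: "\<And>x y. \<rho> (x + y) = \<rho> x + \<rho> y" and mult: "\<And>x y. \<rho> (x * y) = \<rho> x * \<rho> y"
  shows "Poly_Mapping.map \<rho> (lin_ext f u) = lin_ext (\<lambda>b. Poly_Mapping.map \<rho> (f b)) (Poly_Mapping.map \<rho> u)"
proof (rule poly_mapping_eqI)
  fix a
  have zero: "\<rho> 0 = 0" using add[of 0 0] by simp
  have sum: "\<rho> (\<Sum>b\<in>B. g b) = (\<Sum>b\<in>B. \<rho> (g b))" for B and g :: "_ \<Rightarrow> 'r"
    by (induction B rule: infinite_finite_induct) (simp_all add: add zero)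
  have sub: "Poly_Mapping.keys (Poly_Mapping.map \<rho> u) \<subseteq> Poly_Mapping.keys u"
    by (auto simp: in_keys_iff zero)
  show "Poly_Mapping.lookup (Poly_Mapping.map \<rho> (lin_ext f u)) a =
      Poly_Mapping.lookup (lin_ext (\<lambda>b. Poly_Mapping.map \<rho> (f b)) (Poly_Mapping.map \<rho> u)) a"
    by (simp add: zero lookup_lin_ext sum mult lookup_sum lin_ext_superset[OF finite_keys sub])
qed

section \<open>Bases of quotient spaces\<close>

text \<open>A relation among the images lifts to an element of \<open>V\<close> killed by
  \<open>f\<close>, hence of \<open>B\<close>. The kernel is controlled on \<open>V\<close> only, so
  that \<open>f\<close> may be a chain map restricted to cycles as well as a projection modulo
  \<open>B\<close>.\<close>

lemma (in vector_space_pair) independent_mod_image: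
  assumes f: "Vector_Spaces.linear s1 s2 f" and V: "vs1.subspace V" "C \<subseteq> V"
    and ker: "\<And>z. z \<in> V \<Longrightarrow> f z = 0 \<Longrightarrow> z \<in> B"
    and C: "\<And>c. c \<in> C \<Longrightarrow> c \<notin> vs1.span (B \<union> (C - {c}))"
  shows "inj_on f C" "vs2.independent (f ` C)"
proof -
  interpret f: Vector_Spaces.linear s1 s2 f by (rule f)
  have notin: "f c \<notin> vs2.span (f ` (C - {c}))" if c: "c \<in> C" for c
  proof
    assume "f c \<in> vs2.span (f ` (C - {c}))"
    then obtain y where y: "y \<in> vs1.span (C - {c})" "f c = f y"
      by (auto simp: f.span_image)
    have "y \<in> V" using y(1) V vs1.span_minimal[of "C - {c}" V] by blast
    then have "c - y \<in> B"
      using y(2) c V by (intro ker) (auto simp: vs1.subspace_diff f.diff)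
    then have "c - y \<in> vs1.span (B \<union> (C - {c}))" by (simp add: vs1.span_base)
    moreover have "y \<in> vs1.span (B \<union> (C - {c}))" using y(1) vs1.span_mono[of "C - {c}" "B \<union> (C - {c})"] by blast
    ultimately have "(c - y) + y \<in> vs1.span (B \<union> (C - {c}))" by (rule vs1.span_add)
    then show False using C[OF c] by simp
  qed
  show inj: "inj_on f C"
  proof (rule inj_onI, rule ccontr)
    fix x y assume "x \<in> C" "y \<in> C" "f x = f y" "x \<noteq> y"
    then have "f x \<in> f ` (C - {x})" by auto
    then show False using notin[OF \<open>x \<in> C\<close>] vs2.span_base[of "f x" "f ` (C - {x})"] by simp
  qed
  show "vs2.independent (f ` C)"
    unfolding vs2.dependent_def
  proof
    assume "\<exists>a\<in>f ` C. a \<in> vs2.span (f ` C - {a})"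
    then obtain c where c: "c \<in> C" "f c \<in> vs2.span (f ` C - {f c})" by auto
    have "f ` C - {f c} \<subseteq> f ` (C - {c})" by auto
    from vs2.span_mono[OF this] show False using notin[OF c(1)] c(2) by blast
  qed
qed

context vector_space
begin

text \<open>Stands in for the projection to the quotient by \<open>B\<close>: the map kills a basis
  of \<open>B\<close> and fixes the remaining vectors of a basis of the whole space.\<close>

lemma exists_linear_kernel:
  assumes "subspace B"
  shows "\<exists>f. Vector_Spaces.linear scale scale f \<and> (\<forall>x. f x = 0 \<longleftrightarrow> x \<in> B)"
proof -
  interpret vector_space_pair scale scale by unfold_locales
  obtain B0 where B0: "B0 \<subseteq> B" "independent B0" "B \<subseteq> span B0"
    using maximal_independent_subset by blast
  have spB0: "span B0 = B" using B0 assms by (metis span_subspace)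
  let ?E = "extend_basis B0"
  have E: "B0 \<subseteq> ?E" "independent ?E" "span ?E = UNIV"
    using extend_basis_superset[OF B0(2)] independent_extend_basis[OF B0(2)] span_extend_basis[OF B0(2)]
    by auto
  obtain f where f: "Vector_Spaces.linear scale scale f" "\<forall>x\<in>?E. f x = (if x \<in> B0 then 0 else x)"
    using linear_independent_extend[OF E(2), of "\<lambda>x. if x \<in> B0 then 0 else x"] by auto
  interpret f: Vector_Spaces.linear scale scale f by (rule f(1))
  have f0: "f x = 0" if "x \<in> B0" for x using that E(1) f(2) by auto
  have "f x = 0" if "x \<in> span B0" for x
    using that by (induction rule: span_induct_alt) (simp_all add: f.add f.scale f0 f.zero)
  then have "f x = 0" if "x \<in> B" for x using that spB0 by simp
  \<comment> \<open>This gives the converse inclusion: if \<open>f x = 0\<close>, then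
    \<open>x = x - f x\<close> lies in \<open>B\<close>.\<close>
  moreover have "x - f x \<in> B" for x
  proof -
    have "x \<in> span ?E" using E by simp
    then show ?thesis
    proof (induction rule: span_induct_alt)
      case base
      show ?case using assms by (simp add: subspace_0)
    next
      case (step c x y)
      have "f x = (if x \<in> B0 then 0 else x)" using f(2) step(1) by blast
      then have "x - f x \<in> B" using B0(1) subspace_0[OF assms] by auto
      then have "scale c (x - f x) + (y - f y) \<in> B"
        using step assms by (simp add: subspace_add subspace_scale)
      then show ?case by (simp add: f.add f.scale algebra_simps)
    qed
  qed
  ultimately have "\<forall>x. f x = 0 \<longleftrightarrow> x \<in> B" by (metis diff_zero)
  then show ?thesis using f(1) by blast
qed

text \<open>Under a map with kernel \<open>B\<close>, the image of \<open>C0\<close> is independent.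
  It is extended to a basis of the image of \<open>V\<close>, and the new vectors are lifted to
  \<open>V\<close>.\<close>

lemma basis_modulo_extend:
  assumes B: "subspace B" "B \<subseteq> V" and V: "subspace V"
    and C0: "C0 \<subseteq> V" "\<And>c. c \<in> C0 \<Longrightarrow> c \<notin> span (B \<union> (C0 - {c}))"
  shows "\<exists>C. C0 \<subseteq> C \<and> basis_modulo scale V B C"
proof -
  interpret vector_space_pair scale scale by unfold_locales
  obtain f where f: "Vector_Spaces.linear scale scale f" and ker: "\<And>x. f x = 0 \<longleftrightarrow> x \<in> B"
    using exists_linear_kernel[OF B(1)] by blast
  interpret f: Vector_Spaces.linear scale scale f by (rule f)
  have C0': "inj_on f C0" "independent (f ` C0)"
    using independent_mod_image[OF f V C0(1) iffD1[OF ker] C0(2)] by blast+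
  obtain E where E: "f ` C0 \<subseteq> E" "E \<subseteq> f ` V" "independent E" "f ` V \<subseteq> span E"
    using maximal_independent_subset_extend[of "f ` C0" "f ` V"] C0' C0(1) by blast
  define C where "C = C0 \<union> inv_into V f ` (E - f ` C0)"
  have fC: "f ` C = E"
  proof -
    have "f ` inv_into V f ` (E - f ` C0) = E - f ` C0"
      using E(2) by (intro image_inv_into_cancel[OF refl]) auto
    then show ?thesis using E(1) by (auto simp: C_def image_Un)
  qed
  have CZ: "C \<subseteq> V" using C0(1) E(2) inv_into_into[of _ f V] unfolding C_def by blast
  have inj: "inj_on f C"
    unfolding C_def
  proof (subst inj_on_Un, intro conjI)
    show "inj_on f C0" by (rule C0'(1))
    have fi: "f (inv_into V f y) = y" if "y \<in> E" for y using that E(2) by (auto intro: f_inv_into_f)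
    show "inj_on f (inv_into V f ` (E - f ` C0))"
      by (rule inj_on_imageI) (auto simp: inj_on_def fi)
    show "f ` (C0 - inv_into V f ` (E - f ` C0)) \<inter> f ` (inv_into V f ` (E - f ` C0) - C0) = {}"
      using fi by auto
  qed
  have "span (B \<union> C) = V"
  proof (rule span_subspace)
    show "V \<subseteq> span (B \<union> C)"
    proof
      fix z assume z: "z \<in> V"
      then have "f z \<in> f ` span C" using E(4) fC by (auto simp: f.span_image[symmetric])
      then obtain y where y: "y \<in> span C" "f z = f y" by blast
      then have "z - y \<in> B" by (simp add: ker[symmetric] f.diff)
      then have "z - y \<in> span (B \<union> C)" by (simp add: span_base)
      moreover have "y \<in> span (B \<union> C)" using y(1) span_mono[of C "B \<union> C"] by blast
      ultimately have "(z - y) + y \<in> span (B \<union> C)" by (rule span_add)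
      then show "z \<in> span (B \<union> C)" by simp
    qed
  qed (use B CZ V in auto)
  moreover have "c \<notin> span (B \<union> (C - {c}))" if c: "c \<in> C" for c
  proof
    assume "c \<in> span (B \<union> (C - {c}))"
    then have "f c \<in> span (f ` (B \<union> (C - {c})))" by (auto simp: f.span_image)
    also have "f ` (B \<union> (C - {c})) \<subseteq> insert 0 (E - {f c})"
    proof -
      have "f ` (C - {c}) = E - {f c}" using inj_on_image_set_diff[OF inj, of C "{c}"] c fC by auto
      moreover have "f ` B \<subseteq> {0}" using ker by blast
      ultimately show ?thesis by (auto simp: image_Un)
    qed
    then have "span (f ` (B \<union> (C - {c}))) \<subseteq> span (E - {f c})"
      using span_mono[of "f ` (B \<union> (C - {c}))" "insert 0 (E - {f c})"] by simp
    finally have "f c \<in> span (E - {f c})" .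
    moreover have "f c \<in> E" using fC c by blast
    ultimately show False using E(3) unfolding dependent_def by blast
  qed
  ultimately have "basis_modulo scale V B C" using CZ by (auto simp: basis_modulo_def)
  then show ?thesis by (auto simp: C_def)
qed

text \<open>A map with kernel \<open>B\<close> turns \<open>C\<close> into an independent set of the
  same size inside the span of the image of \<open>D\<close>, where the usual exchange bound
  applies.\<close>

lemma basis_modulo_card_le:
  assumes B: "subspace B" and V: "subspace V" and C: "basis_modulo scale V B C"
    and D: "finite D" "V \<subseteq> span (B \<union> D)"
  shows "finite C \<and> card C \<le> card D"
proof -
  interpret vector_space_pair scale scale by unfold_locales
  obtain f where f: "Vector_Spaces.linear scale scale f" and ker: "\<And>x. f x = 0 \<longleftrightarrow> x \<in> B"
    using exists_linear_kernel[OF B] by blast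
  interpret f: Vector_Spaces.linear scale scale f by (rule f)
  have C': "C \<subseteq> V" and C'': "\<And>c. c \<in> C \<Longrightarrow> c \<notin> span (B \<union> (C - {c}))"
    using C by (simp_all add: basis_modulo_def)
  have inj: "inj_on f C" and ind: "independent (f ` C)"
    using independent_mod_image[OF f V C' iffD1[OF ker] C''] by blast+
  have "f ` C \<subseteq> f ` span (B \<union> D)" using C' D(2) by blast
  also have "\<dots> = span (f ` (B \<union> D))" by (simp add: f.span_image)
  also have "\<dots> \<subseteq> span (f ` D)"
  proof -
    have "f ` (B \<union> D) \<subseteq> insert 0 (f ` D)" using ker by blast
    from span_mono[OF this] show ?thesis by simp
  qed
  finally have "finite (f ` C) \<and> card (f ` C) \<le> card (f ` D)"
    using independent_span_bound[of "f ` D" "f ` C"] ind D(1) by blast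
  then show ?thesis
    using inj D(1) card_image_le[of D f] by (auto simp: card_image finite_image_iff)
qed

text \<open>The choice in the definition of \<open>quot_dim\<close> is immaterial: any two bases
  modulo \<open>B\<close> bound each other's size.\<close>

lemma quot_dim_eq_card:
  assumes "subspace B" "subspace V" "basis_modulo scale V B C" "finite C"
  shows "quot_dim scale V B = card C"
proof -
  define D where "D = (SOME D. basis_modulo scale V B D)"
  have D: "basis_modulo scale V B D" unfolding D_def using assms(3) by (rule someI)
  have "finite D" "card D \<le> card C"
    using basis_modulo_card_le[OF assms(1,2) D, of C] assms(3,4) by (auto simp: basis_modulo_def)
  moreover have "card C \<le> card D"
    using basis_modulo_card_le[OF assms(1,2,3) \<open>finite D\<close>] D by (auto simp: basis_modulo_def)
  ultimately show ?thesis by (simp add: quot_dim_def flip: D_def)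
qed

lemma basis_modulo_finite:
  assumes "subspace B" "subspace V" "basis_modulo scale V B C"
    and "finite D" "V \<subseteq> span (B \<union> D)"
  shows "finite C"
  using basis_modulo_card_le assms by blast

text \<open>The bound also covers infinite quotients, for which \<^const>\<open>quot_dim\<close> is 0.\<close>

lemma quot_dim_le:
  assumes B: "subspace B" "B \<subseteq> V" and V: "subspace V"
    and t: "vector_space t" and f: "Vector_Spaces.linear scale t f"
    and ker: "\<And>z. z \<in> V \<Longrightarrow> f z = 0 \<Longrightarrow> z \<in> B"
    and D: "finite D" "f ` V \<subseteq> module.span t D"
  shows "quot_dim scale V B \<le> card D"
proof -
  interpret t: vector_space t by (rule t)
  interpret vector_space_pair scale t by unfold_locales
  define C where "C = (SOME C. basis_modulo scale V B C)"
  have C: "basis_modulo scale V B C"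
    using basis_modulo_extend[OF B V, of "{}"] by (simp add: C_def someI_ex)
  have C': "C \<subseteq> V" and C'': "\<And>c. c \<in> C \<Longrightarrow> c \<notin> span (B \<union> (C - {c}))"
    using C by (simp_all add: basis_modulo_def)
  have "inj_on f C" "t.independent (f ` C)"
    using independent_mod_image[OF f V C' ker C''] by blast+
  moreover have "f ` C \<subseteq> t.span D" using C' D by blast
  ultimately show ?thesis
    using t.independent_span_bound[of D "f ` C"] D(1) by (simp add: quot_dim_def card_image flip: C_def)
qed

end

lemma span_singles_eq_free_mod:
  assumes "finite A"
  shows "module.span (smul :: 'k::field \<Rightarrow> ('b \<Rightarrow>\<^sub>0 'k) \<Rightarrow> _) ((\<lambda>a. Poly_Mapping.single a 1) ` A) = free_mod A"
proof -
  interpret vector_space "smul :: 'k \<Rightarrow> ('b \<Rightarrow>\<^sub>0 'k) \<Rightarrow> _" by (rule vector_space_smul)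
  have "u \<in> span ((\<lambda>a. Poly_Mapping.single a 1) ` A)" if u: "u \<in> free_mod A" for u :: "'b \<Rightarrow>\<^sub>0 'k"
  proof -
    have "u = (\<Sum>b\<in>Poly_Mapping.keys u. smul (Poly_Mapping.lookup u b) (Poly_Mapping.single b 1))"
      by (simp add: sum_singles)
    also have "\<dots> \<in> span ((\<lambda>a. Poly_Mapping.single a 1) ` A)"
      using u by (intro span_sum span_scale span_base) (auto simp: free_mod_def)
    finally show ?thesis .
  qed
  then show ?thesis
    by (intro span_subspace) (auto simp: free_mod_subspace free_mod_single)
qed

section \<open>The Koszul algebra\<close>

text \<open>Additive identities need only be checked on single terms; nested once per argument, this
  reduces multilinear identities to basis vectors.\<close>

lemma poly_mapping_linear_induct [case_names single add]:
  assumes "\<And>b c. P (Poly_Mapping.single b c)" and "\<And>u w. P u \<Longrightarrow> P w \<Longrightarrow> P (u + w)"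
  shows "P (u :: 'b \<Rightarrow>\<^sub>0 'c::comm_monoid_add)"
proof -
  have zero: "P 0" using assms(1)[of undefined 0] by simp
  have "P (\<Sum>b\<in>B. Poly_Mapping.single b (f b))" if "finite B" for B and f :: "'b \<Rightarrow> 'c"
    using that by (induction B rule: finite_induct) (simp_all add: zero assms)
  from this[of "Poly_Mapping.keys u" "Poly_Mapping.lookup u"] show ?thesis
  proof -
    have "(\<Sum>b\<in>Poly_Mapping.keys u. Poly_Mapping.single b (Poly_Mapping.lookup u b)) = u"
      by (rule poly_mapping_eqI) (auto simp: lookup_sum lookup_single when_def in_keys_iff)
    then show ?thesis
      using \<open>finite (Poly_Mapping.keys u) \<Longrightarrow> P (\<Sum>b\<in>Poly_Mapping.keys u. Poly_Mapping.single b (Poly_Mapping.lookup u b))\<close>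
      by simp
  qed
qed

section \<open>Signs in the exterior algebra\<close>

definition pos_sign :: "'v::linorder \<Rightarrow> 'v set \<Rightarrow> 'r::comm_ring_1" where
  "pos_sign i I = (-1) ^ card {m \<in> I. m < i}"

text \<open>The sign of the permutation that sorts \<open>e_I e_J\<close>, just as
  \<open>pos_sign i I\<close> is the sign of moving \<open>e_i\<close> between the front and its
  place in \<open>e_I\<close>.\<close>

definition shuffle_sign :: "'v::linorder set \<Rightarrow> 'v set \<Rightarrow> 'r::comm_ring_1" where
  "shuffle_sign I J = (-1) ^ card {(m, m'). m \<in> I \<and> m' \<in> J \<and> m' < m}"

lemma pos_sign_square [simp]: "pos_sign i I * pos_sign i I = 1"
  by (simp add: pos_sign_def flip: power_mult_distrib)

lemma pos_sign_remove [simp]: "pos_sign i (I - {i}) = pos_sign i I"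
  unfolding pos_sign_def by (rule arg_cong[where f = "\<lambda>A. (-1) ^ card A"]) auto

lemma pos_sign_insert_self [simp]: "pos_sign i (insert i I) = pos_sign i I"
  unfolding pos_sign_def by (rule arg_cong[where f = "\<lambda>A. (-1) ^ card A"]) auto

lemma pos_sign_Un:
  fixes I J :: "'v::{finite,linorder} set"
  assumes "I \<inter> J = {}"
  shows "pos_sign i (I \<union> J) = pos_sign i I * pos_sign i J"
proof -
  have "{m \<in> I \<union> J. m < i} = {m \<in> I. m < i} \<union> {m \<in> J. m < i}" by auto
  then show ?thesis
    unfolding pos_sign_def using assms
    by (simp add: card_Un_disjoint disjoint_iff power_add)
qed

lemma pos_sign_insert:
  fixes I :: "'v::{finite,linorder} set"
  assumes "j \<notin> I"
  shows "pos_sign i (insert j I) = (if j < i then - pos_sign i I else pos_sign i I :: 'r::comm_ring_1)"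
proof -
  have "{m \<in> {j}. m < i} = (if j < i then {j} else {})" by auto
  then have "pos_sign i {j} = (if j < i then - 1 else 1 :: 'r)" by (simp add: pos_sign_def)
  moreover have "pos_sign i ({j} \<union> I) = pos_sign i {j} * (pos_sign i I :: 'r)"
    using assms by (intro pos_sign_Un) auto
  ultimately show ?thesis by auto
qed

lemma shuffle_sign_Un_left:
  fixes I J K :: "'v::{finite,linorder} set"
  assumes "I \<inter> J = {}"
  shows "shuffle_sign (I \<union> J) K = shuffle_sign I K * shuffle_sign J K"
proof -
  have "{(m, m'). m \<in> I \<union> J \<and> m' \<in> K \<and> m' < m} =
      {(m, m'). m \<in> I \<and> m' \<in> K \<and> m' < m} \<union> {(m, m'). m \<in> J \<and> m' \<in> K \<and> m' < m}" by auto
  moreover have "{(m, m'). m \<in> I \<and> m' \<in> K \<and> m' < m} \<inter> {(m, m'). m \<in> J \<and> m' \<in> K \<and> m' < m} = {}"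
    using assms by auto
  ultimately show ?thesis
    unfolding shuffle_sign_def by (simp add: card_Un_disjoint power_add)
qed

lemma shuffle_sign_Un_right:
  fixes I J K :: "'v::{finite,linorder} set"
  assumes "J \<inter> K = {}"
  shows "shuffle_sign I (J \<union> K) = shuffle_sign I J * shuffle_sign I K"
proof -
  have "{(m, m'). m \<in> I \<and> m' \<in> J \<union> K \<and> m' < m} =
      {(m, m'). m \<in> I \<and> m' \<in> J \<and> m' < m} \<union> {(m, m'). m \<in> I \<and> m' \<in> K \<and> m' < m}" by auto
  moreover have "{(m, m'). m \<in> I \<and> m' \<in> J \<and> m' < m} \<inter> {(m, m'). m \<in> I \<and> m' \<in> K \<and> m' < m} = {}"
    using assms by auto
  ultimately show ?thesis
    unfolding shuffle_sign_def by (simp add: card_Un_disjoint power_add)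
qed

lemma shuffle_sign_singleton_left: "shuffle_sign {i} J = pos_sign i J"
proof -
  have "{(m, m'). m \<in> {i} \<and> m' \<in> J \<and> m' < m} = Pair i ` {m \<in> J. m < i}" by auto
  then show ?thesis
    by (simp add: shuffle_sign_def pos_sign_def card_image inj_on_def)
qed

lemma shuffle_sign_singleton_right:
  fixes I :: "'v::{finite,linorder} set"
  assumes "i \<notin> I"
  shows "shuffle_sign I {i} = (-1) ^ card I * pos_sign i I"
proof -
  have "{(m, m'). m \<in> I \<and> m' \<in> {i} \<and> m' < m} = (\<lambda>m. (m, i)) ` {m \<in> I. i < m}" by auto
  then have 1: "shuffle_sign I {i} = (-1) ^ card {m \<in> I. i < m}"
    by (simp add: shuffle_sign_def card_image inj_on_def)
  have "I = {m \<in> I. m < i} \<union> {m \<in> I. i < m}" using assms by (auto, metis linorder_neqE)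
  then have "card I = card {m \<in> I. m < i} + card {m \<in> I. i < m}"
    by (metis (no_types, lifting) card_Un_disjoint disjoint_iff finite mem_Collect_eq not_less_iff_gr_or_eq)
  then show ?thesis
    by (simp add: 1 pos_sign_def power_add mult_ac flip: power_mult_distrib)
qed

lemma shuffle_sign_empty [simp]: "shuffle_sign {} J = 1" "shuffle_sign I {} = 1"
  by (simp_all add: shuffle_sign_def)

section \<open>Contraction, product and grade involution on the exterior algebra\<close>

definition partial :: "'v::linorder \<Rightarrow> ('v set \<Rightarrow>\<^sub>0 'r::comm_ring_1) \<Rightarrow> ('v set \<Rightarrow>\<^sub>0 'r)" where
  "partial i = lin_ext (\<lambda>I. if i \<in> I then Poly_Mapping.single (I - {i}) (pos_sign i I) else 0)"

text \<open>Writing the Koszul differential as a combination of contractions reduces the Leibniz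
  rule and \<open>d d = 0\<close> to statements about the operators \<open>partial i\<close>, in
  which the elements \<open>x i\<close> no longer occur.\<close>

definition kdiff :: "('v::{finite,linorder} \<Rightarrow> 'r::comm_ring_1) \<Rightarrow> ('v set \<Rightarrow>\<^sub>0 'r) \<Rightarrow> ('v set \<Rightarrow>\<^sub>0 'r)" where
  "kdiff x u = (\<Sum>i\<in>UNIV. smul (x i) (partial i u))"

definition kmul :: "('v::{finite,linorder} set \<Rightarrow>\<^sub>0 'r::comm_ring_1) \<Rightarrow> ('v set \<Rightarrow>\<^sub>0 'r) \<Rightarrow> ('v set \<Rightarrow>\<^sub>0 'r)" where
  "kmul u w = lin_ext (\<lambda>I. lin_ext (\<lambda>J. if I \<inter> J = {}
     then Poly_Mapping.single (I \<union> J) (shuffle_sign I J) else 0) w) u"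

text \<open>Carries the Koszul signs, so that the Leibniz rule can be stated for inhomogeneous
  elements as well.\<close>

definition involute :: "('v::finite set \<Rightarrow>\<^sub>0 'r::comm_ring_1) \<Rightarrow> ('v set \<Rightarrow>\<^sub>0 'r)" where
  "involute = lin_ext (\<lambda>I. Poly_Mapping.single I ((-1) ^ card I))"

definition kdeg :: "nat \<Rightarrow> ('v::finite set \<Rightarrow>\<^sub>0 'r::comm_ring_1) set" where
  "kdeg n = free_mod {I. card I = n}"

lemma elems_koszul: "elems (koszul q) = UNIV"
  by (simp add: koszul_def ext_dga_def)

lemma component_koszul: "component (koszul q) n = kdeg n"
  by (simp add: koszul_def ext_dga_def kdeg_def)

lemma mul_koszul: "mul (koszul q) = kmul"
  by (intro ext) (simp add: koszul_def ext_dga_def kmul_def shuffle_sign_def cong: if_cong)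

lemma diff_koszul: "diff (koszul q) = kdiff (\<lambda>i. q (var_poly i))"
proof
  fix u
  have "diff (koszul q) u = lin_ext (\<lambda>I. \<Sum>i\<in>UNIV. smul (q (var_poly i))
      (if i \<in> I then Poly_Mapping.single (I - {i}) (pos_sign i I) else 0)) u"
    unfolding koszul_def ext_dga_def dga.simps
    by (intro lin_ext_eqI) (auto simp: pos_sign_def mult.commute intro!: sum.mono_neutral_cong_left)
  also have "\<dots> = (\<Sum>i\<in>UNIV. smul (q (var_poly i)) (partial i u))"
    unfolding lin_ext_def partial_def
    by (subst smul_sum, subst sum.swap) (simp add: smul_sum mult.commute)
  finally show "diff (koszul q) u = kdiff (\<lambda>i. q (var_poly i)) u"
    by (simp add: kdiff_def)
qed

lemma partial_add: "partial i (u + w) = partial i u + partial i w"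
  by (simp add: partial_def lin_ext_add)

lemma partial_smul: "partial i (smul c u) = smul c (partial i u)"
  by (simp add: partial_def lin_ext_smul)

lemma partial_zero [simp]: "partial i 0 = 0"
  by (simp add: partial_def)

lemma partial_sum: "partial i (\<Sum>a\<in>A. f a) = (\<Sum>a\<in>A. partial i (f a))"
  by (simp add: partial_def lin_ext_sum)

lemma partial_single:
  "partial i (Poly_Mapping.single I c) = (if i \<in> I then Poly_Mapping.single (I - {i}) (c * pos_sign i I) else 0)"
  by (simp add: partial_def)

lemma kdiff_add: "kdiff x (u + w) = kdiff x u + kdiff x w"
  by (simp add: kdiff_def partial_add smul_add_right sum.distrib)

lemma kdiff_smul: "kdiff x (smul c u) = smul c (kdiff x u)"
  by (simp add: kdiff_def partial_smul smul_sum mult.commute)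

lemma kdiff_zero [simp]: "kdiff x 0 = 0"
  by (simp add: kdiff_def)

lemma kdiff_uminus: "kdiff x (- u) = - kdiff x u"
  using kdiff_smul[of x "-1" u] by (simp add: smul_minus_left)

lemma kdiff_diff: "kdiff x (u - w) = kdiff x u - kdiff x w"
  using kdiff_add[of x u "- w"] by (simp add: kdiff_uminus)

lemma kmul_add_left: "kmul (u + u') w = kmul u w + kmul u' w"
  by (simp add: kmul_def lin_ext_add)

lemma kmul_add_right: "kmul u (w + w') = kmul u w + kmul u w'"
  by (simp add: kmul_def lin_ext_add lin_ext_fun_add)

lemma kmul_smul_left: "kmul (smul c u) w = smul c (kmul u w)"
  by (simp add: kmul_def lin_ext_smul)

lemma kmul_smul_right: "kmul u (smul c w) = smul c (kmul u w)"
  by (simp add: kmul_def lin_ext_smul lin_ext_fun_smul)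

lemma kmul_zero_left [simp]: "kmul 0 w = 0"
  by (simp add: kmul_def)

lemma kmul_zero_right [simp]: "kmul u 0 = 0"
  by (simp add: kmul_def)

lemma kmul_uminus_left: "kmul (- u) w = - kmul u w"
  using kmul_smul_left[of "-1" u w] by (simp add: smul_minus_left)

lemma kmul_uminus_right: "kmul u (- w) = - kmul u w"
  using kmul_smul_right[of u "-1" w] by (simp add: smul_minus_left)

lemma kmul_diff_left: "kmul (u - u') w = kmul u w - kmul u' w"
  using kmul_add_left[of u "- u'" w] by (simp add: kmul_uminus_left)

lemma kmul_sum_left: "kmul (\<Sum>a\<in>A. f a) w = (\<Sum>a\<in>A. kmul (f a) w)"
  by (induction A rule: infinite_finite_induct) (simp_all add: kmul_add_left)

lemma kmul_sum_right: "kmul w (\<Sum>a\<in>A. f a) = (\<Sum>a\<in>A. kmul w (f a))"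
  by (induction A rule: infinite_finite_induct) (simp_all add: kmul_add_right)

lemma kmul_single: "kmul (Poly_Mapping.single I a) (Poly_Mapping.single J b) =
    (if I \<inter> J = {} then Poly_Mapping.single (I \<union> J) (a * b * shuffle_sign I J) else 0)"
  by (simp add: kmul_def mult.assoc)

lemma involute_add: "involute (u + w) = involute u + involute w"
  by (simp add: involute_def lin_ext_add)

lemma involute_smul: "involute (smul c u) = smul c (involute u)"
  by (simp add: involute_def lin_ext_smul)

lemma involute_single: "involute (Poly_Mapping.single I c) = Poly_Mapping.single I (c * (-1) ^ card I)"
  by (simp add: involute_def)

lemma involute_zero [simp]: "involute 0 = 0"
  by (simp add: involute_def)

lemma involute_sum: "involute (\<Sum>a\<in>A. f a) = (\<Sum>a\<in>A. involute (f a))"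
  by (simp add: involute_def lin_ext_sum)

lemma lookup_involute: "Poly_Mapping.lookup (involute u) I = (-1) ^ card I * Poly_Mapping.lookup u I"
  by (induction u rule: poly_mapping_linear_induct)
    (simp_all add: involute_single involute_add lookup_add lookup_single when_def algebra_simps)

lemma involute_involute [simp]: "involute (involute u) = u"
  by (rule poly_mapping_eqI) (simp add: lookup_involute mult.assoc[symmetric] flip: power_mult_distrib)

lemma involute_kdeg: "u \<in> kdeg n \<Longrightarrow> involute u = smul ((-1) ^ n) u"
proof (rule poly_mapping_eqI)
  fix I
  assume "u \<in> kdeg n"
  then show "Poly_Mapping.lookup (involute u) I = Poly_Mapping.lookup (smul ((-1) ^ n) u) I"
    by (cases "Poly_Mapping.lookup u I = 0") (auto simp: lookup_involute kdeg_def free_mod_iff)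
qed

lemma involute_kmul: "involute (kmul u w) = kmul (involute u) (involute w)"
proof (induction u rule: poly_mapping_linear_induct)
  case (single I a)
  show ?case
  proof (induction w rule: poly_mapping_linear_induct)
    case (single J b)
    show ?case
      by (cases "I \<inter> J = {}") (simp_all add: involute_single kmul_single card_Un_disjoint power_add mult_ac)
  qed (simp add: involute_add kmul_add_right)
qed (simp add: involute_add kmul_add_left)

lemma kmul_assoc: "kmul (kmul u v) w = kmul u (kmul v w)"
proof (induction u rule: poly_mapping_linear_induct)
  case (single I a)
  show ?case
  proof (induction v rule: poly_mapping_linear_induct)
    case (single J b)
    show ?case
    proof (induction w rule: poly_mapping_linear_induct)
      case (single K c)
      show ?case
        by (auto simp: kmul_single Int_Un_distrib Int_Un_distrib2 Un_assoc shuffle_sign_Un_left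
            shuffle_sign_Un_right mult_ac)
    qed (simp add: kmul_add_right)
  qed (simp add: kmul_add_left kmul_add_right)
qed (simp add: kmul_add_left)

lemma kmul_one_left [simp]: "kmul (Poly_Mapping.single {} 1) w = w"
  by (induction w rule: poly_mapping_linear_induct) (simp_all add: kmul_single kmul_add_right)

lemma partial_kmul_single:
  fixes I J :: "'v::{finite,linorder} set" and a b :: "'r::comm_ring_1"
  shows "partial i (kmul (Poly_Mapping.single I a) (Poly_Mapping.single J b)) =
    kmul (partial i (Poly_Mapping.single I a)) (Poly_Mapping.single J b) +
    kmul (involute (Poly_Mapping.single I a)) (partial i (Poly_Mapping.single J b))"
proof -
  have left: "shuffle_sign I J = shuffle_sign (I - {i}) J * (pos_sign i J :: 'r)" if "i \<in> I"
    using shuffle_sign_Un_left[of "I - {i}" "{i}" J] that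
    by (simp add: shuffle_sign_singleton_left insert_absorb)
  have right: "shuffle_sign I J = shuffle_sign I (J - {i}) * ((-1) ^ card I * pos_sign i I :: 'r)"
    if "i \<in> J" "i \<notin> I"
    using shuffle_sign_Un_right[of "J - {i}" "{i}" I] that
    by (simp add: shuffle_sign_singleton_right insert_absorb)
  have sq: "(-1) ^ n * ((-1) ^ n * c) = (c :: 'r)" for n c
    by (simp add: mult.assoc[symmetric] flip: power_mult_distrib)
  have sq': "pos_sign i K * (pos_sign i K * c) = (c :: 'r)" for K c
    by (simp add: mult.assoc[symmetric])
  consider "i \<in> I" "i \<notin> J" | "i \<notin> I" "i \<in> J" | "i \<notin> I" "i \<notin> J" | "i \<in> I" "i \<in> J" by blast
  then show ?thesis
  proof cases
    case 1
    then have "(I - {i}) \<inter> J = {} \<longleftrightarrow> I \<inter> J = {}" "(I - {i}) \<union> J = I \<union> J - {i}" by auto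
    then show ?thesis
      using 1 left by (auto simp: kmul_single partial_single involute_single pos_sign_Un mult_ac sq')
  next
    case 2
    then have "I \<inter> (J - {i}) = {} \<longleftrightarrow> I \<inter> J = {}" "I \<union> (J - {i}) = I \<union> J - {i}" by auto
    then show ?thesis
      using 2 right by (auto simp: kmul_single partial_single involute_single pos_sign_Un mult_ac sq sq')
  next
    case 3
    then show ?thesis by (simp add: kmul_single partial_single)
  next
    \<comment> \<open>The product vanishes here, but if \<open>I\<close> and \<open>J\<close> meet
      only in \<open>i\<close>, neither term on the right has to vanish, and the two must
      cancel.\<close>
    case 4
    show ?thesis
    proof (cases "(I - {i}) \<inter> (J - {i}) = {}")
      case True
      then have e: "(I - {i}) \<inter> J = {}" "I \<inter> (J - {i}) = {}" "(I - {i}) \<union> J = I \<union> J"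
        "I \<union> (J - {i}) = I \<union> J" "I \<inter> J \<noteq> {}" using 4 by auto
      have "shuffle_sign (I - {i}) J = shuffle_sign (I - {i}) (J - {i}) * ((-1) ^ card (I - {i}) * pos_sign i I :: 'r)"
        using shuffle_sign_Un_right[of "J - {i}" "{i}" "I - {i}"] 4
        by (simp add: shuffle_sign_singleton_right insert_absorb)
      moreover have "shuffle_sign I (J - {i}) = shuffle_sign (I - {i}) (J - {i}) * (pos_sign i J :: 'r)"
        using shuffle_sign_Un_left[of "I - {i}" "{i}" "J - {i}"] 4
        by (simp add: shuffle_sign_singleton_left insert_absorb)
      moreover have "(-1) ^ card I = - ((-1) ^ card (I - {i}) :: 'r)"
        using card.remove[OF finite 4(1)] by (metis power_Suc mult_minus1)
      ultimately have "pos_sign i I * shuffle_sign (I - {i}) J + (-1) ^ card I * (pos_sign i J * shuffle_sign I (J - {i})) = (0 :: 'r)"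
        by (simp add: mult_ac sq sq')
      then have "a * b * (pos_sign i I * shuffle_sign (I - {i}) J + (-1) ^ card I * (pos_sign i J * shuffle_sign I (J - {i}))) = 0"
        by (simp only: mult_zero_right)
      then have "a * pos_sign i I * b * shuffle_sign (I - {i}) J + a * (-1) ^ card I * (b * pos_sign i J) * shuffle_sign I (J - {i}) = 0"
        by (simp only: distrib_left mult.assoc mult.left_commute)
      then show ?thesis
        using 4 e by (simp add: kmul_single partial_single involute_single flip: single_add)
    next
      case False
      then have "(I - {i}) \<inter> J \<noteq> {}" "I \<inter> (J - {i}) \<noteq> {}" "I \<inter> J \<noteq> {}" using 4 by auto
      then show ?thesis using 4 by (simp add: kmul_single partial_single involute_single)
    qed
  qed
qed

lemma partial_kmul: "partial i (kmul u w) = kmul (partial i u) w + kmul (involute u) (partial i w)"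
proof (induction u rule: poly_mapping_linear_induct)
  case (single I a)
  show ?case
    by (induction w rule: poly_mapping_linear_induct)
      (simp_all add: partial_kmul_single kmul_add_right partial_add add_ac)
qed (simp add: kmul_add_left partial_add involute_add add_ac)

lemma kdiff_kmul: "kdiff x (kmul u w) = kmul (kdiff x u) w + kmul (involute u) (kdiff x w)"
  by (simp add: kdiff_def partial_kmul kmul_sum_left kmul_sum_right kmul_smul_left kmul_smul_right
      smul_add_right sum.distrib)

lemma partial_partial_self [simp]: "partial i (partial i u) = 0"
  by (induction u rule: poly_mapping_linear_induct) (simp_all add: partial_single partial_add)

lemma partial_commute:
  fixes u :: "'v::{finite,linorder} set \<Rightarrow>\<^sub>0 'r::comm_ring_1"
  shows "partial i (partial j u) = - partial j (partial i u)"
proof (induction u rule: poly_mapping_linear_induct)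
  case (single I c)
  have rem: "pos_sign i (I - {j}) = (if j < i then - pos_sign i I else pos_sign i I :: 'r)"
    if "j \<in> I" for i j :: 'v
  proof -
    have "pos_sign i (insert j (I - {j})) = (if j < i then - pos_sign i (I - {j}) else pos_sign i (I - {j}) :: 'r)"
      by (rule pos_sign_insert) simp
    then show ?thesis using that by (auto simp: insert_absorb)
  qed
  show ?case
  proof (cases "i \<in> I \<and> j \<in> I \<and> i \<noteq> j")
    case True
    then have e: "I - {j} - {i} = I - {i} - {j}" by auto
    have "i < j \<and> \<not> j < i \<or> j < i \<and> \<not> i < j" using True by auto
    with True e show ?thesis
      by (elim disjE conjE) (simp_all add: partial_single rem single_uminus mult_ac)
  qed (auto simp: partial_single)
qed (simp add: partial_add)

text \<open>The terms with \<open>i < j\<close> cancel against those with \<open>j < i\<close>. The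
  vanishing of the diagonal is a separate hypothesis because antisymmetry does not imply it in
  characteristic 2.\<close>

lemma sum_alternating_eq_0:
  fixes f :: "'v::{finite,linorder} \<Rightarrow> 'v \<Rightarrow> 'a::ab_group_add"
  assumes "\<And>i. f i i = 0" and "\<And>i j. f i j = - f j i"
  shows "(\<Sum>i\<in>UNIV. \<Sum>j\<in>UNIV. f i j) = 0"
proof -
  have "f i j = (if i < j then f i j else 0) + (if j < i then f i j else 0)" for i j
    using assms(1) by (cases i j rule: linorder_cases) auto
  then have "(\<Sum>i\<in>UNIV. \<Sum>j\<in>UNIV. f i j) =
      (\<Sum>i\<in>UNIV. \<Sum>j\<in>UNIV. (if i < j then f i j else 0)) + (\<Sum>i\<in>UNIV. \<Sum>j\<in>UNIV. (if j < i then f i j else 0))"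
    by (simp add: sum.distrib[symmetric])
  also have "(\<Sum>i\<in>UNIV. \<Sum>j\<in>UNIV. (if j < i then f i j else 0)) =
      (\<Sum>i\<in>UNIV. \<Sum>j\<in>UNIV. - (if i < j then f i j else 0))"
    by (subst sum.swap) (intro sum.cong refl, auto simp: assms(2)[symmetric])
  finally show ?thesis by (simp add: sum_negf)
qed

lemma kdiff_kdiff [simp]: "kdiff x (kdiff x u) = 0"
proof -
  have "kdiff x (kdiff x u) = (\<Sum>i\<in>UNIV. \<Sum>j\<in>UNIV. smul (x i * x j) (partial i (partial j u)))"
    by (simp add: kdiff_def partial_sum partial_smul smul_sum)
  also have "\<dots> = 0"
  proof (rule sum_alternating_eq_0)
    fix i j
    show "smul (x i * x j) (partial i (partial j u)) = - smul (x j * x i) (partial j (partial i u))"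
      by (subst partial_commute) (simp add: smul_minus_right mult.commute)
  qed simp
  finally show ?thesis .
qed

lemma kdiff_involute: "kdiff x (involute u) = - involute (kdiff x u)"
proof -
  have "partial i (involute u) = - involute (partial i u)" for i
  proof (induction u rule: poly_mapping_linear_induct)
    case (single I c)
    have "(-1) ^ card I = - ((-1) ^ card (I - {i}) :: 'b)" if "i \<in> I"
      using card.remove[OF finite that] by (metis power_Suc mult_minus1)
    then show ?case
      by (auto simp: partial_single involute_single mult_ac simp flip: single_uminus)
  qed (simp add: partial_add involute_add)
  then show ?thesis
    by (simp add: kdiff_def involute_sum involute_smul smul_minus_right sum_negf)
qed

lemma kdeg_zero [simp]: "0 \<in> kdeg n"
  by (simp add: kdeg_def)

lemma kdeg_add: "u \<in> kdeg n \<Longrightarrow> w \<in> kdeg n \<Longrightarrow> u + w \<in> kdeg n"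
  by (simp add: kdeg_def free_mod_add)

lemma kdeg_diff: "u \<in> kdeg n \<Longrightarrow> w \<in> kdeg n \<Longrightarrow> u - w \<in> kdeg n"
  by (simp add: kdeg_def free_mod_diff)

lemma kdeg_uminus: "u \<in> kdeg n \<Longrightarrow> - u \<in> kdeg n"
  by (simp add: kdeg_def free_mod_uminus)

lemma kdeg_smul: "u \<in> kdeg n \<Longrightarrow> smul c u \<in> kdeg n"
  by (simp add: kdeg_def free_mod_smul)

lemma kdeg_sum: "(\<And>a. a \<in> A \<Longrightarrow> f a \<in> kdeg n) \<Longrightarrow> (\<Sum>a\<in>A. f a) \<in> kdeg n"
  by (simp add: kdeg_def free_mod_sum)

lemma kdeg_single: "card I = n \<Longrightarrow> Poly_Mapping.single I c \<in> kdeg n"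
  by (simp add: kdeg_def free_mod_single)

lemma involute_mem_kdeg: "u \<in> kdeg n \<Longrightarrow> involute u \<in> kdeg n"
  by (simp add: involute_kdeg kdeg_smul)

lemma kdiff_mem_kdeg:
  assumes "u \<in> kdeg (Suc n)"
  shows "kdiff x u \<in> kdeg n"
proof -
  have "partial i u \<in> kdeg n" for i
    using assms unfolding partial_def kdeg_def
    by (rule lin_ext_free_mod) (auto intro: free_mod_single)
  then show ?thesis by (auto simp: kdiff_def intro: kdeg_sum kdeg_smul)
qed

lemma kdiff_kdeg_0:
  assumes "u \<in> kdeg 0"
  shows "kdiff x u = 0"
proof -
  have "partial i u = 0" for i
    using assms unfolding partial_def lin_ext_def kdeg_def free_mod_def
    by (intro sum.neutral) auto
  then show ?thesis by (simp add: kdiff_def)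
qed

lemma kmul_mem_kdeg:
  assumes "u \<in> kdeg m" "w \<in> kdeg n"
  shows "kmul u w \<in> kdeg (m + n)"
  unfolding kmul_def kdeg_def
proof (rule lin_ext_free_mod[OF assms(1)[unfolded kdeg_def]])
  fix I :: "'a set" assume I: "I \<in> {I. card I = m}"
  show "lin_ext (\<lambda>J. if I \<inter> J = {} then Poly_Mapping.single (I \<union> J) (shuffle_sign I J) else 0) w
      \<in> free_mod {I. card I = m + n}"
  proof (rule lin_ext_free_mod[OF assms(2)[unfolded kdeg_def]])
    fix J :: "'a set" assume "J \<in> {J. card J = n}"
    then show "(if I \<inter> J = {} then Poly_Mapping.single (I \<union> J) (shuffle_sign I J) else 0)
        \<in> free_mod {I. card I = m + n}"
      using I by (simp add: card_Un_disjoint free_mod_single)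
  qed
qed

text \<open>Overlapping index sets contribute nothing to a product anyway, so only disjoint pairs
  have to annihilate each other.\<close>

lemma kmul_eq_0I:
  assumes "\<And>I J. I \<inter> J = {} \<Longrightarrow> Poly_Mapping.lookup u I * Poly_Mapping.lookup w J = 0"
  shows "kmul u w = 0"
  unfolding kmul_def lin_ext_def smul_sum
  by (intro sum.neutral ballI) (simp add: mult.assoc[symmetric] assms)

lemma lookup_kdiff:
  "Poly_Mapping.lookup (kdiff x u) I =
     (\<Sum>i\<in>- I. pos_sign i I * x i * Poly_Mapping.lookup u (insert i I))"
proof -
  have "Poly_Mapping.lookup (partial i u) I =
      (if i \<in> I then 0 else pos_sign i I * Poly_Mapping.lookup u (insert i I))" for i
    by (induction u rule: poly_mapping_linear_induct)
      (auto simp: partial_single partial_add lookup_add lookup_single when_def algebra_simps)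
  then have "Poly_Mapping.lookup (kdiff x u) I =
      (\<Sum>i\<in>UNIV. if i \<in> I then 0 else pos_sign i I * x i * Poly_Mapping.lookup u (insert i I))"
    by (auto simp: kdiff_def lookup_sum mult_ac intro!: sum.cong)
  then show ?thesis
    by (simp add: sum.If_cases Compl_eq)
qed

section \<open>The monomial basis of the quotient ring\<close>

definition gens :: "var monomial set" where
  "gens = {m_a, m_b, m_c, m_ab, m_bc, m_ca, m_ab_c, m_bc_a}"

abbreviation ex :: "var monomial \<Rightarrow> var \<Rightarrow> nat" where
  "ex \<equiv> Poly_Mapping.lookup"

abbreviation ev :: "var \<Rightarrow> var monomial" where
  "ev i \<equiv> Poly_Mapping.single i 1"

text \<open>The clauses belong to the eight generators in the order a, b, c, ab, bc, ca, ab#c, bc#a.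
  In this unfolded form linear arithmetic decides membership in the ideal.\<close>

definition in_a :: "var monomial \<Rightarrow> bool" where
  "in_a u \<longleftrightarrow> 1 \<le> ex u X1 \<and> 2 \<le> ex u X2 \<or> 1 \<le> ex u Y1 \<and> 2 \<le> ex u Y2 \<or> 3 \<le> ex u Z \<or>
     1 \<le> ex u X1 \<and> 1 \<le> ex u X2 \<and> 1 \<le> ex u Y1 \<and> 1 \<le> ex u Y2 \<or>
     2 \<le> ex u Y2 \<and> 2 \<le> ex u Z \<or> 2 \<le> ex u X2 \<and> 2 \<le> ex u Z \<or>
     1 \<le> ex u X1 \<and> 1 \<le> ex u Y1 \<and> 1 \<le> ex u Z \<or>
     2 \<le> ex u X2 \<and> 2 \<le> ex u Y2 \<and> 1 \<le> ex u Z"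

lemma ex_add [simp]: "ex (u + v) i = ex u i + ex v i"
  by (rule lookup_add)

lemma ex_diff [simp]: "ex (u - v) i = ex u i - ex v i"
  by (simp add: minus_poly_mapping.rep_eq)

lemma ex_single: "ex (Poly_Mapping.single i n) j = (if i = j then n else 0)"
  by (simp add: lookup_single when_def)

lemma UNIV_var: "(UNIV :: var set) = {X1, X2, Y1, Y2, Z}"
  using var.exhaust by blast

lemma all_var: "(\<forall>i. P i) \<longleftrightarrow> P X1 \<and> P X2 \<and> P Y1 \<and> P Y2 \<and> P Z"
  by (metis var.exhaust)

lemmas gen_defs = m_a_def m_b_def m_c_def m_ab_def m_bc_def m_ca_def m_ab_c_def m_bc_a_def

lemma in_a_iff: "in_a u \<longleftrightarrow> (\<exists>g\<in>gens. mono_dvd g u)"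
  by (simp add: in_a_def gens_def mono_dvd_def all_var gen_defs ex_single numeral_2_eq_2)

declare One_nat_def [simp del]

lemma in_a_mono:
  assumes "in_a u" and le: "\<And>i. ex u i \<le> ex v i"
  shows "in_a v"
proof -
  obtain g where g: "g \<in> gens" "mono_dvd g u" using assms(1) by (auto simp: in_a_iff)
  have "mono_dvd g v"
    unfolding mono_dvd_def
  proof
    fix i
    have "ex g i \<le> ex u i" using g(2) by (simp add: mono_dvd_def)
    also have "\<dots> \<le> ex v i" by (rule le)
    finally show "ex g i \<le> ex v i" .
  qed
  then show ?thesis using g(1) by (auto simp: in_a_iff)
qed

lemma in_a_add: "in_a u \<Longrightarrow> in_a (u + v)"
  by (erule in_a_mono) simp

lemma mono_dvd_imp_add: "mono_dvd g u \<Longrightarrow> u = (u - g) + g"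
  by (rule poly_mapping_eqI) (simp add: mono_dvd_def lookup_add minus_poly_mapping.rep_eq)

text \<open>Specific to monomial ideals: every term of a multiple of a generator is divisible by
  that generator, and conversely each term is on its own a multiple of a generator.\<close>

lemma ideal_a_iff: "p \<in> (ideal_a :: (var, 'k::field) mpoly set) \<longleftrightarrow> (\<forall>u\<in>Poly_Mapping.keys p. in_a u)"
proof
  assume "p \<in> ideal_a"
  then show "\<forall>u\<in>Poly_Mapping.keys p. in_a u"
    unfolding ideal_a_def ideal_gen_def gens_def[symmetric]
  proof (induction rule: module.span_induct_alt[OF module_times, consumes 1])
    case 1
    show ?case by simp
  next
    case (2 c x y)
    from 2(1) obtain g where g: "g \<in> gens" "x = mono_poly g" by blast
    have "in_a u" if u: "u \<in> Poly_Mapping.keys (c * x)" for u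
    proof -
      obtain v where "u = v + g" using u keys_mult[of c x] unfolding g(2) by fastforce
      then have "mono_dvd g u" by (simp add: mono_dvd_def)
      then show ?thesis using g(1) in_a_iff by blast
    qed
    then show ?case using 2(2) keys_add[of "c * x" y] by auto
  qed
next
  assume *: "\<forall>u\<in>Poly_Mapping.keys p. in_a u"
  have "Poly_Mapping.single u c \<in> (ideal_a :: (var, 'k) mpoly set)" if "in_a u" for u c
  proof -
    from that obtain g where g: "g \<in> gens" "mono_dvd g u" by (auto simp: in_a_iff)
    then have "Poly_Mapping.single u c = Poly_Mapping.single (u - g) c * mono_poly g"
      by (metis mono_dvd_imp_add mult_single mult.right_neutral)
    moreover have "mono_poly g \<in> (ideal_a :: (var, 'k) mpoly set)"
      using g(1) unfolding ideal_a_def ideal_gen_def gens_def[symmetric]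
      by (intro module.span_base[OF module_times]) auto
    ultimately show ?thesis by (simp add: ideal_a_mult)
  qed
  then have "(\<Sum>u\<in>Poly_Mapping.keys p. Poly_Mapping.single u (Poly_Mapping.lookup p u)) \<in> ideal_a"
    using * unfolding ideal_a_def ideal_gen_def
    by (intro module.span_sum[OF module_times]) auto
  then show "p \<in> ideal_a" by (simp add: sum_singles)
qed

text \<open>The coordinates of a residue class in the basis of \<open>R\<close> formed by the
  monomials outside the ideal. They make computations in \<open>R\<close> combinatorial.\<close>

lift_definition std_coeff :: "'k::field quot_ring \<Rightarrow> var monomial \<Rightarrow> 'k" is
  "\<lambda>p u. if in_a u then 0 else Poly_Mapping.lookup p u"
proof
  fix p p' :: "(var, 'k) mpoly" and u
  assume "ideal_rel p p'"
  then have "in_a u \<or> Poly_Mapping.lookup (p - p') u = 0"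
    by (auto simp: ideal_rel_def ideal_a_iff in_keys_iff)
  then show "(if in_a u then 0 else Poly_Mapping.lookup p u) = (if in_a u then 0 else Poly_Mapping.lookup p' u)"
    by (auto simp: lookup_minus)
qed

lemma std_coeff_quot_map: "std_coeff (quot_map p) u = (if in_a u then 0 else Poly_Mapping.lookup p u)"
  unfolding quot_map_def by (simp add: std_coeff.abs_eq)

lemma quot_map_surj: "\<exists>p. r = quot_map p"
  unfolding quot_map_def by (metis Quotient_abs_rep[OF Quotient_quot_ring])

lemma quot_map_eq_iff: "quot_map p = quot_map p' \<longleftrightarrow> p - p' \<in> ideal_a"
  unfolding quot_map_def by (simp add: quot_ring.abs_eq_iff ideal_rel_def)

lemma quot_map_zero [simp]: "quot_map 0 = 0"
  by (simp add: quot_map_def zero_quot_ring_def)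

lemma quot_map_one [simp]: "quot_map 1 = 1"
  by (simp add: quot_map_def one_quot_ring_def)

lemma quot_map_add: "quot_map (p + p') = quot_map p + quot_map p'"
  by (simp add: quot_map_def plus_quot_ring.abs_eq)

lemma quot_map_mult: "quot_map (p * p') = quot_map p * quot_map p'"
  by (simp add: quot_map_def times_quot_ring.abs_eq)

lemma quot_map_eq_0_iff: "quot_map p = 0 \<longleftrightarrow> p \<in> ideal_a"
  using quot_map_eq_iff[of p 0] by simp

lemma std_coeff_in_a [simp]: "in_a u \<Longrightarrow> std_coeff r u = 0"
  by transfer simp

lemma std_coeff_zero [simp]: "std_coeff 0 u = 0"
  by transfer simp

lemma std_coeff_add: "std_coeff (r + s) u = std_coeff r u + std_coeff s u"
  by transfer (simp add: lookup_add)

lemma std_coeff_uminus: "std_coeff (- r) u = - std_coeff r u"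
  by transfer simp

lemma std_coeff_minus: "std_coeff (r - s) u = std_coeff r u - std_coeff s u"
  by transfer (simp add: lookup_minus)

lemma std_coeff_sum: "std_coeff (\<Sum>a\<in>A. f a) u = (\<Sum>a\<in>A. std_coeff (f a) u)"
  by (induction A rule: infinite_finite_induct) (simp_all add: std_coeff_add)

lemma std_coeff_sign: "std_coeff ((-1) ^ n * r) u = (-1) ^ n * std_coeff r u"
  by (cases "even n") (simp_all add: std_coeff_uminus)

lemma std_coeff_eqI: "(\<And>u. std_coeff r u = std_coeff s u) \<Longrightarrow> r = s"
proof transfer
  fix r s :: "(var, 'a) mpoly"
  assume *: "\<And>u. (if in_a u then 0 else Poly_Mapping.lookup r u) = (if in_a u then 0 else Poly_Mapping.lookup s u)"
  have "in_a u" if "u \<in> Poly_Mapping.keys (r - s)" for u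
    using that *[of u] by (cases "in_a u") (auto simp: in_keys_iff lookup_minus)
  then show "ideal_rel r s" by (simp add: ideal_rel_def ideal_a_iff)
qed

lemma finite_std_coeff: "finite {u. std_coeff r u \<noteq> 0}"
proof -
  obtain p where "r = quot_map p" using quot_map_surj by blast
  then have "{u. std_coeff r u \<noteq> 0} \<subseteq> Poly_Mapping.keys p"
    by (auto simp: std_coeff_quot_map in_keys_iff)
  then show ?thesis by (rule finite_subset) simp
qed

lemma lookup_mult_single:
  fixes p :: "('v, 'k::comm_ring_1) mpoly"
  shows "Poly_Mapping.lookup (Poly_Mapping.single t c * p) u =
    (if mono_dvd t u then c * Poly_Mapping.lookup p (u - t) else 0)"
proof (induction p rule: poly_mapping_linear_induct)
  case (single v b)
  have "t + v = u \<longleftrightarrow> mono_dvd t u \<and> v = u - t"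
  proof
    assume "t + v = u"
    then show "mono_dvd t u \<and> v = u - t" by (auto simp: mono_dvd_def lookup_add)
  next
    assume "mono_dvd t u \<and> v = u - t"
    then show "t + v = u" by (metis mono_dvd_imp_add add.commute)
  qed
  then show ?case by (simp add: mult_single lookup_single when_def)
next
  case (add u w)
  then show ?case by (simp add: distrib_left lookup_add)
qed

abbreviation xq :: "var \<Rightarrow> 'k::field quot_ring" where
  "xq i \<equiv> quot_map (var_poly i)"

abbreviation cq :: "'k \<Rightarrow> 'k::field quot_ring" where
  "cq c \<equiv> quot_map (const_poly c)"

lemma mono_dvd_ev: "mono_dvd (ev i) u \<longleftrightarrow> ex u i \<noteq> 0"
  by (auto simp: mono_dvd_def ex_single)

lemma std_coeff_mult_single:
  assumes "r = quot_map p"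
  shows "std_coeff (quot_map (Poly_Mapping.single t c) * r) u =
    (if in_a u \<or> \<not> mono_dvd t u then 0 else c * std_coeff r (u - t))"
proof -
  have "in_a u" if "in_a (u - t)" "mono_dvd t u"
    using that in_a_add[of "u - t" t] by (metis mono_dvd_imp_add)
  then show ?thesis
    by (auto simp: assms quot_map_mult[symmetric] std_coeff_quot_map lookup_mult_single)
qed

lemma std_coeff_xq:
  "std_coeff (xq i * r) u = (if in_a u \<or> ex u i = 0 then 0 else std_coeff r (u - ev i))"
proof -
  obtain p where "r = quot_map p" using quot_map_surj by blast
  from std_coeff_mult_single[OF this, of "ev i" 1 u] show ?thesis by (simp add: mono_dvd_ev)
qed

lemma std_coeff_cq: "std_coeff (cq c * r) u = c * std_coeff r u"
proof -
  obtain p where "r = quot_map p" using quot_map_surj by blast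
  from std_coeff_mult_single[OF this, of 0 c u] show ?thesis by (simp add: mono_dvd_def)
qed

text \<open>Representatives may also contain monomials of the ideal, but these only produce
  monomials of the ideal, so the standard monomials decide.\<close>

lemma std_coeff_mult_eq_0:
  assumes "\<And>u v. std_coeff r u \<noteq> 0 \<Longrightarrow> std_coeff s v \<noteq> 0 \<Longrightarrow> in_a (u + v)"
  shows "r * s = 0"
proof -
  obtain p where p: "r = quot_map p" using quot_map_surj by blast
  obtain p' where p': "s = quot_map p'" using quot_map_surj by blast
  have "in_a w" if w: "w \<in> Poly_Mapping.keys (p * p')" for w
  proof -
    obtain u v where uv: "w = u + v" "u \<in> Poly_Mapping.keys p" "v \<in> Poly_Mapping.keys p'"
      using subsetD[OF keys_mult w] by auto
    show ?thesis
    proof (cases "in_a u \<or> in_a v")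
      case True
      then show ?thesis using in_a_add[of u v] in_a_add[of v u] uv(1) by (auto simp: add.commute)
    next
      case False
      then show ?thesis using assms[of u v] uv by (auto simp: p p' std_coeff_quot_map in_keys_iff)
    qed
  qed
  then have "p * p' \<in> ideal_a" by (simp add: ideal_a_iff)
  then show ?thesis by (simp add: p p' quot_map_mult[symmetric] quot_map_eq_0_iff)
qed

section \<open>Elimination of variables in the Koszul complex\<close>

type_synonym 'k kos = "var set \<Rightarrow>\<^sub>0 'k quot_ring"

abbreviation dK :: "'k::field kos \<Rightarrow> 'k kos" where
  "dK \<equiv> kdiff xq"

section \<open>Coefficients with respect to the cells\<close>

definition coef :: "'k::field kos \<Rightarrow> var set \<Rightarrow> var monomial \<Rightarrow> 'k" where
  "coef z I u = std_coeff (Poly_Mapping.lookup z I) u"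

definition kos_of :: "(var set \<Rightarrow> var monomial \<Rightarrow> 'k::field) \<Rightarrow> 'k kos" where
  "kos_of \<phi> = Abs_poly_mapping (\<lambda>I. quot_map (Abs_poly_mapping (\<phi> I)))"

definition supported :: "(var set \<Rightarrow> var monomial \<Rightarrow> bool) \<Rightarrow> 'k::field kos \<Rightarrow> bool" where
  "supported P z \<longleftrightarrow> (\<forall>I u. coef z I u \<noteq> 0 \<longrightarrow> P I u)"

lemma coef_zero [simp]: "coef 0 I u = 0"
  by (simp add: coef_def)

lemma coef_in_a [simp]: "in_a u \<Longrightarrow> coef z I u = 0"
  by (simp add: coef_def)

lemma coef_add: "coef (z + w) I u = coef z I u + coef w I u"
  by (simp add: coef_def lookup_add std_coeff_add)

lemma coef_diff: "coef (z - w) I u = coef z I u - coef w I u"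
  by (simp add: coef_def lookup_minus std_coeff_minus)

lemma coef_uminus: "coef (- w) I u = - coef w I u"
  by (simp add: coef_def std_coeff_uminus)

lemma coef_sum: "coef (\<Sum>a\<in>A. f a) I u = (\<Sum>a\<in>A. coef (f a) I u)"
  by (simp add: coef_def lookup_sum std_coeff_sum)

lemma coef_cq: "coef (smul (cq c) z) I u = c * coef z I u"
  by (simp add: coef_def std_coeff_cq)

lemma coef_eqI: "(\<And>I u. coef z I u = coef w I u) \<Longrightarrow> z = w"
  by (intro poly_mapping_eqI std_coeff_eqI) (simp add: coef_def)

lemma finite_coef: "finite {u. coef z I u \<noteq> 0}"
  by (simp add: coef_def finite_std_coeff)

lemma coef_kos_of:
  assumes "\<And>I. finite {u. \<phi> I u \<noteq> 0}" and "\<And>I u. in_a u \<Longrightarrow> \<phi> I u = 0"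
  shows "coef (kos_of \<phi>) I u = \<phi> I u"
  using assms by (simp add: coef_def kos_of_def std_coeff_quot_map)

lemma kdeg_iff_coef: "z \<in> kdeg n \<longleftrightarrow> (\<forall>I u. coef z I u \<noteq> 0 \<longrightarrow> card I = n)"
proof -
  have "r = 0 \<longleftrightarrow> (\<forall>u. std_coeff r u = 0)" for r :: "'a quot_ring"
    using std_coeff_eqI[of r 0] by auto
  then show ?thesis by (auto simp: kdeg_def free_mod_iff coef_def)
qed

lemma coef_dK: "coef (dK z) I u = (if in_a u then 0 else
    \<Sum>i\<in>- I. if ex u i = 0 then 0 else pos_sign i I * coef z (insert i I) (u - ev i))"
  by (auto simp: coef_def lookup_kdiff std_coeff_sum pos_sign_def std_coeff_sign std_coeff_xq
      mult.assoc intro!: sum.cong)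

lemma supportedD: "supported P z \<Longrightarrow> coef z I u \<noteq> 0 \<Longrightarrow> P I u"
  by (simp add: supported_def)

lemma supported_add:
  assumes "supported P z" "supported P w"
  shows "supported P (z + w)"
  unfolding supported_def
proof (intro allI impI)
  fix I u assume "coef (z + w) I u \<noteq> 0"
  then have "coef z I u \<noteq> 0 \<or> coef w I u \<noteq> 0" by (auto simp: coef_add)
  then show "P I u" using assms supportedD by blast
qed

lemma supported_mono:
  assumes "supported P z" and "\<And>I u. P I u \<Longrightarrow> \<not> in_a u \<Longrightarrow> Q I u"
  shows "supported Q z"
  unfolding supported_def
proof (intro allI impI)
  fix I u assume nz: "coef z I u \<noteq> 0"
  then have "\<not> in_a u" by auto
  with nz show "Q I u" using assms supportedD by blast
qed

section \<open>Splitting a cycle along its support\<close>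

definition part :: "(var set \<Rightarrow> var monomial \<Rightarrow> bool) \<Rightarrow> 'k::field kos \<Rightarrow> 'k kos" where
  "part Q z = kos_of (\<lambda>I u. if Q I u then coef z I u else 0)"

lemma coef_part: "coef (part Q z) I u = (if Q I u then coef z I u else 0)"
  unfolding part_def
proof (rule coef_kos_of)
  show "finite {u. (if Q I u then coef z I u else 0) \<noteq> 0}" for I
    by (rule finite_subset[OF _ finite_coef[of z I]]) auto
qed auto

lemma part_add_part: "part Q z + part (\<lambda>I u. \<not> Q I u) z = z"
  by (rule coef_eqI) (simp add: coef_add coef_part)

lemma part_kdeg:
  assumes "z \<in> kdeg n"
  shows "part Q z \<in> kdeg n"
  unfolding kdeg_iff_coef
proof (intro allI impI)
  fix I u assume "coef (part Q z) I u \<noteq> 0"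
  then have "coef z I u \<noteq> 0" by (simp add: coef_part split: if_splits)
  then show "card I = n" using assms kdeg_iff_coef by blast
qed

lemma supported_part: "supported P z \<Longrightarrow> supported (\<lambda>I u. P I u \<and> Q I u) (part Q z)"
  by (simp add: supported_def coef_part)

lemma ev_add_diff: "ex u j \<noteq> 0 \<Longrightarrow> u - ev j + ev j = u"
  by (rule poly_mapping_eqI) (auto simp: ex_single lookup_add minus_poly_mapping.rep_eq)

text \<open>The differential follows arrows from \<open>x^u e_I\<close> to
  \<open>x_j x^u e_(I - {j})\<close>. The hypothesis makes \<open>Q\<close> constant along every
  arrow that starts in \<open>P\<close> and is nonzero in \<open>R\<close>, so the cells with
  \<open>Q\<close> split off as a summand.\<close>

lemma dK_part:
  assumes z: "supported P z"
    and Q: "\<And>I u j. P I u \<Longrightarrow> j \<in> I \<Longrightarrow> \<not> in_a (u + ev j) \<Longrightarrow> Q (I - {j}) (u + ev j) \<longleftrightarrow> Q I u"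
  shows "dK (part Q z) = part Q (dK z)"
proof (rule coef_eqI)
  fix I u
  show "coef (dK (part Q z)) I u = coef (part Q (dK z)) I u"
  proof (cases "in_a u")
    case False
    have "(if ex u j = 0 then 0 else pos_sign j I * coef (part Q z) (insert j I) (u - ev j)) =
        (if Q I u then if ex u j = 0 then 0 else pos_sign j I * coef z (insert j I) (u - ev j) else 0)"
      if "j \<in> - I" for j
    proof (cases "ex u j = 0 \<or> coef z (insert j I) (u - ev j) = 0")
      case nz: False
      then have "P (insert j I) (u - ev j)" using z by (auto simp: supported_def)
      from Q[OF this, of j] nz that False have "Q I u \<longleftrightarrow> Q (insert j I) (u - ev j)"
        by (simp add: ev_add_diff)
      then show ?thesis by (simp add: coef_part)
    qed (auto simp: coef_part)
    then have "(\<Sum>j\<in>- I. if ex u j = 0 then 0 else pos_sign j I * coef (part Q z) (insert j I) (u - ev j)) =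
        (\<Sum>j\<in>- I. if Q I u then if ex u j = 0 then 0 else pos_sign j I * coef z (insert j I) (u - ev j) else 0)"
      by (intro sum.cong refl)
    then show ?thesis
      by (cases "Q I u") (simp_all add: coef_dK coef_part False)
  qed simp
qed

lemma cycle_split:
  assumes z: "supported P z" "dK z = 0" "z \<in> kdeg n"
    and Q: "\<And>I u j. P I u \<Longrightarrow> j \<in> I \<Longrightarrow> \<not> in_a (u + ev j) \<Longrightarrow> Q (I - {j}) (u + ev j) \<longleftrightarrow> Q I u"
  obtains z1 z2 where "z = z1 + z2" "dK z1 = 0" "dK z2 = 0" "z1 \<in> kdeg n" "z2 \<in> kdeg n"
    "supported (\<lambda>I u. P I u \<and> Q I u) z1" "supported (\<lambda>I u. P I u \<and> \<not> Q I u) z2"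
proof
  show "z = part Q z + part (\<lambda>I u. \<not> Q I u) z" by (simp add: part_add_part)
  have "part Q 0 = 0" for Q by (rule coef_eqI) (simp add: coef_part)
  then show "dK (part Q z) = 0" "dK (part (\<lambda>I u. \<not> Q I u) z) = 0"
    using dK_part[OF z(1), of Q] dK_part[OF z(1), of "\<lambda>I u. \<not> Q I u"] Q z(2) by auto
qed (use z in \<open>auto intro: part_kdeg supported_part\<close>)

text \<open>The operator \<open>x\<^sup>u e_I \<mapsto> \<plusminus> x\<^sup>u / x_i \<cdot> e_i e_I\<close>, which contracts the Koszul complex of the
  variable \<open>i\<close> wherever multiplication by \<open>x_i\<close> is bijective.\<close>

definition contract :: "var \<Rightarrow> 'k::field kos \<Rightarrow> 'k kos" where
  "contract i z = kos_of (\<lambda>I u. if i \<in> I \<and> \<not> in_a u then pos_sign i I * coef z (I - {i}) (u + ev i) else 0)"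

lemma coef_contract:
  "coef (contract i z) I u = (if i \<in> I \<and> \<not> in_a u then pos_sign i I * coef z (I - {i}) (u + ev i) else 0)"
  unfolding contract_def
proof (rule coef_kos_of)
  fix I
  have "inj (\<lambda>u. u + ev i)" by (simp add: inj_on_def)
  then have "finite ((\<lambda>u. u + ev i) -` {u. coef z (I - {i}) u \<noteq> 0})"
    by (intro finite_vimageI finite_coef)
  then show "finite {u. (if i \<in> I \<and> \<not> in_a u then pos_sign i I * coef z (I - {i}) (u + ev i) else 0) \<noteq> 0}"
    by (rule rev_finite_subset) auto
qed auto

lemma contract_kdeg:
  assumes "z \<in> kdeg n"
  shows "contract i z \<in> kdeg (Suc n)"
  unfolding kdeg_iff_coef
proof (intro allI impI)
  fix I u assume "coef (contract i z) I u \<noteq> 0"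
  then have i: "i \<in> I" "coef z (I - {i}) (u + ev i) \<noteq> 0" by (simp_all add: coef_contract split: if_splits)
  then have "card (I - {i}) = n" using assms kdeg_iff_coef by blast
  then show "card I = Suc n" using card.remove[OF finite i(1)] by simp
qed

text \<open>A homotopy argument with \<open>contract i\<close> as homotopy: a cell without
  \<open>e_i\<close> whose monomial contains \<open>x_i\<close> is cancelled against the cell in
  which one factor \<open>x_i\<close> is replaced by \<open>e_i\<close>. What survives are cells
  free of both \<open>x_i\<close> and \<open>e_i\<close>, and cells with \<open>e_i\<close> whose
  monomial is killed by \<open>x_i\<close>. The conditions \<open>up\<close> and \<open>down\<close>
  say that \<open>P\<close> is preserved by the contraction and by the differential.\<close>

lemma eliminate:
  assumes z: "dK z = 0" "z \<in> kdeg n" "supported P z"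
    and up: "\<And>I u. P I u \<Longrightarrow> \<not> in_a u \<Longrightarrow> i \<notin> I \<Longrightarrow> ex u i \<noteq> 0 \<Longrightarrow> P (insert i I) (u - ev i)"
    and down: "\<And>I u j. P I u \<Longrightarrow> j \<in> I \<Longrightarrow> \<not> in_a (u + ev j) \<Longrightarrow> P (I - {j}) (u + ev j)"
  obtains b w0 w1 where "z = dK b + w0 + w1" "b \<in> kdeg (Suc n)" "w0 \<in> kdeg n" "w1 \<in> kdeg n"
    "dK w0 = 0" "dK w1 = 0"
    "supported (\<lambda>I u. P I u \<and> \<not> in_a u \<and> i \<notin> I \<and> ex u i = 0) w0"
    "supported (\<lambda>I u. P I u \<and> \<not> in_a u \<and> i \<in> I \<and> in_a (u + ev i)) w1"
proof -
  let ?b = "contract i z"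
  define w where "w = z - dK ?b"
  have b: "supported P ?b"
    unfolding supported_def
  proof (intro allI impI)
    fix I u assume nz: "coef ?b I u \<noteq> 0"
    then have "i \<in> I" "coef z (I - {i}) (u + ev i) \<noteq> 0" by (auto simp: coef_contract split: if_splits)
    then have "P (I - {i}) (u + ev i)" "\<not> in_a (u + ev i)"
      using z(3) by (auto simp: supported_def)
    from up[OF this] show "P I u" using \<open>i \<in> I\<close> by (simp add: insert_absorb ex_single)
  qed
  have "supported P (dK ?b)"
    unfolding supported_def
  proof (intro allI impI)
    fix I u assume nz: "coef (dK ?b) I u \<noteq> 0"
    then have u: "\<not> in_a u" by auto
    with nz have "(\<Sum>j\<in>- I. if ex u j = 0 then 0 else pos_sign j I * coef ?b (insert j I) (u - ev j)) \<noteq> 0"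
      by (simp add: coef_dK)
    then obtain j where j: "j \<in> - I" "(if ex u j = 0 then 0 else pos_sign j I * coef ?b (insert j I) (u - ev j)) \<noteq> 0"
      by (rule sum.not_neutral_contains_not_neutral)
    then have "ex u j \<noteq> 0" "P (insert j I) (u - ev j)" using b by (auto simp: supported_def split: if_splits)
    from down[OF this(2), of j] this(1) u j(1) show "P I u" by (simp add: ev_add_diff)
  qed
  then have wP: "supported P w" using z(3) supported_add[of P z "- dK ?b"]
    by (simp add: w_def supported_def coef_uminus)
  have wdeg: "w \<in> kdeg n"
    unfolding w_def by (intro kdeg_diff z(2) kdiff_mem_kdeg contract_kdeg)
  have dw: "dK w = 0" by (simp add: w_def kdiff_diff z(1))
  \<comment> \<open>All cells of \<open>contract i z\<close> contain \<open>i\<close>, so at an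
    index set without \<open>i\<close> only the summand for \<open>i\<close> contributes to the
    differential, and it returns the coefficient of \<open>z\<close>.\<close>
  have w0: "ex u i = 0" if "i \<notin> I" "coef w I u \<noteq> 0" for I u
  proof (rule ccontr)
    assume ui: "ex u i \<noteq> 0"
    have u: "\<not> in_a u" using that(2) by auto
    have ui': "\<not> in_a (u - ev i)" using u in_a_add[of "u - ev i" "ev i"] ui by (auto simp: ev_add_diff)
    have "coef (dK ?b) I u = (\<Sum>j\<in>- I. if j = i then pos_sign i I * coef ?b (insert i I) (u - ev i) else 0)"
      unfolding coef_dK if_not_P[OF u]
      by (intro sum.cong refl) (use that(1) ui in \<open>auto simp: coef_contract\<close>)
    also have "\<dots> = pos_sign i I * coef ?b (insert i I) (u - ev i)" using that(1) by simp
    also have "\<dots> = coef z I u"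
      using that(1) ui ui' by (simp add: coef_contract ev_add_diff mult.assoc[symmetric])
    finally show False using that(2) by (simp add: w_def coef_diff)
  qed
  \<comment> \<open>Evaluates \<open>dK w = 0\<close> at \<open>I - {i}\<close> and
    \<open>u + ev i\<close>. The summands for other variables come from cells without
    \<open>i\<close> but with a factor \<open>x_i\<close>, which were just excluded, so the one
    remaining summand vanishes too.\<close>
  have w1: "in_a (u + ev i)" if "i \<in> I" "coef w I u \<noteq> 0" for I u
  proof (rule ccontr)
    assume ui: "\<not> in_a (u + ev i)"
    have e: "u + ev i - ev i = u" by simp
    have "coef w (insert j (I - {i})) (u + ev i - ev j) = 0" if "ex (u + ev i) j \<noteq> 0" "j \<noteq> i" for j
      using w0[of "insert j (I - {i})" "u + ev i - ev j"] that \<open>j \<noteq> i\<close> by (auto simp: ex_single)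
    then have "coef (dK w) (I - {i}) (u + ev i) =
        (\<Sum>j\<in>- (I - {i}). if j = i then pos_sign i I * coef w I u else 0)"
      unfolding coef_dK if_not_P[OF ui]
      by (intro sum.cong refl) (use that(1) in \<open>auto simp: e ex_single insert_absorb\<close>)
    also have "\<dots> = pos_sign i I * coef w I u" using that(1) by simp
    finally have "pos_sign i I * coef w I u = 0" by (simp add: dw)
    then have "pos_sign i I * (pos_sign i I * coef w I u) = 0" by simp
    then show False using that(2) by (simp add: mult.assoc[symmetric])
  qed
  have "P I u \<and> \<not> in_a u \<and> (if i \<in> I then in_a (u + ev i) else ex u i = 0)" if "coef w I u \<noteq> 0" for I u
    using w0[of I u] w1[of I u] wP that by (auto simp: supported_def)
  then have "supported (\<lambda>I u. P I u \<and> \<not> in_a u \<and> (if i \<in> I then in_a (u + ev i) else ex u i = 0)) w"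
    by (simp add: supported_def)
  \<comment> \<open>On this support, an arrow that removes \<open>i\<close> multiplies a monomial by
    \<open>x_i\<close> into the ideal. So containing \<open>i\<close> is constant along nonzero
    arrows, and both parts are cycles.\<close>
  then obtain y1 y2 where y: "w = y1 + y2" "dK y1 = 0" "dK y2 = 0" "y1 \<in> kdeg n" "y2 \<in> kdeg n"
    "supported (\<lambda>I u. (P I u \<and> \<not> in_a u \<and> (if i \<in> I then in_a (u + ev i) else ex u i = 0)) \<and> i \<in> I) y1"
    "supported (\<lambda>I u. (P I u \<and> \<not> in_a u \<and> (if i \<in> I then in_a (u + ev i) else ex u i = 0)) \<and> i \<notin> I) y2"
    by (rule cycle_split[where Q = "\<lambda>I u. i \<in> I", OF _ dw wdeg]) auto
  show thesis
  proof (rule that[of ?b y2 y1])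
    show "z = dK ?b + y2 + y1" using y(1) by (simp add: w_def algebra_simps)
    show "supported (\<lambda>I u. P I u \<and> \<not> in_a u \<and> i \<notin> I \<and> ex u i = 0) y2"
      using y(7) by (rule supported_mono) auto
    show "supported (\<lambda>I u. P I u \<and> \<not> in_a u \<and> i \<in> I \<and> in_a (u + ev i)) y1"
      using y(6) by (rule supported_mono) auto
  qed (use y contract_kdeg[OF z(2)] in auto)
qed

text \<open>No monomial without the variables of \<open>D\<close> lies in the ideal, so the cells
  avoiding \<open>D\<close> form the Koszul complex of a polynomial ring in the other variables. Its
  homology is the ground field in degree 0.\<close>

lemma reduce_without_generators:
  assumes "dK z = 0" "z \<in> kdeg n" "supported (\<lambda>I u. \<forall>i\<in>D. i \<notin> I \<and> ex u i = 0) z"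
    and "\<And>u. (\<And>i. i \<in> D \<Longrightarrow> ex u i = 0) \<Longrightarrow> \<not> in_a u"
  obtains b w where "z = dK b + w" "b \<in> kdeg (Suc n)" "w \<in> kdeg n" "dK w = 0"
    "supported (\<lambda>I u. I = {} \<and> u = 0) w"
proof -
  have "\<exists>b w. z = dK b + w \<and> b \<in> kdeg (Suc n) \<and> w \<in> kdeg n \<and> dK w = 0 \<and>
      supported (\<lambda>I u. I = {} \<and> u = 0) w"
    using assms
  proof (induction "card (- D)" arbitrary: z D)
    case 0
    then have "- D = {}" by simp
    then have "D = UNIV" by blast
    then have "supported (\<lambda>I u. I = {} \<and> u = 0) z"
      using "0.prems"(3) by (elim supported_mono) (auto simp: poly_mapping_eq_iff fun_eq_iff)
    then show ?case using "0.prems" by (intro exI[of _ 0] exI[of _ z]) simp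
  next
    case (Suc m)
    obtain i where i: "i \<notin> D" using Suc.hyps(2) by (metis Compl_UNIV_eq UNIV_eq_I card.empty nat.distinct(1))
    obtain b w0 w1 where e: "z = dK b + w0 + w1" "b \<in> kdeg (Suc n)" "w0 \<in> kdeg n" "dK w0 = 0"
      "supported (\<lambda>I u. (\<forall>i\<in>D. i \<notin> I \<and> ex u i = 0) \<and> \<not> in_a u \<and> i \<notin> I \<and> ex u i = 0) w0"
      "supported (\<lambda>I u. (\<forall>i\<in>D. i \<notin> I \<and> ex u i = 0) \<and> \<not> in_a u \<and> i \<in> I \<and> in_a (u + ev i)) w1"
      by (rule eliminate[OF Suc.prems(1-3), of i]) (use i in \<open>auto simp: ex_single\<close>)
    \<comment> \<open>Multiplication by \<open>x_i\<close> never leads into the ideal as long as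
      only variables outside \<open>D\<close> occur.\<close>
    have "w1 = 0"
    proof (rule coef_eqI, rule ccontr)
      fix I u assume "coef w1 I u \<noteq> coef 0 I u"
      then have u: "\<forall>i\<in>D. ex u i = 0" "in_a (u + ev i)" using supportedD[OF e(6), of I u] by auto
      have "\<not> in_a (u + ev i)" using u(1) i by (intro Suc.prems(4)) (auto simp: ex_single)
      with u(2) show False by simp
    qed
    have "- D = insert i (- insert i D)" using i by auto
    then have "m = card (- insert i D)" using Suc.hyps(2) by (metis Compl_iff card_insert_disjoint finite insertI1 nat.inject)
    moreover have "supported (\<lambda>I u. \<forall>i\<in>insert i D. i \<notin> I \<and> ex u i = 0) w0"
      using e(5) by (rule supported_mono) auto
    ultimately obtain b' w where "w0 = dK b' + w" "b' \<in> kdeg (Suc n)" "w \<in> kdeg n" "dK w = 0"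
      "supported (\<lambda>I u. I = {} \<and> u = 0) w"
      using Suc.hyps(1)[of "insert i D" w0] e(3,4) Suc.prems(4) by auto
    then show ?case
      using e(1,2) \<open>w1 = 0\<close> by (intro exI[of _ "b + b'"] exI[of _ w]) (simp add: kdiff_add kdeg_add)
  qed
  then show thesis using that by blast
qed

lemma boundary_without_generators:
  assumes z: "dK z = 0" "z \<in> kdeg n" "0 < n" "supported (\<lambda>I u. \<forall>i\<in>D. i \<notin> I \<and> ex u i = 0) z"
    and D: "\<And>u. (\<And>i. i \<in> D \<Longrightarrow> ex u i = 0) \<Longrightarrow> \<not> in_a u"
  obtains b where "z = dK b" "b \<in> kdeg (Suc n)"
proof -
  obtain b w where w: "z = dK b + w" "b \<in> kdeg (Suc n)" "w \<in> kdeg n" "supported (\<lambda>I u. I = {} \<and> u = 0) w"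
    using reduce_without_generators[OF z(1,2,4) D] by metis
  have "w = 0"
  proof (rule coef_eqI, rule ccontr)
    fix I u assume "coef w I u \<noteq> coef 0 I u"
    then have "coef w I u \<noteq> 0" by simp
    then have "card I = n" "I = {}" using w(3) kdeg_iff_coef supportedD[OF w(4)] by blast+
    then show False using z(3) by simp
  qed
  then show thesis using that w by simp
qed

text \<open>Hence the homology is finite-dimensional.\<close>

lemma bounded_representative:
  assumes "dK z = 0" "z \<in> kdeg n"
  obtains b w where "z = dK b + w" "b \<in> kdeg (Suc n)" "w \<in> kdeg n" "dK w = 0"
    "supported (\<lambda>I u. \<forall>i. ex u i \<le> 3) w"
proof -
  \<comment> \<open>The bound is on the multidegree of \<open>x^u e_I\<close>, in which
    \<open>e_i\<close> counts like \<open>x_i\<close>. Differential and contraction preserve it, so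
    bounds already reached survive the elimination of further variables.\<close>
  have "\<exists>b w. z = dK b + w \<and> b \<in> kdeg (Suc n) \<and> w \<in> kdeg n \<and> dK w = 0 \<and>
      supported (\<lambda>I u. \<forall>i\<in>D. ex u i + (if i \<in> I then 1 else 0) \<le> 3) w" if "finite D" for D
    using that
  proof (induction D)
    case empty
    show ?case using assms by (intro exI[of _ 0] exI[of _ z]) (simp add: supported_def)
  next
    case (insert i D)
    then obtain b w where w: "z = dK b + w" "b \<in> kdeg (Suc n)" "w \<in> kdeg n" "dK w = 0"
      "supported (\<lambda>I u. \<forall>i\<in>D. ex u i + (if i \<in> I then 1 else 0) \<le> 3) w" by blast
    obtain b' w0 w1 where e: "w = dK b' + w0 + w1" "b' \<in> kdeg (Suc n)" "w0 \<in> kdeg n" "w1 \<in> kdeg n"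
      "dK w0 = 0" "dK w1 = 0"
      "supported (\<lambda>I u. (\<forall>i\<in>D. ex u i + (if i \<in> I then 1 else 0) \<le> 3) \<and> \<not> in_a u \<and> i \<notin> I \<and> ex u i = 0) w0"
      "supported (\<lambda>I u. (\<forall>i\<in>D. ex u i + (if i \<in> I then 1 else 0) \<le> 3) \<and> \<not> in_a u \<and> i \<in> I \<and> in_a (u + ev i)) w1"
      by (rule eliminate[OF w(4,3,5), of i]) (auto simp: ex_single split: if_splits)
    \<comment> \<open>Generators have exponents at most 3, so beyond exponent 2 one further factor
      after that 3rd one cannot be what leads into the ideal.\<close>
    have bound: "ex u i \<le> 2" if in1: "in_a (u + ev i)" and in2: "\<not> in_a u" for u
    proof (rule ccontr)
      assume "\<not> ex u i \<le> 2"
      obtain g where g: "g \<in> gens" "mono_dvd g (u + ev i)" using in1 in_a_iff by blast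
      have "ex g i \<le> 3" using g(1) by (auto simp: gens_def gen_defs ex_single)
      have "mono_dvd g u"
        unfolding mono_dvd_def
      proof
        fix j
        have "ex g j \<le> ex u j + (if i = j then 1 else 0)"
          using g(2) by (simp add: mono_dvd_def ex_single)
        then show "ex g j \<le> ex u j" using \<open>ex g i \<le> 3\<close> \<open>\<not> ex u i \<le> 2\<close> by (cases "i = j") auto
      qed
      then show False using g(1) in2 in_a_iff by blast
    qed
    let ?P = "\<lambda>I u. \<forall>j\<in>insert i D. ex u j + (if j \<in> I then 1 else 0) \<le> 3"
    have "supported ?P w0" using e(7) by (rule supported_mono) auto
    moreover have "supported ?P w1" using e(8) by (rule supported_mono) (auto dest: bound)
    ultimately have "supported ?P (w0 + w1)" by (rule supported_add)
    then show ?case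
      using w(1,2) e by (intro exI[of _ "b + b'"] exI[of _ "w0 + w1"])
        (simp add: kdiff_add kdeg_add add.assoc)
  qed
  from this[OF finite, of UNIV] obtain b w where "z = dK b + w" "b \<in> kdeg (Suc n)" "w \<in> kdeg n" "dK w = 0"
    and w: "supported (\<lambda>I u. \<forall>i\<in>UNIV. ex u i + (if i \<in> I then 1 else 0) \<le> 3) w" by blast
  moreover have "supported (\<lambda>I u. \<forall>i. ex u i \<le> 3) w"
    using w by (rule supported_mono) (auto intro: add_leD1)
  ultimately show thesis using that by blast
qed

section \<open>Products of Koszul cycles\<close>

abbreviation z_free :: "var set \<Rightarrow> var monomial \<Rightarrow> bool" where
  "z_free I u \<equiv> Z \<notin> I \<and> ex u Z = 0"

text \<open>Without \<open>z\<close>, only the generators \<open>m_a\<close>, \<open>m_b\<close> and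
  \<open>m_ab\<close> are left, and each is divisible by \<open>x1 x2\<close> or by
  \<open>y1 y2\<close>. Removing one of the \<open>x\<close> and one of the \<open>y\<close>
  variables therefore leaves a polynomial ring, over which cycles of positive degree bound. The
  primed names fix the order of elimination.\<close>

lemma two_step:
  assumes z: "dK z = 0" "z \<in> kdeg n" "0 < n" "supported z_free z"
    and ij: "i \<in> {X1, X2}" "j \<in> {Y1, Y2}" "i' = i \<and> j' = j \<or> i' = j \<and> j' = i"
  obtains b w1 w2 where "z = dK b + w1 + w2" "b \<in> kdeg (Suc n)"
    "w1 \<in> kdeg n" "dK w1 = 0" "supported (\<lambda>I u. z_free I u \<and> \<not> in_a u \<and> i' \<in> I \<and> in_a (u + ev i')) w1"
    "w2 \<in> kdeg n" "dK w2 = 0" "supported (\<lambda>I u. z_free I u \<and> \<not> in_a u \<and> i' \<notin> I \<and> ex u i' = 0 \<and> j' \<in> I \<and> in_a (u + ev j')) w2"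
proof -
  have ij': "i' \<noteq> Z" "j' \<noteq> Z" "i' \<noteq> j'" using ij by auto
  obtain b w0 w1 where e: "z = dK b + w0 + w1" "b \<in> kdeg (Suc n)" "w0 \<in> kdeg n" "w1 \<in> kdeg n"
      "dK w0 = 0" "dK w1 = 0"
      "supported (\<lambda>I u. z_free I u \<and> \<not> in_a u \<and> i' \<notin> I \<and> ex u i' = 0) w0"
      "supported (\<lambda>I u. z_free I u \<and> \<not> in_a u \<and> i' \<in> I \<and> in_a (u + ev i')) w1"
    by (rule eliminate[OF z(1,2,4), of i']) (use ij' in \<open>auto simp: ex_single\<close>)
  have P: "supported (\<lambda>I u. z_free I u \<and> i' \<notin> I \<and> ex u i' = 0) w0"
    using e(7) by (rule supported_mono) auto
  obtain b' w0' w2 where e': "w0 = dK b' + w0' + w2" "b' \<in> kdeg (Suc n)" "w0' \<in> kdeg n" "w2 \<in> kdeg n"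
      "dK w0' = 0" "dK w2 = 0"
      "supported (\<lambda>I u. (z_free I u \<and> i' \<notin> I \<and> ex u i' = 0) \<and> \<not> in_a u \<and> j' \<notin> I \<and> ex u j' = 0) w0'"
      "supported (\<lambda>I u. (z_free I u \<and> i' \<notin> I \<and> ex u i' = 0) \<and> \<not> in_a u \<and> j' \<in> I \<and> in_a (u + ev j')) w2"
    by (rule eliminate[OF e(5,3) P, of j']) (use ij' in \<open>auto simp: ex_single\<close>)
  have no_gens: "\<not> in_a u" if u: "\<And>k. k \<in> {Z, i', j'} \<Longrightarrow> ex u k = 0" for u
  proof -
    have "ex u Z = 0" "ex u i = 0" "ex u j = 0" using u ij(3) by auto
    then show ?thesis using ij(1,2) by (auto simp: in_a_def)
  qed
  have "supported (\<lambda>I u. \<forall>k\<in>{Z, i', j'}. k \<notin> I \<and> ex u k = 0) w0'"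
    using e'(7) by (rule supported_mono) auto
  then obtain b'' where b'': "w0' = dK b''" "b'' \<in> kdeg (Suc n)"
    by (rule boundary_without_generators[OF e'(5,3) z(3) _ no_gens])
  show thesis
  proof (rule that[of "b + b' + b''" w1 w2])
    show "z = dK (b + b' + b'') + w1 + w2" using e(1) e'(1) b''(1) by (simp add: kdiff_add)
    show "supported (\<lambda>I u. z_free I u \<and> \<not> in_a u \<and> i' \<notin> I \<and> ex u i' = 0 \<and> j' \<in> I \<and> in_a (u + ev j')) w2"
      using e'(8) by (rule supported_mono) auto
  qed (use e e' b'' in \<open>auto intro: kdeg_add\<close>)
qed

text \<open>The cells left by the elimination are moved into the ideal by \<open>x2\<close> or by
  \<open>y2\<close>, and the other factors of the responsible generator bound their coefficients.
  This lemma and the next four prepare coefficient ideals that annihilate the possible coefficients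
  of the cells with \<open>e_Z\<close>: here, \<open>(x1, y1)\<close> annihilates
  \<open>x2^2 y2^2\<close>.\<close>

lemma coeffs_in_X1_Y1:
  assumes z: "dK z = 0" "z \<in> kdeg n" "0 < n" "supported z_free z"
  obtains b w where "z = dK b + w" "b \<in> kdeg (Suc n)" "supported (\<lambda>I u. 1 \<le> ex u X1 \<or> 1 \<le> ex u Y1) w"
proof -
  obtain b w1 w2 where "z = dK b + w1 + w2" "b \<in> kdeg (Suc n)"
    and w1: "supported (\<lambda>I u. z_free I u \<and> \<not> in_a u \<and> X2 \<in> I \<and> in_a (u + ev X2)) w1"
    and w2: "supported (\<lambda>I u. z_free I u \<and> \<not> in_a u \<and> X2 \<notin> I \<and> ex u X2 = 0 \<and> Y2 \<in> I \<and> in_a (u + ev Y2)) w2"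
    by (rule two_step[OF z, of X2 Y2 X2 Y2]) auto
  moreover have "supported (\<lambda>I u. 1 \<le> ex u X1 \<or> 1 \<le> ex u Y1) w1"
    using w1 by (rule supported_mono) (auto simp: in_a_def ex_single)
  moreover have "supported (\<lambda>I u. 1 \<le> ex u X1 \<or> 1 \<le> ex u Y1) w2"
    using w2 by (rule supported_mono) (auto simp: in_a_def ex_single)
  ultimately show thesis using that[of b "w1 + w2"] by (simp add: supported_add add.assoc)
qed

text \<open>The ideal \<open>(x2^2, y1)\<close> annihilates \<open>y2^2 z\<close>, by
  \<open>m_bc_a\<close> and \<open>m_b\<close>.\<close>

lemma coeffs_in_X2X2_Y1:
  assumes z: "dK z = 0" "z \<in> kdeg n" "0 < n" "supported z_free z"
  obtains b w where "z = dK b + w" "b \<in> kdeg (Suc n)" "supported (\<lambda>I u. 2 \<le> ex u X2 \<or> 1 \<le> ex u Y1) w"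
proof -
  obtain b w1 w2 where "z = dK b + w1 + w2" "b \<in> kdeg (Suc n)"
    and w1: "supported (\<lambda>I u. z_free I u \<and> \<not> in_a u \<and> X1 \<in> I \<and> in_a (u + ev X1)) w1"
    and w2: "supported (\<lambda>I u. z_free I u \<and> \<not> in_a u \<and> X1 \<notin> I \<and> ex u X1 = 0 \<and> Y2 \<in> I \<and> in_a (u + ev Y2)) w2"
    by (rule two_step[OF z, of X1 Y2 X1 Y2]) auto
  moreover have "supported (\<lambda>I u. 2 \<le> ex u X2 \<or> 1 \<le> ex u Y1) w1"
    using w1 by (rule supported_mono) (auto simp: in_a_def ex_single)
  moreover have "supported (\<lambda>I u. 2 \<le> ex u X2 \<or> 1 \<le> ex u Y1) w2"
    using w2 by (rule supported_mono) (auto simp: in_a_def ex_single)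
  ultimately show thesis using that[of b "w1 + w2"] by (simp add: supported_add add.assoc)
qed

text \<open>The ideal \<open>(x1, y2^2)\<close> annihilates \<open>x2^2 z\<close>, by
  \<open>m_a\<close> and \<open>m_bc_a\<close>.\<close>

lemma coeffs_in_X1_Y2Y2:
  assumes z: "dK z = 0" "z \<in> kdeg n" "0 < n" "supported z_free z"
  obtains b w where "z = dK b + w" "b \<in> kdeg (Suc n)" "supported (\<lambda>I u. 1 \<le> ex u X1 \<or> 2 \<le> ex u Y2) w"
proof -
  obtain b w1 w2 where "z = dK b + w1 + w2" "b \<in> kdeg (Suc n)"
    and w1: "supported (\<lambda>I u. z_free I u \<and> \<not> in_a u \<and> Y1 \<in> I \<and> in_a (u + ev Y1)) w1"
    and w2: "supported (\<lambda>I u. z_free I u \<and> \<not> in_a u \<and> Y1 \<notin> I \<and> ex u Y1 = 0 \<and> X2 \<in> I \<and> in_a (u + ev X2)) w2"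
    by (rule two_step[OF z, of X2 Y1 Y1 X2]) auto
  moreover have "supported (\<lambda>I u. 1 \<le> ex u X1 \<or> 2 \<le> ex u Y2) w1"
    using w1 by (rule supported_mono) (auto simp: in_a_def ex_single)
  moreover have "supported (\<lambda>I u. 1 \<le> ex u X1 \<or> 2 \<le> ex u Y2) w2"
    using w2 by (rule supported_mono) (auto simp: in_a_def ex_single)
  ultimately show thesis using that[of b "w1 + w2"] by (simp add: supported_add add.assoc)
qed

text \<open>The ideal \<open>(x2^2, y2^2, x2 y2)\<close> annihilates \<open>x1 y1\<close>, by
  \<open>m_a\<close>, \<open>m_b\<close> and \<open>m_ab\<close>.\<close>

lemma coeffs_in_squares:
  assumes z: "dK z = 0" "z \<in> kdeg n" "0 < n" "supported z_free z"
  obtains b w where "z = dK b + w" "b \<in> kdeg (Suc n)"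
    "supported (\<lambda>I u. 2 \<le> ex u X2 \<or> 2 \<le> ex u Y2 \<or> 1 \<le> ex u X2 \<and> 1 \<le> ex u Y2) w"
proof -
  let ?J = "\<lambda>I::var set. \<lambda>u. 2 \<le> ex u X2 \<or> 2 \<le> ex u Y2 \<or> 1 \<le> ex u X2 \<and> 1 \<le> ex u Y2"
  obtain b w1 w2 where "z = dK b + w1 + w2" "b \<in> kdeg (Suc n)"
    and w1: "supported (\<lambda>I u. z_free I u \<and> \<not> in_a u \<and> X1 \<in> I \<and> in_a (u + ev X1)) w1"
    and w2: "supported (\<lambda>I u. z_free I u \<and> \<not> in_a u \<and> X1 \<notin> I \<and> ex u X1 = 0 \<and> Y1 \<in> I \<and> in_a (u + ev Y1)) w2"
    by (rule two_step[OF z, of X1 Y1 X1 Y1]) auto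
  moreover have "supported ?J w1"
    using w1 by (rule supported_mono) (auto simp: in_a_def ex_single)
  moreover have "supported ?J w2"
    using w2 by (rule supported_mono) (auto simp: in_a_def ex_single)
  ultimately show thesis using that[of b "w1 + w2"] by (simp add: supported_add add.assoc)
qed

text \<open>The ideal \<open>(x2^2, y2^2, x1 y1)\<close> annihilates \<open>z^2\<close>, by
  \<open>m_ca\<close>, \<open>m_bc\<close> and \<open>m_ab_c\<close>. Eliminating \<open>x2\<close>
  leaves cells whose coefficients are only known to contain \<open>x1 x2\<close>; these have to be
  reduced further, by way of \<open>y2\<close> and \<open>x1\<close>.\<close>

lemma coeffs_in_X1Y1_squares:
  assumes z: "dK z = 0" "z \<in> kdeg n" "0 < n" "supported z_free z"
  obtains b w where "z = dK b + w" "b \<in> kdeg (Suc n)"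
    "supported (\<lambda>I u. 2 \<le> ex u X2 \<or> 2 \<le> ex u Y2 \<or> 1 \<le> ex u X1 \<and> 1 \<le> ex u Y1) w"
proof -
  let ?J = "\<lambda>I::var set. \<lambda>u. 2 \<le> ex u X2 \<or> 2 \<le> ex u Y2 \<or> 1 \<le> ex u X1 \<and> 1 \<le> ex u Y1"
  obtain b w0 w1 where e: "z = dK b + w0 + w1" "b \<in> kdeg (Suc n)" "w0 \<in> kdeg n" "w1 \<in> kdeg n"
      "dK w0 = 0" "dK w1 = 0"
      "supported (\<lambda>I u. z_free I u \<and> \<not> in_a u \<and> X2 \<notin> I \<and> ex u X2 = 0) w0"
      "supported (\<lambda>I u. z_free I u \<and> \<not> in_a u \<and> X2 \<in> I \<and> in_a (u + ev X2)) w1"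
    by (rule eliminate[OF z(1,2,4), of X2]) (auto simp: ex_single)
  txt \<open>In \<open>X2\<close>-degree 0, only the generator \<open>m_b\<close> is relevant.\<close>
  have z0: "supported z_free w0" using e(7) by (rule supported_mono) auto
  have P: "supported (\<lambda>I u. z_free I u \<and> X2 \<notin> I \<and> ex u X2 = 0) w0"
    using e(7) by (rule supported_mono) auto
  obtain b1 v0 v1 where v: "w0 = dK b1 + v0 + v1" "b1 \<in> kdeg (Suc n)" "v0 \<in> kdeg n" "dK v0 = 0"
      "supported (\<lambda>I u. (z_free I u \<and> X2 \<notin> I \<and> ex u X2 = 0) \<and> \<not> in_a u \<and> Y1 \<notin> I \<and> ex u Y1 = 0) v0"
      "supported (\<lambda>I u. (z_free I u \<and> X2 \<notin> I \<and> ex u X2 = 0) \<and> \<not> in_a u \<and> Y1 \<in> I \<and> in_a (u + ev Y1)) v1"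
    by (rule eliminate[OF e(5,3) P, of Y1]) (auto simp: ex_single)
  have v1: "supported ?J v1"
    using v(6) by (rule supported_mono) (auto simp: in_a_def ex_single)
  have "supported (\<lambda>I u. \<forall>k\<in>{Z, X2, Y1}. k \<notin> I \<and> ex u k = 0) v0"
    using v(5) by (rule supported_mono) auto
  then obtain b2 where b2: "v0 = dK b2" "b2 \<in> kdeg (Suc n)"
    by (rule boundary_without_generators[OF v(4,3) z(3)]) (auto simp: in_a_def)
  txt \<open>The other part is split according to whether the degree in \<open>X2\<close> is 1 or 2.\<close>
  obtain y1 y2 where y: "w1 = y1 + y2" "dK y2 = 0" "y2 \<in> kdeg n"
    "supported (\<lambda>I u. (z_free I u \<and> \<not> in_a u \<and> X2 \<in> I \<and> in_a (u + ev X2)) \<and> ex u X2 = 0) y1"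
    "supported (\<lambda>I u. (z_free I u \<and> \<not> in_a u \<and> X2 \<in> I \<and> in_a (u + ev X2)) \<and> ex u X2 \<noteq> 0) y2"
    by (rule cycle_split[OF e(8,6,4), of "\<lambda>I u. ex u X2 = 0"]) (auto simp: ex_single)
  have y1: "supported ?J y1"
    using y(4) by (rule supported_mono) (auto simp: in_a_def ex_single)
  let ?A = "\<lambda>I u. z_free I u \<and> X2 \<in> I \<and> ex u X2 = 1 \<and> 1 \<le> ex u X1"
  \<comment> \<open>The only generator without \<open>z\<close> that asks for a second factor
    \<open>x2\<close> is \<open>m_a\<close>.\<close>
  have A: "ex u X2 = 1 \<and> 1 \<le> ex u X1"
    if "ex u Z = 0" "\<not> in_a u" "in_a (u + ev X2)" "ex u X2 \<noteq> 0" for u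
  proof -
    have "1 \<le> ex u X1" using that by (simp add: in_a_def ex_single) linarith
    moreover have "\<not> 2 \<le> ex u X2"
    proof
      assume "2 \<le> ex u X2"
      then have "in_a u" using \<open>1 \<le> ex u X1\<close> by (simp add: in_a_def)
      then show False using that(2) by simp
    qed
    ultimately show ?thesis using that(4) by linarith
  qed
  have A': "in_a (u + ev X2)" if "ex u X2 = 1" "1 \<le> ex u X1" for u
    using that by (simp add: in_a_def ex_single)
  have "supported ?A y2"
    using y(5) by (rule supported_mono) (use A in blast)
  then obtain b3 t0 t1 where t: "y2 = dK b3 + t0 + t1" "b3 \<in> kdeg (Suc n)" "t0 \<in> kdeg n" "dK t0 = 0"
      "supported (\<lambda>I u. ?A I u \<and> \<not> in_a u \<and> Y2 \<notin> I \<and> ex u Y2 = 0) t0"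
      "supported (\<lambda>I u. ?A I u \<and> \<not> in_a u \<and> Y2 \<in> I \<and> in_a (u + ev Y2)) t1"
    by (rule eliminate[OF y(2,3), of _ Y2]) (auto simp: ex_single A')
  have t1: "supported ?J t1"
    using t(6) by (rule supported_mono) (auto simp: in_a_def ex_single)
  \<comment> \<open>With \<open>y2\<close> and \<open>z\<close> gone, \<open>m_a\<close> is the only
    generator left, so eliminating \<open>x1\<close> yields coefficients in \<open>x2^2\<close>. The
    condition \<open>?A\<close> is given up because contraction at \<open>x1\<close> need not
    preserve it.\<close>
  have "supported (\<lambda>I u. z_free I u \<and> Y2 \<notin> I \<and> ex u Y2 = 0) t0"
    using t(5) by (rule supported_mono) auto
  then obtain b4 s0 s1 where s: "t0 = dK b4 + s0 + s1" "b4 \<in> kdeg (Suc n)" "s0 \<in> kdeg n" "dK s0 = 0"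
      "supported (\<lambda>I u. (z_free I u \<and> Y2 \<notin> I \<and> ex u Y2 = 0) \<and> \<not> in_a u \<and> X1 \<notin> I \<and> ex u X1 = 0) s0"
      "supported (\<lambda>I u. (z_free I u \<and> Y2 \<notin> I \<and> ex u Y2 = 0) \<and> \<not> in_a u \<and> X1 \<in> I \<and> in_a (u + ev X1)) s1"
    by (rule eliminate[OF t(4,3), of _ X1]) (auto simp: ex_single)
  have s1: "supported ?J s1"
    using s(6) by (rule supported_mono) (auto simp: in_a_def ex_single)
  have "supported (\<lambda>I u. \<forall>k\<in>{Z, Y2, X1}. k \<notin> I \<and> ex u k = 0) s0"
    using s(5) by (rule supported_mono) auto
  then obtain b5 where b5: "s0 = dK b5" "b5 \<in> kdeg (Suc n)"
    by (rule boundary_without_generators[OF s(4,3) z(3)]) (auto simp: in_a_def)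
  show thesis
  proof (rule that[of "b + b1 + b2 + b3 + b4 + b5" "v1 + y1 + t1 + s1"])
    show "z = dK (b + b1 + b2 + b3 + b4 + b5) + (v1 + y1 + t1 + s1)"
      by (simp add: kdiff_add e(1) v(1) b2(1) y(1) t(1) s(1) b5(1) add_ac)
    show "b + b1 + b2 + b3 + b4 + b5 \<in> kdeg (Suc n)"
      by (intro kdeg_add e v b2 t s b5)
    show "supported ?J (v1 + y1 + t1 + s1)"
      by (intro supported_add v1 y1 t1 s1)
  qed
qed

section \<open>Products of cycles modulo boundaries\<close>

definition is_boundary :: "'k::field kos \<Rightarrow> bool" where
  "is_boundary z \<longleftrightarrow> (\<exists>b. z = dK b)"

lemma is_boundary_dK: "is_boundary (dK b)"
  by (auto simp: is_boundary_def)

lemma is_boundary_add: "is_boundary z \<Longrightarrow> is_boundary w \<Longrightarrow> is_boundary (z + w)"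
  by (auto simp: is_boundary_def kdiff_add[symmetric])

lemma is_boundary_kmul_left:
  assumes "dK y = 0"
  shows "is_boundary (kmul (dK b) y)"
proof -
  have "kmul (dK b) y = dK (kmul b y)" by (simp add: kdiff_kmul assms)
  then show ?thesis by (simp add: is_boundary_dK)
qed

lemma is_boundary_kmul_right:
  assumes "dK y = 0"
  shows "is_boundary (kmul y (dK b))"
proof -
  have "kmul y (dK b) = dK (kmul (involute y) b)"
    by (simp add: kdiff_kmul kdiff_involute assms)
  then show ?thesis by (simp add: is_boundary_dK)
qed

text \<open>The differential is homogeneous, so only the component of a bounding chain in degree
  \<open>Suc n\<close> matters.\<close>

lemma boundary_in_degree:
  assumes "z \<in> kdeg n" "is_boundary z"
  obtains b where "b \<in> kdeg (Suc n)" "z = dK b"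
proof -
  obtain b where b: "z = dK b" using assms(2) by (auto simp: is_boundary_def)
  let ?b = "part (\<lambda>I u. card I = Suc n) b"
  have "?b \<in> kdeg (Suc n)" by (simp add: kdeg_iff_coef coef_part)
  moreover have "z = dK ?b"
  proof (rule coef_eqI)
    fix I u
    show "coef z I u = coef (dK ?b) I u"
    proof (cases "card I = n")
      case True
      have "coef ?b (insert i I) v = coef b (insert i I) v" if "i \<in> - I" for i v
        using that True by (simp add: coef_part)
      then have "(\<Sum>i\<in>- I. if ex u i = 0 then 0 else pos_sign i I * coef ?b (insert i I) (u - ev i)) =
          (\<Sum>i\<in>- I. if ex u i = 0 then 0 else pos_sign i I * coef b (insert i I) (u - ev i))"
        by (intro sum.cong refl) simp
      then show ?thesis by (simp only: b coef_dK)
    next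
      case False
      have "coef ?b (insert i I) v = 0" if "i \<in> - I" for i v
        using that False by (simp add: coef_part)
      then have "(\<Sum>i\<in>- I. if ex u i = 0 then 0 else pos_sign i I * coef ?b (insert i I) (u - ev i)) = 0"
        by (intro sum.neutral ballI) simp
      moreover have "coef z I u = 0" using assms(1) False kdeg_iff_coef by blast
      ultimately show ?thesis by (simp add: coef_dK)
    qed
  qed
  ultimately show thesis by (rule that)
qed

lemma kmul_eq_0_cells:
  assumes "supported P z" "supported Q w"
    and "\<And>I u J v. P I u \<Longrightarrow> Q J v \<Longrightarrow> I \<inter> J = {} \<Longrightarrow> in_a (u + v)"
  shows "kmul z w = 0"
proof (rule kmul_eq_0I)
  fix I J :: "var set" assume IJ: "I \<inter> J = {}"
  show "Poly_Mapping.lookup z I * Poly_Mapping.lookup w J = 0"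
  proof (rule std_coeff_mult_eq_0)
    fix u v
    assume "std_coeff (Poly_Mapping.lookup z I) u \<noteq> 0" "std_coeff (Poly_Mapping.lookup w J) v \<noteq> 0"
    then have "P I u" "Q J v" using supportedD[OF assms(1)] supportedD[OF assms(2)] by (simp_all add: coef_def)
    then show "in_a (u + v)" using IJ by (rule assms(3))
  qed
qed

text \<open>Changing \<open>z\<close> by a boundary changes both products by boundaries, and for the
  representative \<open>w\<close> they vanish cell by cell.\<close>

lemma is_boundary_kmul_annihilated:
  assumes y: "dK y = 0" "supported Q y"
    and z: "z = dK b + w" "supported (\<lambda>I. P) w"
    and ann: "\<And>u I v. P u \<Longrightarrow> Q I v \<Longrightarrow> in_a (u + v)"
  shows "is_boundary (kmul z y) \<and> is_boundary (kmul y z)"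
proof -
  have "kmul w y = 0" using z(2) y(2) by (rule kmul_eq_0_cells) (rule ann)
  moreover have "kmul y w = 0" using y(2) z(2)
  proof (rule kmul_eq_0_cells)
    fix I u J v assume "Q I u" "P v"
    then show "in_a (u + v)" using ann[of v I u] by (simp add: add.commute)
  qed
  ultimately show ?thesis
    using is_boundary_kmul_left[OF y(1), of b] is_boundary_kmul_right[OF y(1), of b]
    by (simp add: z(1) kmul_add_left kmul_add_right)
qed

abbreviation z_killed :: "var set \<Rightarrow> var monomial \<Rightarrow> bool" where
  "z_killed I u \<equiv> \<not> in_a u \<and> Z \<in> I \<and> in_a (u + ev Z)"

text \<open>In degree 1 in \<open>z\<close>, only \<open>m_bc\<close> and \<open>m_ca\<close> can be
  waiting for one more factor \<open>z\<close>.\<close>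

lemma z_killed_1: "\<not> in_a u \<Longrightarrow> in_a (u + ev Z) \<Longrightarrow> ex u Z = 1 \<Longrightarrow> 2 \<le> ex u X2 \<or> 2 \<le> ex u Y2"
  by (simp add: in_a_def ex_single) linarith

text \<open>The two alternatives are the cofactors of \<open>z\<close> in \<open>m_ab_c\<close> and
  \<open>m_bc_a\<close>, the generators of degree 1 in \<open>z\<close>.\<close>

lemma z_killed_0: "\<not> in_a u \<Longrightarrow> in_a (u + ev Z) \<Longrightarrow> ex u Z = 0 \<Longrightarrow>
    1 \<le> ex u X1 \<and> 1 \<le> ex u Y1 \<or> 2 \<le> ex u X2 \<and> 2 \<le> ex u Y2"
  by (simp add: in_a_def ex_single) linarith

text \<open>The classes involving \<open>Z\<close> are decomposed according to their degree in \<open>Z\<close>, so that each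
  part has coefficients in a cyclic module; for each of these, a positive degree class not involving
  \<open>Z\<close> has a representative with coefficients in the annihilator.\<close>

lemma is_boundary_z_free_times_z_killed:
  assumes z: "dK z = 0" "z \<in> kdeg n" "0 < n" "supported z_free z"
    and y: "dK y = 0" "y \<in> kdeg m" "supported z_killed y"
  shows "is_boundary (kmul z y) \<and> is_boundary (kmul y z)"
proof -
  have Zle: "ex u Z \<le> 2" if "\<not> in_a u" for u using that by (auto simp: in_a_def)
  obtain y2 y' where y': "y = y2 + y'" "dK y2 = 0" "dK y' = 0" "y' \<in> kdeg m"
    "supported (\<lambda>I u. z_killed I u \<and> ex u Z = 2) y2" "supported (\<lambda>I u. z_killed I u \<and> ex u Z \<noteq> 2) y'"
    by (rule cycle_split[OF y(3,1,2), of "\<lambda>I u. ex u Z = 2"]) (auto simp: ex_single)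
  obtain y1 y0 where y10: "y' = y1 + y0" "dK y1 = 0" "dK y0 = 0" "y1 \<in> kdeg m" "y0 \<in> kdeg m"
    "supported (\<lambda>I u. (z_killed I u \<and> ex u Z \<noteq> 2) \<and> ex u Z = 1) y1"
    "supported (\<lambda>I u. (z_killed I u \<and> ex u Z \<noteq> 2) \<and> ex u Z \<noteq> 1) y0"
    by (rule cycle_split[OF y'(6,3,4), of "\<lambda>I u. ex u Z = 1"]) (auto simp: ex_single)
  have P1: "supported (\<lambda>I u. z_killed I u \<and> ex u Z = 1) y1"
    using y10(6) by (rule supported_mono) auto
  have P0: "supported (\<lambda>I u. z_killed I u \<and> ex u Z = 0) y0"
    using y10(7) by (rule supported_mono) (use Zle in force)
  \<comment> \<open>Raising the exponent of \<open>x2\<close> from 1 to 2 can only happen where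
    \<open>y2^2 z\<close> is present, and then leads into the ideal by
    \<open>m_bc_a\<close>.\<close>
  have stable1: "2 \<le> ex (u + ev j) X2 \<longleftrightarrow> 2 \<le> ex u X2"
    if "z_killed I u \<and> ex u Z = 1" "\<not> in_a (u + ev j)" for I u j
  proof (rule ccontr)
    assume n: "\<not> ?thesis"
    then have j: "j = X2" by (auto simp: ex_single split: if_splits)
    have "2 \<le> ex u X2 \<or> 2 \<le> ex u Y2" using that(1) by (intro z_killed_1) auto
    moreover have "\<not> 2 \<le> ex u X2" "2 \<le> ex u X2 + 1" using n j by (auto simp: ex_single)
    ultimately have "2 \<le> ex u X2 + 1" "2 \<le> ex u Y2" "ex u Z = 1" using that(1) by auto
    then have "in_a (u + ev j)" by (simp add: in_a_def ex_single j)
    then show False using that(2) by simp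
  qed
  obtain y1a y1b where y1: "y1 = y1a + y1b" "dK y1a = 0" "dK y1b = 0"
    "supported (\<lambda>I u. (z_killed I u \<and> ex u Z = 1) \<and> 2 \<le> ex u X2) y1a"
    "supported (\<lambda>I u. (z_killed I u \<and> ex u Z = 1) \<and> \<not> 2 \<le> ex u X2) y1b"
    by (rule cycle_split[OF P1 y10(2,4), of "\<lambda>I u. 2 \<le> ex u X2"]) (erule (1) stable1, blast)
  \<comment> \<open>Where \<open>x1 y1\<close> is missing, \<open>x2^2 y2^2\<close> is present, so a
    further \<open>x1\<close> or \<open>y1\<close> leads into the ideal by \<open>m_a\<close> or
    \<open>m_b\<close>.\<close>
  have stable0: "(1 \<le> ex (u + ev j) X1 \<and> 1 \<le> ex (u + ev j) Y1) \<longleftrightarrow> (1 \<le> ex u X1 \<and> 1 \<le> ex u Y1)"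
    if "z_killed I u \<and> ex u Z = 0" "\<not> in_a (u + ev j)" for I u j
  proof (rule ccontr)
    assume n: "\<not> ?thesis"
    then have j: "j = X1 \<or> j = Y1" by (auto simp: ex_single split: if_splits)
    have n': "\<not> (1 \<le> ex u X1 \<and> 1 \<le> ex u Y1)" using n by auto
    have "1 \<le> ex u X1 \<and> 1 \<le> ex u Y1 \<or> 2 \<le> ex u X2 \<and> 2 \<le> ex u Y2"
      using that(1) by (intro z_killed_0) auto
    then have "in_a (u + ev j)" using n' j by (auto simp: in_a_def ex_single)
    then show False using that(2) by simp
  qed
  obtain y0a y0b where y0: "y0 = y0a + y0b" "dK y0a = 0" "dK y0b = 0"
    "supported (\<lambda>I u. (z_killed I u \<and> ex u Z = 0) \<and> (1 \<le> ex u X1 \<and> 1 \<le> ex u Y1)) y0a"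
    "supported (\<lambda>I u. (z_killed I u \<and> ex u Z = 0) \<and> \<not> (1 \<le> ex u X1 \<and> 1 \<le> ex u Y1)) y0b"
    by (rule cycle_split[OF P0 y10(3,5), of "\<lambda>I u. 1 \<le> ex u X1 \<and> 1 \<le> ex u Y1"]) (erule (1) stable0, blast)
  have K2: "is_boundary (kmul z y2) \<and> is_boundary (kmul y2 z)"
  proof -
    obtain b w where w: "z = dK b + w"
      "supported (\<lambda>I u. 2 \<le> ex u X2 \<or> 2 \<le> ex u Y2 \<or> 1 \<le> ex u X1 \<and> 1 \<le> ex u Y1) w"
      by (rule coeffs_in_X1Y1_squares[OF z])
    have Q: "supported (\<lambda>I u. ex u Z = 2) y2" using y'(5) by (rule supported_mono) blast
    show ?thesis
      by (rule is_boundary_kmul_annihilated[OF y'(2) Q w]) (auto simp: in_a_def)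
  qed
  have K1: "is_boundary (kmul z y1a) \<and> is_boundary (kmul y1a z)"
  proof -
    obtain b w where w: "z = dK b + w" "supported (\<lambda>I u. 1 \<le> ex u X1 \<or> 2 \<le> ex u Y2) w"
      by (rule coeffs_in_X1_Y2Y2[OF z])
    have Q: "supported (\<lambda>I u. ex u Z = 1 \<and> 2 \<le> ex u X2) y1a" using y1(4) by (rule supported_mono) auto
    show ?thesis
      by (rule is_boundary_kmul_annihilated[OF y1(2) Q w]) (auto simp: in_a_def)
  qed
  have K1': "is_boundary (kmul z y1b) \<and> is_boundary (kmul y1b z)"
  proof -
    obtain b w where w: "z = dK b + w" "supported (\<lambda>I u. 2 \<le> ex u X2 \<or> 1 \<le> ex u Y1) w"
      by (rule coeffs_in_X2X2_Y1[OF z])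
    have Q: "supported (\<lambda>I u. ex u Z = 1 \<and> 2 \<le> ex u Y2) y1b"
      using y1(5) by (rule supported_mono) (use z_killed_1 in blast)
    show ?thesis
      by (rule is_boundary_kmul_annihilated[OF y1(3) Q w]) (auto simp: in_a_def)
  qed
  have K0: "is_boundary (kmul z y0a) \<and> is_boundary (kmul y0a z)"
  proof -
    obtain b w where w: "z = dK b + w"
      "supported (\<lambda>I u. 2 \<le> ex u X2 \<or> 2 \<le> ex u Y2 \<or> 1 \<le> ex u X2 \<and> 1 \<le> ex u Y2) w"
      by (rule coeffs_in_squares[OF z])
    have Q: "supported (\<lambda>I u. 1 \<le> ex u X1 \<and> 1 \<le> ex u Y1) y0a" using y0(4) by (rule supported_mono) auto
    show ?thesis
      by (rule is_boundary_kmul_annihilated[OF y0(2) Q w]) (auto simp: in_a_def)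
  qed
  have K0': "is_boundary (kmul z y0b) \<and> is_boundary (kmul y0b z)"
  proof -
    obtain b w where w: "z = dK b + w" "supported (\<lambda>I u. 1 \<le> ex u X1 \<or> 1 \<le> ex u Y1) w"
      by (rule coeffs_in_X1_Y1[OF z])
    have Q: "supported (\<lambda>I u. 2 \<le> ex u X2 \<and> 2 \<le> ex u Y2) y0b"
      using y0(5) by (rule supported_mono) (use z_killed_0 in blast)
    show ?thesis
      by (rule is_boundary_kmul_annihilated[OF y0(3) Q w]) (auto simp: in_a_def)
  qed
  have "y = y2 + y1a + y1b + y0a + y0b" by (simp add: y'(1) y10(1) y1(1) y0(1) add_ac)
  then show ?thesis
    using K2 K1 K1' K0 K0' by (simp add: kmul_add_left kmul_add_right is_boundary_add)
qed

text \<open>After eliminating \<open>x2\<close> and then \<open>y2\<close>, two cells of the same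
  kind share \<open>e_X2\<close> or \<open>e_Y2\<close> and multiply to 0, while for cells of
  different kinds the coefficients multiply into the ideal by \<open>m_ab\<close> or
  \<open>m_b\<close>.\<close>

lemma is_boundary_z_free_times_z_free:
  assumes z: "dK z = 0" "z \<in> kdeg n" "0 < n" "supported z_free z"
    and y: "dK y = 0" "y \<in> kdeg m" "0 < m" "supported z_free y"
  shows "is_boundary (kmul z y)"
proof -
  have A: "1 \<le> ex u X1 \<and> (1 \<le> ex u X2 \<or> 1 \<le> ex u Y1 \<and> 1 \<le> ex u Y2)"
    if "ex u Z = 0" "\<not> in_a u" "in_a (u + ev X2)" for u
    using that by (simp add: in_a_def ex_single) linarith
  have B: "1 \<le> ex u Y1 \<and> 1 \<le> ex u Y2"
    if "ex u Z = 0" "\<not> in_a u" "ex u X2 = 0" "in_a (u + ev Y2)" for u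
    using that by (simp add: in_a_def ex_single)
  let ?P = "\<lambda>I u. X2 \<in> I \<and> 1 \<le> ex u X1 \<and> (1 \<le> ex u X2 \<or> 1 \<le> ex u Y1 \<and> 1 \<le> ex u Y2)"
  let ?Q = "\<lambda>I u. Y2 \<in> I \<and> 1 \<le> ex u Y1 \<and> 1 \<le> ex u Y2"
  obtain b z1 z2 where z12: "z = dK b + z1 + z2" "dK z1 = 0"
    "supported (\<lambda>I u. z_free I u \<and> \<not> in_a u \<and> X2 \<in> I \<and> in_a (u + ev X2)) z1" "dK z2 = 0"
    "supported (\<lambda>I u. z_free I u \<and> \<not> in_a u \<and> X2 \<notin> I \<and> ex u X2 = 0 \<and> Y2 \<in> I \<and> in_a (u + ev Y2)) z2"
    by (rule two_step[OF z, of X2 Y2 X2 Y2]) auto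
  obtain c y1 y2 where y12: "y = dK c + y1 + y2" "dK y1 = 0"
    "supported (\<lambda>I u. z_free I u \<and> \<not> in_a u \<and> X2 \<in> I \<and> in_a (u + ev X2)) y1" "dK y2 = 0"
    "supported (\<lambda>I u. z_free I u \<and> \<not> in_a u \<and> X2 \<notin> I \<and> ex u X2 = 0 \<and> Y2 \<in> I \<and> in_a (u + ev Y2)) y2"
    by (rule two_step[OF y, of X2 Y2 X2 Y2]) auto
  have z1: "supported ?P z1" using z12(3) by (rule supported_mono) (use A in blast)
  have z2: "supported ?Q z2" using z12(5) by (rule supported_mono) (use B in blast)
  have y1: "supported ?P y1" using y12(3) by (rule supported_mono) (use A in blast)
  have y2: "supported ?Q y2" using y12(5) by (rule supported_mono) (use B in blast)
  have "kmul z1 y1 = 0" using z1 y1 by (rule kmul_eq_0_cells) auto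
  moreover have "kmul z1 y2 = 0" using z1 y2 by (rule kmul_eq_0_cells) (auto simp: in_a_def)
  moreover have "kmul z2 y1 = 0" using z2 y1 by (rule kmul_eq_0_cells) (auto simp: in_a_def)
  moreover have "kmul z2 y2 = 0" using z2 y2 by (rule kmul_eq_0_cells) auto
  ultimately have "kmul z y = kmul (dK b) y + kmul z1 (dK c) + kmul z2 (dK c)"
    by (simp add: z12(1) y12(1) kmul_add_left kmul_add_right)
  then show ?thesis
    using is_boundary_kmul_left[OF y(1)] is_boundary_kmul_right[OF z12(2)] is_boundary_kmul_right[OF z12(4)]
    by (simp add: is_boundary_add)
qed

text \<open>Eliminating \<open>z\<close> from both factors leaves the combinations already treated
  and the products of two cells with \<open>e_Z\<close>, which are 0.\<close>

theorem is_boundary_kmul: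
  assumes z: "dK z = 0" "z \<in> kdeg n" "0 < n"
    and y: "dK y = 0" "y \<in> kdeg m" "0 < m"
  shows "is_boundary (kmul z y)"
proof -
  have top: "supported (\<lambda>I u. True) w" for w :: "'a kos" by (simp add: supported_def)
  obtain b z0 z1 where z01: "z = dK b + z0 + z1" "z0 \<in> kdeg n" "z1 \<in> kdeg n" "dK z0 = 0" "dK z1 = 0"
    "supported (\<lambda>I u. True \<and> \<not> in_a u \<and> Z \<notin> I \<and> ex u Z = 0) z0" "supported (\<lambda>I u. True \<and> z_killed I u) z1"
    by (rule eliminate[OF z(1,2) top, of Z]) auto
  obtain c y0 y1 where y01: "y = dK c + y0 + y1" "y0 \<in> kdeg m" "y1 \<in> kdeg m" "dK y0 = 0" "dK y1 = 0"
    "supported (\<lambda>I u. True \<and> \<not> in_a u \<and> Z \<notin> I \<and> ex u Z = 0) y0" "supported (\<lambda>I u. True \<and> z_killed I u) y1"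
    by (rule eliminate[OF y(1,2) top, of Z]) auto
  have z0: "supported z_free z0" using z01(6) by (rule supported_mono) auto
  have z1: "supported z_killed z1" using z01(7) by (rule supported_mono) auto
  have y0: "supported z_free y0" using y01(6) by (rule supported_mono) auto
  have y1: "supported z_killed y1" using y01(7) by (rule supported_mono) auto
  have 1: "is_boundary (kmul z0 y1)"
    using is_boundary_z_free_times_z_killed[OF z01(4,2) z(3) z0 y01(5,3) y1] ..
  have 2: "is_boundary (kmul z1 y0)"
    using is_boundary_z_free_times_z_killed[OF y01(4,2) y(3) y0 z01(5,3) z1] ..
  have 3: "is_boundary (kmul z0 y0)"
    by (rule is_boundary_z_free_times_z_free[OF z01(4,2) z(3) z0 y01(4,2) y(3) y0])
  have "kmul z1 y1 = 0" using z1 y1 by (rule kmul_eq_0_cells) auto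
  then have "kmul z y = kmul (dK b) y + kmul z0 (dK c) + kmul z1 (dK c) + kmul z0 y0 + kmul z0 y1 + kmul z1 y0"
    by (simp add: z01(1) y01(1) kmul_add_left kmul_add_right add_ac)
  then show ?thesis
    using 1 2 3 is_boundary_kmul_left[OF y(1)] is_boundary_kmul_right[OF z01(4)] is_boundary_kmul_right[OF z01(5)]
    by (simp add: is_boundary_add)
qed

theorem trivial_homology_product_koszul:
  "trivial_homology_product (koszul (quot_map :: (var, 'k::field) mpoly \<Rightarrow> 'k quot_ring))"
  unfolding trivial_homology_product_def
proof (intro allI impI)
  fix i j and z w :: "'k kos"
  assume a: "0 < i \<and> 0 < j \<and> z \<in> cycles (koszul quot_map) i \<and> w \<in> cycles (koszul quot_map) j"
  then have "is_boundary (kmul z w)"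
    by (intro is_boundary_kmul[of z i w j]) (auto simp: cycles_def component_koszul diff_koszul)
  then obtain b where b: "kmul z w = dK b" by (auto simp: is_boundary_def)
  have "\<exists>c'. kmul z w + dK c = 0 + dK c'" for c
    by (rule exI[of _ "b + c"]) (simp add: b kdiff_add)
  moreover have "\<exists>c'. 0 + dK c = kmul z w + dK c'" for c
    by (rule exI[of _ "c - b"]) (simp add: b kdiff_diff)
  ultimately show "hclass (koszul quot_map) (mul (koszul quot_map) z w) = hclass (koszul quot_map) 0"
    by (auto simp: hclass_def mul_koszul diff_koszul elems_koszul)
qed

section \<open>The Massey product in the Taylor resolution\<close>

lemma strict_linear_order_onD:
  assumes r: "strict_linear_order_on A r"
  shows "(x, y) \<in> r \<Longrightarrow> (y, x) \<in> r \<Longrightarrow> False"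
    and "x \<in> A \<Longrightarrow> y \<in> A \<Longrightarrow> x \<noteq> y \<Longrightarrow> (x, y) \<in> r \<or> (y, x) \<in> r"
proof -
  have *: "trans r" "irrefl r" "total_on A r" using r by (auto simp: strict_linear_order_on_def)
  show "False" if "(x, y) \<in> r" "(y, x) \<in> r"
    using transD[OF *(1) that] *(2) by (simp add: irrefl_def)
  show "(x, y) \<in> r \<or> (y, x) \<in> r" if "x \<in> A" "y \<in> A" "x \<noteq> y"
    using *(3) that by (auto simp: total_on_def)
qed

lemma ex_gens:
  "ex m_a i = (case i of X1 \<Rightarrow> 1 | X2 \<Rightarrow> 2 | _ \<Rightarrow> 0)"
  "ex m_b i = (case i of Y1 \<Rightarrow> 1 | Y2 \<Rightarrow> 2 | _ \<Rightarrow> 0)"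
  "ex m_c i = (case i of Z \<Rightarrow> 3 | _ \<Rightarrow> 0)"
  "ex m_ab i = (case i of Z \<Rightarrow> 0 | _ \<Rightarrow> 1)"
  "ex m_bc i = (case i of Y2 \<Rightarrow> 2 | Z \<Rightarrow> 2 | _ \<Rightarrow> 0)"
  "ex m_ca i = (case i of X2 \<Rightarrow> 2 | Z \<Rightarrow> 2 | _ \<Rightarrow> 0)"
  "ex m_ab_c i = (case i of X1 \<Rightarrow> 1 | Y1 \<Rightarrow> 1 | Z \<Rightarrow> 1 | _ \<Rightarrow> 0)"
  "ex m_bc_a i = (case i of X2 \<Rightarrow> 2 | Y2 \<Rightarrow> 2 | Z \<Rightarrow> 1 | _ \<Rightarrow> 0)"
  by (cases i; simp add: gen_defs ex_single)+

lemma mono_eq_iff: "u = v \<longleftrightarrow> (\<forall>i. ex u i = ex v i)"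
  by (simp add: poly_mapping_eq_iff fun_eq_iff)

lemma distinct_gens: "distinct [m_a, m_b, m_c, m_ab, m_bc, m_ca, m_ab_c, m_bc_a]"
  by (simp add: mono_eq_iff all_var ex_gens)

lemma finite_gens: "finite gens"
  by (simp add: gens_def)

lemma gens_antichain: "g \<in> gens \<Longrightarrow> h \<in> gens \<Longrightarrow> mono_dvd h g \<Longrightarrow> h = g"
  by (simp add: gens_def, elim disjE; simp add: mono_dvd_def all_var ex_gens)

lemma mono_poly_mem_ideal_a: "mono_poly u \<in> (ideal_a :: (var, 'k::field) mpoly set) \<longleftrightarrow> in_a u"
  by (simp add: ideal_a_iff)

lemma min_gens_ideal_a: "min_gens (ideal_a :: (var, 'k::field) mpoly set) = gens"
proof -
  have refl: "mono_dvd g g" for g :: "var monomial" by (simp add: mono_dvd_def)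
  have gen: "in_a g" if "g \<in> gens" for g using that refl in_a_iff by blast
  show ?thesis
    unfolding min_gens_def mono_poly_mem_ideal_a
  proof (intro set_eqI iffI)
    fix u assume u: "u \<in> {u. in_a u \<and> (\<forall>v. in_a v \<and> mono_dvd v u \<longrightarrow> v = u)}"
    then obtain g where g: "g \<in> gens" "mono_dvd g u" using in_a_iff by blast
    then have "g = u" using u gen by blast
    with g show "u \<in> gens" by simp
  next
    fix u assume u: "u \<in> gens"
    have "v = u" if "in_a v" "mono_dvd v u" for v
    proof -
      obtain g where g: "g \<in> gens" "mono_dvd g v" using \<open>in_a v\<close> in_a_iff by blast
      have "mono_dvd g u" using g(2) that(2) unfolding mono_dvd_def by (meson order_trans)
      then have "g = u" using gens_antichain[OF u g(1)] by simp
      then show ?thesis using g(2) that(2) unfolding mono_dvd_def mono_eq_iff by (simp add: order_antisym)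
    qed
    with gen[OF u] show "u \<in> {u. in_a u \<and> (\<forall>v. in_a v \<and> mono_dvd v u \<longrightarrow> v = u)}" by simp
  qed
qed

lemma diff_ext_dga_single:
  "diff (ext_dga V r \<delta> \<pi>) (Poly_Mapping.single I c) =
     smul c (\<Sum>m\<in>I. Poly_Mapping.single (I - {m}) ((-1) ^ card {m' \<in> I. (m', m) \<in> r} * \<delta> I m))"
  by (simp add: ext_dga_def)

lemma mul_ext_dga_single:
  "mul (ext_dga V r \<delta> \<pi>) (Poly_Mapping.single I c) (Poly_Mapping.single J d) =
     (if I \<inter> J = {} then Poly_Mapping.single (I \<union> J)
        (c * d * ((-1) ^ card {(m, m'). m \<in> I \<and> m' \<in> J \<and> (m', m) \<in> r} * \<pi> I J)) else 0)"
  by (simp add: ext_dga_def mult.assoc)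

abbreviation taylor_alg :: "var monomial rel \<Rightarrow> (var monomial set \<Rightarrow>\<^sub>0 'k::field) dga" where
  "taylor_alg r \<equiv> taylor gens r (const_coeff :: (var, 'k) mpoly \<Rightarrow> 'k)"

text \<open>The coefficient of the Taylor differential modulo the variables: a quotient of least
  common multiples becomes 1 if it is the trivial monomial and 0 otherwise.\<close>

definition lcm_delta :: "var monomial set \<Rightarrow> var monomial \<Rightarrow> 'k::field" where
  "lcm_delta I m = (if \<forall>i. ex (mono_lcm I) i \<le> ex (mono_lcm (I - {m})) i then 1 else 0)"

lemma ex_mono_lcm: "ex (mono_lcm I) i = Max (insert 0 ((\<lambda>u. ex u i) ` I))"
  by (simp add: mono_lcm.rep_eq image_image)

lemma diff_taylor:
  "diff (taylor_alg r :: (_ \<Rightarrow>\<^sub>0 'k::field) dga) (Poly_Mapping.single I c) =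
     smul c (\<Sum>m\<in>I. Poly_Mapping.single (I - {m}) ((-1) ^ card {m' \<in> I. (m', m) \<in> r} * lcm_delta I m))"
proof -
  have "const_coeff (mono_poly (mono_lcm I - mono_lcm (I - {m})) :: (var, 'k) mpoly) = lcm_delta I m" for m
    by (auto simp: lookup_single when_def lcm_delta_def mono_eq_iff)
  then show ?thesis by (simp add: taylor_def diff_ext_dga_single)
qed

text \<open>By the inequality, the structure constant is a unit monomial. The sign is left open
  because it depends on the order \<open>r\<close>.\<close>

lemma mul_taylor:
  assumes "I \<inter> J = {}" "\<And>i. ex (mono_lcm I) i + ex (mono_lcm J) i \<le> ex (mono_lcm (I \<union> J)) i"
  shows "\<exists>n. mul (taylor_alg r :: (_ \<Rightarrow>\<^sub>0 'k::field) dga) (Poly_Mapping.single I c) (Poly_Mapping.single J d) =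
    Poly_Mapping.single (I \<union> J) (c * d * (-1) ^ n)"
proof -
  have "mono_lcm I + mono_lcm J - mono_lcm (I \<union> J) = 0" using assms(2) by (simp add: mono_eq_iff)
  then show ?thesis using assms(1) by (auto simp: taylor_def mul_ext_dga_single)
qed

section \<open>The cocycle given by the colouring\<close>

definition colour :: "var monomial \<Rightarrow> nat" where
  "colour m = (if m \<in> {m_a, m_ca, m_bc_a} then 0 else if m \<in> {m_ab, m_ab_c} then 1
     else if m \<in> {m_b, m_bc} then 2 else 3)"

text \<open>On a colourful set, the parity of the permutation that compares the order
  \<open>r\<close> with the order of the colours.\<close>

definition inversions :: "var monomial rel \<Rightarrow> var monomial set \<Rightarrow> nat" where
  "inversions r I = card {(p, q). p \<in> I \<and> q \<in> I \<and> colour p < colour q \<and> (q, p) \<in> r}"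

definition colourful :: "var monomial set \<Rightarrow> bool" where
  "colourful I \<longleftrightarrow> bij_betw colour I {0, 1, 2, 3}"

lemma colour_gens:
  "colour m_a = 0" "colour m_ca = 0" "colour m_bc_a = 0" "colour m_ab = 1" "colour m_ab_c = 1"
  "colour m_b = 2" "colour m_bc = 2" "colour m_c = 3"
  using distinct_gens by (auto simp: colour_def)

text \<open>This is the reason for the choice of colours: generators of colour 0 contain
  \<open>x2^2\<close>, those of colour 1 contain \<open>x1 y1\<close>, those of colour 2 contain
  \<open>y2^2\<close>, and colour 3 is \<open>z^3\<close>. So a set meeting all colours has the lcm
  of all generators, and the coefficients of faces leading to it are those of a simplex.\<close>

lemma lcm_delta_eq_1:
  assumes J: "J \<subseteq> gens" and "colour ` (J - {m}) = {0, 1, 2, 3}"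
  shows "lcm_delta J m = 1"
proof -
  \<comment> \<open>The exponents of the least common multiple of all generators.\<close>
  define t :: "var \<Rightarrow> nat" where "t = (\<lambda>i. case i of X1 \<Rightarrow> 1 | X2 \<Rightarrow> 2 | Y1 \<Rightarrow> 1 | Y2 \<Rightarrow> 2 | Z \<Rightarrow> 3)"
  have fin: "finite J" using J finite_gens finite_subset by blast
  have le: "ex g i \<le> t i" if "g \<in> gens" for g i
    using that by (cases i) (auto simp: gens_def ex_gens t_def)
  have ge: "\<exists>g\<in>J - {m}. t i \<le> ex g i" for i
  proof -
    have "\<exists>g\<in>J - {m}. colour g = k" if "k \<in> {0, 1, 2, 3}" for k
      using that unfolding assms(2)[symmetric] by blast
    \<comment> \<open>The colour all of whose members attain the maximal exponent of the variable
      \<open>i\<close>.\<close>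
    from this[of "case i of X1 \<Rightarrow> 1 | X2 \<Rightarrow> 0 | Y1 \<Rightarrow> 1 | Y2 \<Rightarrow> 2 | Z \<Rightarrow> 3"]
    obtain g where g: "g \<in> J - {m}" "colour g = (case i of X1 \<Rightarrow> 1 | X2 \<Rightarrow> 0 | Y1 \<Rightarrow> 1 | Y2 \<Rightarrow> 2 | Z \<Rightarrow> 3)"
      by (cases i) auto
    have "g \<in> gens" using g J by auto
    then have "t i \<le> ex g i"
      using g(2) by (cases i) (auto simp: gens_def colour_gens ex_gens t_def)
    with g show ?thesis by blast
  qed
  have "ex (mono_lcm J) i \<le> ex (mono_lcm (J - {m})) i" for i
  proof -
    have "ex (mono_lcm J) i \<le> t i"
      unfolding ex_mono_lcm using fin J le by (intro Max.boundedI) auto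
    also obtain g where "g \<in> J - {m}" "t i \<le> ex g i" using ge by blast
    then have "t i \<le> ex (mono_lcm (J - {m})) i"
      unfolding ex_mono_lcm using fin by (intro Max.coboundedI[THEN order_trans[rotated]]) auto
    finally show ?thesis .
  qed
  then show ?thesis by (simp add: lcm_delta_def)
qed

lemma inversions_insert:
  assumes "finite K" "x \<notin> K"
  shows "inversions r (insert x K) = inversions r K +
    (card {p \<in> K. colour p < colour x \<and> (x, p) \<in> r} + card {q \<in> K. colour x < colour q \<and> (q, x) \<in> r})"
proof -
  let ?A = "{(p, q). p \<in> K \<and> q \<in> K \<and> colour p < colour q \<and> (q, p) \<in> r}"
  let ?B = "(\<lambda>p. (p, x)) ` {p \<in> K. colour p < colour x \<and> (x, p) \<in> r}"
  let ?C = "Pair x ` {q \<in> K. colour x < colour q \<and> (q, x) \<in> r}"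
  have "?A \<subseteq> K \<times> K" by auto
  then have "finite ?A" using assms(1) by (meson finite_SigmaI finite_subset)
  have "{(p, q). p \<in> insert x K \<and> q \<in> insert x K \<and> colour p < colour q \<and> (q, p) \<in> r} = ?A \<union> (?B \<union> ?C)"
    by auto
  then have "inversions r (insert x K) = card (?A \<union> (?B \<union> ?C))" by (simp add: inversions_def)
  also have "\<dots> = card ?A + card (?B \<union> ?C)"
    using \<open>finite ?A\<close> assms by (intro card_Un_disjoint) auto
  also have "card (?B \<union> ?C) = card ?B + card ?C"
    using assms by (intro card_Un_disjoint) auto
  finally show ?thesis by (simp add: inversions_def card_image inj_on_def)
qed

text \<open>An element of \<open>K\<close> is inverted with \<open>x\<close> if it precedes
  \<open>x\<close> in exactly one of the two orders, so modulo 2 the inversions with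
  \<open>x\<close> are the sum of its positions in both. The position in the colour order depends on
  \<open>x\<close> only through its colour, which makes two elements of equal colour
  comparable.\<close>

lemma inversions_insert_parity:
  assumes r: "strict_linear_order_on gens r" and K: "K \<subseteq> gens" "x \<in> gens" "x \<notin> K" "colour x \<notin> colour ` K"
  shows "(-1) ^ inversions r (insert x K) =
    (-1) ^ (inversions r K + card {p \<in> K. colour p < colour x} + card {p \<in> K. (p, x) \<in> r} :: nat) * (1 :: 'k::field)"
proof -
  have fin: "finite K" using K(1) finite_gens finite_subset by blast
  let ?c = "colour x"
  let ?a = "card {p \<in> K. colour p < ?c \<and> (x, p) \<in> r}"
  let ?a' = "card {p \<in> K. colour p < ?c \<and> (p, x) \<in> r}"
  let ?b = "card {q \<in> K. ?c < colour q \<and> (q, x) \<in> r}"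
  have c: "colour p < ?c \<or> ?c < colour p" if "p \<in> K" for p
  proof -
    have "colour p \<noteq> ?c" using that K(4) by (metis image_eqI)
    then show ?thesis by linarith
  qed
  have o: "((x, p) \<in> r \<or> (p, x) \<in> r) \<and> \<not> ((x, p) \<in> r \<and> (p, x) \<in> r)" if "p \<in> K" for p
    using strict_linear_order_onD[OF r] that K by (metis subsetD)
  have "{p \<in> K. (p, x) \<in> r} = {p \<in> K. colour p < ?c \<and> (p, x) \<in> r} \<union> {q \<in> K. ?c < colour q \<and> (q, x) \<in> r}"
    using c by auto
  moreover have "card ({p \<in> K. colour p < ?c \<and> (p, x) \<in> r} \<union> {q \<in> K. ?c < colour q \<and> (q, x) \<in> r}) = ?a' + ?b"
    using fin by (intro card_Un_disjoint) auto
  ultimately have 1: "card {p \<in> K. (p, x) \<in> r} = ?a' + ?b" by simp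
  have "{p \<in> K. colour p < ?c} = {p \<in> K. colour p < ?c \<and> (x, p) \<in> r} \<union> {p \<in> K. colour p < ?c \<and> (p, x) \<in> r}"
    using o by auto
  moreover have "card ({p \<in> K. colour p < ?c \<and> (x, p) \<in> r} \<union> {p \<in> K. colour p < ?c \<and> (p, x) \<in> r}) = ?a + ?a'"
    using fin o by (intro card_Un_disjoint) auto
  ultimately have 2: "card {p \<in> K. colour p < ?c} = ?a + ?a'" by simp
  have "inversions r K + card {p \<in> K. colour p < ?c} + card {p \<in> K. (p, x) \<in> r} =
      inversions r (insert x K) + 2 * ?a'"
    unfolding inversions_insert[OF fin K(3)] 1 2 by simp
  then show ?thesis by (simp add: power_add power_mult)
qed

definition colour_form :: "var monomial rel \<Rightarrow> (var monomial set \<Rightarrow>\<^sub>0 'k::field) \<Rightarrow> 'k" where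
  "colour_form r u = (\<Sum>I\<in>Pow gens. if colourful I then (-1) ^ inversions r I * Poly_Mapping.lookup u I else 0)"

lemma colour_form_add: "colour_form r (u + w) = colour_form r u + colour_form r w"
  by (simp add: colour_form_def lookup_add sum.distrib[symmetric] distrib_left cong: if_cong)
    (intro sum.cong refl, simp add: distrib_left)

lemma colour_form_smul: "colour_form r (smul c u) = c * colour_form r u"
  by (simp add: colour_form_def sum_distrib_left if_distrib mult.left_commute cong: if_cong)

lemma colour_form_zero: "colour_form r 0 = 0"
  unfolding colour_form_def by (intro sum.neutral) simp

lemma colour_form_sum: "colour_form r (\<Sum>a\<in>A. f a) = (\<Sum>a\<in>A. colour_form r (f a))"
  by (induction A rule: infinite_finite_induct) (simp_all add: colour_form_add colour_form_zero)

lemma colour_form_single: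
  assumes "I \<subseteq> gens"
  shows "colour_form r (Poly_Mapping.single I c) = (if colourful I then (-1) ^ inversions r I * c else 0)"
proof -
  have "colour_form r (Poly_Mapping.single I c) =
      (\<Sum>J\<in>Pow gens. if J = I then if colourful I then (-1) ^ inversions r I * c else 0 else 0)"
    unfolding colour_form_def by (intro sum.cong refl) (auto simp: lookup_single when_def)
  then show ?thesis using assms finite_gens by simp
qed

text \<open>If removing one element of \<open>J\<close> leaves a colourful set, then exactly one colour is repeated
  in \<open>J\<close>, and the contributions of the two elements of this colour cancel.\<close>

lemma colour_form_boundary:
  assumes r: "strict_linear_order_on gens r" and J: "J \<subseteq> gens"
  shows "(\<Sum>m\<in>J. colour_form r (Poly_Mapping.single (J - {m})
    ((-1) ^ card {m' \<in> J. (m', m) \<in> r} * lcm_delta J m))) = (0 :: 'k::field)"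
proof (cases "\<exists>x\<in>J. colourful (J - {x})")
  case False
  then show ?thesis
    using J by (intro sum.neutral ballI) (simp add: colour_form_single subset_iff)
next
  case True
  then obtain x where x: "x \<in> J" "colourful (J - {x})" by blast
  have finJ: "finite J" using J finite_gens finite_subset by blast
  have "colour x \<in> {0, 1, 2, 3}" by (simp add: colour_def)
  then have "colour x \<in> colour ` (J - {x})" using x(2) by (simp add: colourful_def bij_betw_def)
  then obtain y where y: "y \<in> J" "y \<noteq> x" "colour y = colour x" by (elim imageE) (metis DiffE singletonI)
  define K where "K = J - {x, y}"
  have K: "J - {x} = insert y K" "J - {y} = insert x K" "x \<notin> K" "y \<notin> K" "J = insert x (insert y K)" "finite K" "K \<subseteq> gens"
    using x y finJ J by (auto simp: K_def)
  have inj: "inj_on colour (insert y K)" "colour ` insert y K = {0, 1, 2, 3}"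
    using x(2) by (simp_all add: K(1) colourful_def bij_betw_def)
  have cK: "colour y \<notin> colour ` K" using inj(1) K(4) by (auto simp: inj_on_def)
  have cK': "colour x \<notin> colour ` K" using cK y(3) by simp
  have "inj_on colour (insert x K)" "colour ` insert x K = {0, 1, 2, 3}"
    using inj K(3,4) cK y(3) by (auto simp: inj_on_insert)
  then have y': "colourful (J - {y})" by (simp add: K(2) colourful_def bij_betw_def)
  have other: "\<not> colourful (J - {m})" if "m \<in> J - {x, y}" for m
  proof
    assume "colourful (J - {m})"
    then have "inj_on colour (J - {m})" by (simp add: colourful_def bij_betw_def)
    moreover have "x \<in> J - {m}" "y \<in> J - {m}" using that x y by auto
    ultimately show False using y by (meson inj_onD)
  qed
  let ?f = "\<lambda>m. colour_form r (Poly_Mapping.single (J - {m})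
    ((-1) ^ card {m' \<in> J. (m', m) \<in> r} * lcm_delta J m)) :: 'k"
  have sub: "J - {m} \<subseteq> gens" for m using J by auto
  have "(\<Sum>m\<in>J. ?f m) = (\<Sum>m\<in>{x, y}. ?f m)"
    using finJ x(1) y(1) other by (intro sum.mono_neutral_right) (auto simp: colour_form_single[OF sub])
  also have "\<dots> = ?f x + ?f y" using y(2) by simp
  also have "?f x = (-1) ^ (inversions r (insert y K) + card {m' \<in> J. (m', x) \<in> r})"
  proof -
    have "lcm_delta J x = (1 :: 'k)" using inj(2) by (intro lcm_delta_eq_1[OF J]) (simp only: K(1))
    then show ?thesis using x(2) unfolding colour_form_single[OF sub] by (simp add: K(1) power_add)
  qed
  also have "?f y = (-1) ^ (inversions r (insert x K) + card {m' \<in> J. (m', y) \<in> r})"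
  proof -
    have "lcm_delta J y = (1 :: 'k)"
      using \<open>colour ` insert x K = {0, 1, 2, 3}\<close> by (intro lcm_delta_eq_1[OF J]) (simp only: K(2))
    then show ?thesis using y' unfolding colour_form_single[OF sub] by (simp add: K(2) power_add)
  qed
  finally have sum: "(\<Sum>m\<in>J. ?f m) = (-1) ^ inversions r (insert y K) * (-1) ^ card {m' \<in> J. (m', x) \<in> r} +
      (-1) ^ inversions r (insert x K) * (-1) ^ card {m' \<in> J. (m', y) \<in> r}" by (simp add: power_add)
  have xg: "x \<in> gens" "y \<in> gens" using x y J by auto
  have irr: "(m, m) \<notin> r" for m using strict_linear_order_onD(1)[OF r] by blast
  have cx: "card {m' \<in> J. (m', x) \<in> r} = card {p \<in> K. (p, x) \<in> r} + (if (y, x) \<in> r then 1 else 0)"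
  proof -
    have "{m' \<in> J. (m', x) \<in> r} = {p \<in> K. (p, x) \<in> r} \<union> (if (y, x) \<in> r then {y} else {})"
      using K(5) irr by auto
    then show ?thesis using K(4,6) by auto
  qed
  have cy: "card {m' \<in> J. (m', y) \<in> r} = card {p \<in> K. (p, y) \<in> r} + (if (x, y) \<in> r then 1 else 0)"
  proof -
    have "{m' \<in> J. (m', y) \<in> r} = {p \<in> K. (p, y) \<in> r} \<union> (if (x, y) \<in> r then {x} else {})"
      using K(5) irr by auto
    then show ?thesis using K(3,6) by auto
  qed
  \<comment> \<open>All parts of the exponents that depend on \<open>K\<close> and on the common
    colour agree. The signs then differ by which of \<open>x\<close> and \<open>y\<close> comes
    first, so they are opposite.\<close>
  have "(x, y) \<in> r \<and> (y, x) \<notin> r \<or> (y, x) \<in> r \<and> (x, y) \<notin> r"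
    using strict_linear_order_onD[OF r] xg y(2) by metis
  then show ?thesis
    unfolding sum cx cy inversions_insert_parity[OF r K(7) xg(2) K(4) cK]
      inversions_insert_parity[OF r K(7) xg(1) K(3) cK'] y(3)
    by (auto simp: power_add mult_ac)
qed

lemma colour_form_diff:
  assumes r: "strict_linear_order_on gens r" and u: "u \<in> elems (taylor_alg r)"
  shows "colour_form r (diff (taylor_alg r) u) = (0 :: 'k::field)"
proof -
  let ?d = "diff (taylor_alg r :: (_ \<Rightarrow>\<^sub>0 'k) dga)"
  have d: "?d u = (\<Sum>J\<in>Poly_Mapping.keys u. ?d (Poly_Mapping.single J (Poly_Mapping.lookup u J)))"
  proof -
    have "?d (\<Sum>J\<in>Poly_Mapping.keys u. Poly_Mapping.single J (Poly_Mapping.lookup u J)) =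
        (\<Sum>J\<in>Poly_Mapping.keys u. ?d (Poly_Mapping.single J (Poly_Mapping.lookup u J)))"
      unfolding taylor_def ext_dga_def dga.simps by (rule lin_ext_sum)
    then show ?thesis by (simp add: sum_singles)
  qed
  have "Poly_Mapping.keys u \<subseteq> Pow gens"
    using u by (simp add: taylor_def ext_dga_def free_mod_def)
  then have "colour_form r (?d (Poly_Mapping.single J c)) = 0" if "J \<in> Poly_Mapping.keys u" for J c
    using colour_form_boundary[OF r, of J] that
    by (auto simp: diff_taylor colour_form_smul colour_form_sum)
  then show ?thesis by (subst d) (simp add: colour_form_sum)
qed

section \<open>An explicit defining system and its value\<close>

lemma mul_taylor_coprime:
  assumes "I \<inter> J = {}" "finite I" "finite J" and cop: "\<And>g h i. g \<in> I \<Longrightarrow> h \<in> J \<Longrightarrow> ex g i = 0 \<or> ex h i = 0"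
  shows "\<exists>n. mul (taylor_alg r :: (_ \<Rightarrow>\<^sub>0 'k::field) dga) (Poly_Mapping.single I c) (Poly_Mapping.single J d) =
    Poly_Mapping.single (I \<union> J) (c * d * (-1) ^ n)"
proof (rule mul_taylor[OF assms(1)])
  fix i
  have mono: "ex (mono_lcm A) i \<le> ex (mono_lcm (I \<union> J)) i" if "A \<subseteq> I \<union> J" for A
    unfolding ex_mono_lcm using that assms(2,3) by (intro Max_mono) auto
  have zero: "ex (mono_lcm A) i = 0" if "\<And>g. g \<in> A \<Longrightarrow> ex g i = 0" for A
  proof -
    have *: "insert 0 ((\<lambda>u. ex u i) ` A) = {0}" using that by auto
    show ?thesis unfolding ex_mono_lcm * by simp
  qed
  show "ex (mono_lcm I) i + ex (mono_lcm J) i \<le> ex (mono_lcm (I \<union> J)) i"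
  proof (cases "\<exists>g\<in>I. ex g i \<noteq> 0")
    case True
    then obtain g where g: "g \<in> I" "ex g i \<noteq> 0" by blast
    have "ex (mono_lcm J) i = 0"
    proof (rule zero)
      fix h assume "h \<in> J"
      from cop[OF g(1) this, of i] show "ex h i = 0" using g(2) by simp
    qed
    then show ?thesis using mono[of I] by simp
  next
    case False
    then have "ex (mono_lcm I) i = 0" by (intro zero) blast
    then show ?thesis using mono[of J] by simp
  qed
qed

lemma lcm_delta_eq_0:
  assumes "finite I" "m \<in> I" "\<And>h. h \<in> I - {m} \<Longrightarrow> ex h i < ex m i" "0 < ex m i"
  shows "lcm_delta I m = 0"
proof -
  have "ex (mono_lcm (I - {m})) i < ex m i"
    unfolding ex_mono_lcm using assms by (subst Max_less_iff) auto
  also have "\<dots> \<le> ex (mono_lcm I) i"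
    unfolding ex_mono_lcm using assms by (intro Max_ge) auto
  finally show ?thesis unfolding lcm_delta_def by (metis not_le)
qed

lemma lcm_delta_eq_1':
  assumes "finite I" "\<And>i. \<exists>h\<in>I - {m}. ex m i \<le> ex h i"
  shows "lcm_delta I m = 1"
proof -
  have "ex (mono_lcm I) i \<le> ex (mono_lcm (I - {m})) i" for i
  proof -
    have ge: "ex h i \<le> ex (mono_lcm (I - {m})) i" if "h \<in> I - {m}" for h
      unfolding ex_mono_lcm using assms(1) that by (intro Max_ge) auto
    obtain h where h: "h \<in> I - {m}" "ex m i \<le> ex h i" using assms(2) by blast
    have "ex g i \<le> ex (mono_lcm (I - {m})) i" if "g \<in> I" for g
      using ge[of g] ge[OF h(1)] h(2) that by (cases "g = m") auto
    then show ?thesis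
      unfolding ex_mono_lcm[of I] using assms(1) by (intro Max.boundedI) auto
  qed
  then show ?thesis by (simp add: lcm_delta_def)
qed

lemma diff_taylor_one_term:
  assumes "finite I" "m \<in> I" "lcm_delta I m = (1 :: 'k::field)" "\<And>h. h \<in> I - {m} \<Longrightarrow> lcm_delta I h = (0 :: 'k)"
  shows "\<exists>n. \<forall>c. diff (taylor_alg r :: (_ \<Rightarrow>\<^sub>0 'k) dga) (Poly_Mapping.single I c) =
    Poly_Mapping.single (I - {m}) (c * (-1) ^ n)"
proof -
  let ?f = "\<lambda>h. Poly_Mapping.single (I - {h}) ((-1) ^ card {m' \<in> I. (m', h) \<in> r} * (lcm_delta I h :: 'k))"
  have "(\<Sum>h\<in>I. ?f h) = (\<Sum>h\<in>{m}. ?f h)"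
    using assms by (intro sum.mono_neutral_right) auto
  also have "\<dots> = Poly_Mapping.single (I - {m}) ((-1) ^ card {m' \<in> I. (m', m) \<in> r})"
    using assms(3) by simp
  finally show ?thesis by (auto simp: diff_taylor)
qed

lemma massey_taylor:
  assumes r: "strict_linear_order_on gens r"
  defines "T \<equiv> taylor_alg r :: (var monomial set \<Rightarrow>\<^sub>0 'k::field) dga"
    and "e \<equiv> \<lambda>I. Poly_Mapping.single I (1 :: 'k)"
  shows "\<exists>x \<in> massey T [hclass T (e {m_a}), hclass T (e {m_b}), hclass T (e {m_c})]. x \<noteq> hclass T 0"
proof -
  note ne = distinct_gens[simplified]
  let ?s = "Poly_Mapping.single :: _ \<Rightarrow> 'k \<Rightarrow> _"
  have cop: "ex g i = 0 \<or> ex h i = 0"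
    if "g \<in> {m_a} \<and> h \<in> {m_b, m_c, m_bc} \<or> g \<in> {m_a, m_b, m_ab} \<and> h \<in> {m_c} \<or> g \<in> {m_b} \<and> h \<in> {m_c}" for g h i
    using that by (cases i) (auto simp: ex_gens)
  obtain n1 where n1: "mul T (e {m_a}) (e {m_b}) = ?s {m_a, m_b} ((-1) ^ n1)"
    using mul_taylor_coprime[of "{m_a}" "{m_b}" r 1 1] cop ne by (auto simp: T_def e_def insert_commute)
  obtain n2 where n2: "mul T (e {m_b}) (e {m_c}) = ?s {m_b, m_c} ((-1) ^ n2)"
    using mul_taylor_coprime[of "{m_b}" "{m_c}" r 1 1] cop ne by (auto simp: T_def e_def insert_commute)
  \<comment> \<open>\<open>m_ab\<close> divides the lcm of \<open>m_a\<close> and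
    \<open>m_b\<close>, whereas omitting \<open>m_a\<close> or \<open>m_b\<close> lowers the
    exponent of \<open>x2\<close> or \<open>y2\<close>; so a single face survives modulo the
    variables.\<close>
  have "\<exists>n. \<forall>c. diff T (?s {m_a, m_b, m_ab} c) = ?s ({m_a, m_b, m_ab} - {m_ab}) (c * (-1) ^ n)"
    unfolding T_def
  proof (rule diff_taylor_one_term)
    show "lcm_delta {m_a, m_b, m_ab} m_ab = (1 :: 'k)"
    proof (rule lcm_delta_eq_1')
      fix i
      have "{m_a, m_b, m_ab} - {m_ab} = {m_a, m_b}" using ne by auto
      then show "\<exists>h\<in>{m_a, m_b, m_ab} - {m_ab}. ex m_ab i \<le> ex h i"
        by (cases i) (simp_all add: ex_gens, auto)
    qed simp
    fix h assume "h \<in> {m_a, m_b, m_ab} - {m_ab}"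
    then have "h = m_a \<or> h = m_b" by auto
    moreover have "lcm_delta {m_a, m_b, m_ab} m_a = (0 :: 'k)"
      by (rule lcm_delta_eq_0[of _ _ X2]) (auto simp: ex_gens)
    moreover have "lcm_delta {m_a, m_b, m_ab} m_b = (0 :: 'k)"
      by (rule lcm_delta_eq_0[of _ _ Y2]) (auto simp: ex_gens)
    ultimately show "lcm_delta {m_a, m_b, m_ab} h = (0 :: 'k)" by auto
  qed auto
  moreover have "{m_a, m_b, m_ab} - {m_ab} = {m_a, m_b}" using ne by auto
  ultimately obtain n3 where n3: "\<And>c. diff T (?s {m_a, m_b, m_ab} c) = ?s {m_a, m_b} (c * (-1) ^ n3)" by auto
  \<comment> \<open>Likewise \<open>m_bc\<close> divides the lcm of \<open>m_b\<close> and
    \<open>m_c\<close>, whereas \<open>y1\<close> comes from \<open>m_b\<close> alone and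
    \<open>z^3\<close> from \<open>m_c\<close> alone.\<close>
  have "\<exists>n. \<forall>c. diff T (?s {m_b, m_c, m_bc} c) = ?s ({m_b, m_c, m_bc} - {m_bc}) (c * (-1) ^ n)"
    unfolding T_def
  proof (rule diff_taylor_one_term)
    show "lcm_delta {m_b, m_c, m_bc} m_bc = (1 :: 'k)"
    proof (rule lcm_delta_eq_1')
      fix i
      have "{m_b, m_c, m_bc} - {m_bc} = {m_b, m_c}" using ne by auto
      then show "\<exists>h\<in>{m_b, m_c, m_bc} - {m_bc}. ex m_bc i \<le> ex h i"
        by (cases i) (simp_all add: ex_gens, auto)
    qed simp
    fix h assume "h \<in> {m_b, m_c, m_bc} - {m_bc}"
    then have "h = m_b \<or> h = m_c" by auto
    moreover have "lcm_delta {m_b, m_c, m_bc} m_b = (0 :: 'k)"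
      by (rule lcm_delta_eq_0[of _ _ Y1]) (auto simp: ex_gens)
    moreover have "lcm_delta {m_b, m_c, m_bc} m_c = (0 :: 'k)"
      by (rule lcm_delta_eq_0[of _ _ Z]) (auto simp: ex_gens)
    ultimately show "lcm_delta {m_b, m_c, m_bc} h = (0 :: 'k)" by auto
  qed auto
  moreover have "{m_b, m_c, m_bc} - {m_bc} = {m_b, m_c}" using ne by auto
  ultimately obtain n4 where n4: "\<And>c. diff T (?s {m_b, m_c, m_bc} c) = ?s {m_b, m_c} (c * (-1) ^ n4)" by auto
  have cycle: "diff T (e {m}) = 0" if "m \<in> {m_a, m_b, m_c}" for m
  proof -
    have "lcm_delta {m} m = (0 :: 'k)"
      using that by (intro lcm_delta_eq_0[of _ _ "if m = m_a then X1 else if m = m_b then Y1 else Z"]) (use ne in \<open>auto simp: ex_gens\<close>)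
    then show ?thesis by (simp add: T_def e_def diff_taylor)
  qed
  \<comment> \<open>The exponents compensate the unspecified signs of product and
    differential.\<close>
  define a12 where "a12 = ?s {m_a, m_b, m_ab} ((-1) ^ (n1 + n3))"
  define a23 where "a23 = ?s {m_b, m_c, m_bc} ((-1) ^ (n2 + n4))"
  have sq: "(-1) ^ (n + n') * (-1) ^ n' = ((-1) ^ n :: 'k)" for n n'
    by (simp add: power_add mult.assoc flip: power_mult_distrib)
  have d12: "diff T a12 = mul T (e {m_a}) (e {m_b})" by (simp add: a12_def n1 n3 sq)
  have d23: "diff T a23 = mul T (e {m_b}) (e {m_c})" by (simp add: a23_def n2 n4 sq)
  obtain n5 where n5: "mul T (e {m_a}) a23 = ?s ({m_a} \<union> {m_b, m_c, m_bc}) (1 * (-1) ^ (n2 + n4) * (-1) ^ n5)"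
    unfolding T_def e_def a23_def
    using mul_taylor_coprime[of "{m_a}" "{m_b, m_c, m_bc}" r 1 "(-1) ^ (n2 + n4)"] cop ne by auto
  obtain n6 where n6: "mul T a12 (e {m_c}) = ?s ({m_a, m_b, m_ab} \<union> {m_c}) ((-1) ^ (n1 + n3) * 1 * (-1) ^ n6)"
    unfolding T_def e_def a12_def
    using mul_taylor_coprime[of "{m_a, m_b, m_ab}" "{m_c}" r "(-1) ^ (n1 + n3)" 1] cop ne by auto
  \<comment> \<open>Each \<open>a i j\<close> is a multiple of a basis vector on
    \<open>2 * (j - i) + 1\<close> generators. These degrees are odd, so \<open>bar\<close> is the
    identity throughout.\<close>
  define p :: "nat \<Rightarrow> nat \<Rightarrow> nat" where "p = (\<lambda>i j. 2 * (j - i) + 1)"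
  define a where "a = (\<lambda>(i::nat) (j::nat). if i = 1 \<and> j = 1 then e {m_a} else if i = 2 \<and> j = 2 then e {m_b}
    else if i = 3 then e {m_c} else if i = 1 then a12 else a23)"
  let ?cs = "[hclass T (e {m_a}), hclass T (e {m_b}), hclass T (e {m_c})]"
  have cases: "i = 1 \<and> j = 1 \<or> i = 2 \<and> j = 2 \<or> i = 3 \<and> j = 3 \<or> i = 1 \<and> j = 2 \<or> i = 2 \<and> j = 3"
    if "1 \<le> i" "i \<le> j" "j \<le> 3" "(i, j) \<noteq> (1, 3)" for i j :: nat
  proof -
    have "i = 1 \<or> i = 2 \<or> i = 3" "j = 1 \<or> j = 2 \<or> j = 3" using that by linarith+
    then show ?thesis using that by auto
  qed
  have comp: "?s I c \<in> component T n" if "I \<subseteq> gens" "card I = n" for I c n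
    using that by (simp add: T_def taylor_def ext_dga_def free_mod_single)
  have gg: "{m_a, m_b, m_c, m_ab, m_bc} \<subseteq> gens" by (auto simp: gens_def)
  have "defining_system T ?cs p a"
    unfolding defining_system_def Let_def
  proof (intro conjI allI impI)
    fix i j :: nat assume "1 \<le> i \<and> i \<le> j \<and> j \<le> length ?cs \<and> (i, j) \<noteq> (1, length ?cs)"
    then have "i = 1 \<and> j = 1 \<or> i = 2 \<and> j = 2 \<or> i = 3 \<and> j = 3 \<or> i = 1 \<and> j = 2 \<or> i = 2 \<and> j = 3"
      by (intro cases) auto
    then show "a i j \<in> component T (p i j)"
      using gg ne by (elim disjE) (simp_all add: a_def p_def e_def a12_def a23_def comp)
  next
    fix i v j :: nat assume "1 \<le> i \<and> i \<le> v \<and> v < j \<and> j \<le> length ?cs"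
    then show "p i j = p i v + p (Suc v) j + 1" unfolding p_def by arith
  next
    fix i :: nat assume "1 \<le> i \<and> i \<le> length ?cs"
    then have "i = 1 \<or> i = 2 \<or> i = 3" by auto
    then show "diff T (a i i) = 0" "hclass T (a i i) = ?cs ! (i - 1)"
      by (auto simp: a_def cycle numeral_2_eq_2)
  next
    fix i j :: nat assume "1 \<le> i \<and> i < j \<and> j \<le> length ?cs \<and> (i, j) \<noteq> (1, length ?cs)"
    then have "i = 1 \<and> j = 2 \<or> i = 2 \<and> j = 3"
      using cases[of i j] by auto
    then show "diff T (a i j) = (\<Sum>v=i..<j. mul T (bar (p i v) (a i v)) (a (Suc v) j))"
    proof
      assume "i = 1 \<and> j = 2"
      moreover have "{1..<2} = {1::nat}" by auto
      ultimately show ?thesis by (simp add: a_def p_def bar_def d12)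
    next
      assume "i = 2 \<and> j = 3"
      moreover have "{2..<3} = {2::nat}" by auto
      ultimately show ?thesis by (simp add: a_def p_def bar_def d23)
    qed
  qed
  moreover define v where "v = (\<Sum>v=1..<length ?cs. mul T (bar (p 1 v) (a 1 v)) (a (Suc v) (length ?cs)))"
  ultimately have mem: "hclass T v \<in> massey T ?cs" unfolding massey_def Let_def by blast
  have "{1..<3} = {1, 2 :: nat}" by auto
  then have v: "v = mul T (e {m_a}) a23 + mul T a12 (e {m_c})"
    by (simp add: v_def a_def p_def bar_def)
  \<comment> \<open>\<open>m_b\<close> and \<open>m_bc\<close> share a colour, so the cocycle sees
    only the other summand, whose four generators have different colours.\<close>
  have "\<not> colourful ({m_a} \<union> {m_b, m_c, m_bc})"
  proof
    assume "colourful ({m_a} \<union> {m_b, m_c, m_bc})"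
    then have "inj_on colour ({m_a} \<union> {m_b, m_c, m_bc})" by (simp add: colourful_def bij_betw_def)
    from inj_onD[OF this, of m_b m_bc] show False using ne by (simp add: colour_gens)
  qed
  moreover have "colourful ({m_a, m_b, m_ab} \<union> {m_c})"
    by (auto simp: colourful_def bij_betw_def inj_on_def colour_gens)
  moreover have "{m_a} \<union> {m_b, m_c, m_bc} \<subseteq> gens" "{m_a, m_b, m_ab} \<union> {m_c} \<subseteq> gens"
    by (auto simp: gens_def)
  ultimately have nz: "colour_form r v \<noteq> 0"
    by (simp only: v n5 n6 colour_form_add colour_form_single if_True if_False) simp
  have "v \<noteq> diff T b" if "b \<in> elems T" for b
    using nz colour_form_diff[OF r, of b] that by (auto simp: T_def)
  then have "v \<notin> hclass T 0" unfolding hclass_def add_0 by blast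
  moreover have "v \<in> hclass T v"
  proof -
    have "diff T 0 = 0" "0 \<in> elems T" by (simp_all add: T_def taylor_def ext_dga_def)
    then show ?thesis unfolding hclass_def by (metis (mono_tags, lifting) add.right_neutral mem_Collect_eq)
  qed
  ultimately have "hclass T v \<noteq> hclass T 0" by metis
  with mem show ?thesis by blast
qed

section \<open>Comparison of free resolutions\<close>

locale ring_to_field =
  fixes \<rho> :: "'r::comm_ring_1 \<Rightarrow> 'k::field"
  assumes rho_add: "\<rho> (x + y) = \<rho> x + \<rho> y"
    and rho_mult: "\<rho> (x * y) = \<rho> x * \<rho> y"
    and rho_one: "\<rho> 1 = 1"
begin

lemma rho_zero: "\<rho> 0 = 0"
  by (metis add_0 add_cancel_right_right rho_add)

lemma augmentation_superset:
  assumes "finite K" "Poly_Mapping.keys u \<subseteq> K"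
  shows "augmentation \<rho> \<eta> u = (\<Sum>b\<in>K. \<rho> (Poly_Mapping.lookup u b) * \<eta> b)"
  unfolding augmentation_def
  by (rule sum.mono_neutral_left) (use assms rho_zero in \<open>auto simp: in_keys_iff\<close>)

lemma augmentation_add: "augmentation \<rho> \<eta> (u + w) = augmentation \<rho> \<eta> u + augmentation \<rho> \<eta> w"
proof -
  let ?K = "Poly_Mapping.keys u \<union> Poly_Mapping.keys w"
  have "Poly_Mapping.keys (u + w) \<subseteq> ?K" by (rule keys_add)
  then show ?thesis
    by (simp add: augmentation_superset[of ?K] lookup_add rho_add distrib_right sum.distrib)
qed

lemma augmentation_smul: "augmentation \<rho> \<eta> (smul c u) = \<rho> c * augmentation \<rho> \<eta> u"
  using keys_smul[of c u]
  by (simp add: augmentation_superset[of "Poly_Mapping.keys u"] rho_mult sum_distrib_left mult.assoc)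

lemma augmentation_zero [simp]: "augmentation \<rho> \<eta> 0 = 0"
  by (simp add: augmentation_def)

lemma augmentation_diff: "augmentation \<rho> \<eta> (u - w) = augmentation \<rho> \<eta> u - augmentation \<rho> \<eta> w"
  using augmentation_add[of \<eta> "u - w" w] by simp

lemma augmentation_single: "augmentation \<rho> \<eta> (Poly_Mapping.single b c) = \<rho> c * \<eta> b"
  by (simp add: augmentation_superset[of "{b}"])

lemma augmentation_sum: "augmentation \<rho> \<eta> (\<Sum>a\<in>A. f a) = (\<Sum>a\<in>A. augmentation \<rho> \<eta> (f a))"
  by (induction A rule: infinite_finite_induct) (simp_all add: augmentation_add)

lemma augmentation_lin_ext:
  assumes "u \<in> free_mod B" "\<And>b. b \<in> B \<Longrightarrow> augmentation \<rho> \<theta> (f b) = \<eta> b"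
  shows "augmentation \<rho> \<theta> (lin_ext f u) = augmentation \<rho> \<eta> u"
proof -
  have "Poly_Mapping.keys u \<subseteq> B" using assms(1) by (simp add: free_mod_def)
  then show ?thesis
    using assms(2) unfolding lin_ext_def augmentation_def[of \<rho> \<eta>] augmentation_sum augmentation_smul
    by (intro sum.cong refl) auto
qed

text \<open>Truncated, because the complex built on words below is controlled in low degrees
  only.\<close>

definition complex_upto :: "nat \<Rightarrow> (nat \<Rightarrow> 'b set) \<Rightarrow> (nat \<Rightarrow> 'b \<Rightarrow> ('b \<Rightarrow>\<^sub>0 'r)) \<Rightarrow> ('b \<Rightarrow> 'k) \<Rightarrow> bool" where
  "complex_upto n B D \<eta> \<longleftrightarrow>
     (\<forall>j<n. \<forall>b\<in>B (Suc j). D j b \<in> free_mod (B j)) \<and>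
     (0 < n \<longrightarrow> (\<forall>b\<in>B (Suc 0). augmentation \<rho> \<eta> (D 0 b) = 0)) \<and>
     (\<forall>j. Suc j < n \<longrightarrow> (\<forall>b\<in>B (Suc (Suc j)). lin_ext (D j) (D (Suc j) b) = 0))"

text \<open>Exactness at the terms of index less than \<open>n\<close>; nothing is asserted at index
  \<open>n\<close> itself.\<close>

definition exact_upto :: "nat \<Rightarrow> (nat \<Rightarrow> 'b set) \<Rightarrow> (nat \<Rightarrow> 'b \<Rightarrow> ('b \<Rightarrow>\<^sub>0 'r)) \<Rightarrow> ('b \<Rightarrow> 'k) \<Rightarrow> bool" where
  "exact_upto n B D \<eta> \<longleftrightarrow>
     (\<forall>c. \<exists>y\<in>free_mod (B 0). augmentation \<rho> \<eta> y = c) \<and>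
     (0 < n \<longrightarrow> (\<forall>u\<in>free_mod (B 0). augmentation \<rho> \<eta> u = 0 \<longrightarrow> (\<exists>y\<in>free_mod (B (Suc 0)). lin_ext (D 0) y = u))) \<and>
     (\<forall>j. Suc j < n \<longrightarrow> (\<forall>u\<in>free_mod (B (Suc j)). lin_ext (D j) u = 0 \<longrightarrow>
        (\<exists>y\<in>free_mod (B (Suc (Suc j))). lin_ext (D (Suc j)) y = u)))"

lemma exact_upto_step:
  assumes "exact_upto (Suc n) B D \<eta>" "u \<in> free_mod (B n)"
    and "n = 0 \<Longrightarrow> augmentation \<rho> \<eta> u = 0" and "\<And>m. n = Suc m \<Longrightarrow> lin_ext (D m) u = 0"
  shows "\<exists>y. y \<in> free_mod (B (Suc n)) \<and> lin_ext (D n) y = u"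
proof (cases n)
  case 0
  then show ?thesis using assms by (auto simp: exact_upto_def)
next
  case (Suc j)
  have "\<forall>j. Suc j < Suc n \<longrightarrow> (\<forall>u\<in>free_mod (B (Suc j)). lin_ext (D j) u = 0 \<longrightarrow>
        (\<exists>y\<in>free_mod (B (Suc (Suc j))). lin_ext (D (Suc j)) y = u))"
    using assms(1) unfolding exact_upto_def by (elim conjE)
  from this[rule_format, of j u] show ?thesis using assms(2,4) Suc by auto
qed

lemma exact_upto_mono: "exact_upto n B D \<eta> \<Longrightarrow> m \<le> n \<Longrightarrow> exact_upto m B D \<eta>"
  by (auto simp: exact_upto_def)

lemma complex_upto_mono: "complex_upto n B D \<eta> \<Longrightarrow> m \<le> n \<Longrightarrow> complex_upto m B D \<eta>"
  by (auto simp: complex_upto_def)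

lemma free_resolution_complex: "free_resolution \<rho> B D \<eta> \<Longrightarrow> complex_upto n B D \<eta>"
  and free_resolution_exact: "free_resolution \<rho> B D \<eta> \<Longrightarrow> exact_upto n B D \<eta>"
proof -
  assume F: "free_resolution \<rho> B D \<eta>"
  have D: "D j b \<in> free_mod (B j)" if "b \<in> B (Suc j)" for j b
    using F that by (auto simp: free_resolution_def)
  have aug: "{u \<in> free_mod (B 0). augmentation \<rho> \<eta> u = 0} = lin_ext (D 0) ` free_mod (B (Suc 0))"
    using F by (simp add: free_resolution_def One_nat_def)
  have ker: "{u \<in> free_mod (B (Suc j)). lin_ext (D j) u = 0} = lin_ext (D (Suc j)) ` free_mod (B (Suc (Suc j)))" for j
    using F by (simp add: free_resolution_def)
  have surj: "augmentation \<rho> \<eta> ` free_mod (B 0) = UNIV"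
    using F by (simp add: free_resolution_def)
  have im: "D j b \<in> lin_ext (D j) ` free_mod (B (Suc j))" if "b \<in> B (Suc j)" for j b
    using free_mod_single[OF that, of 1] by (intro image_eqI[of _ _ "Poly_Mapping.single b 1"]) auto
  show "complex_upto n B D \<eta>"
    unfolding complex_upto_def using D im aug ker by blast
  show "exact_upto n B D \<eta>"
    unfolding exact_upto_def
  proof (intro conjI allI impI ballI)
    show "\<exists>y\<in>free_mod (B 0). augmentation \<rho> \<eta> y = c" for c
    proof -
      have "c \<in> augmentation \<rho> \<eta> ` free_mod (B 0)" by (simp add: surj)
      then show ?thesis by blast
    qed
    show "\<exists>y\<in>free_mod (B (Suc 0)). lin_ext (D 0) y = u"
      if "u \<in> free_mod (B 0)" "augmentation \<rho> \<eta> u = 0" for u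
    proof -
      have "u \<in> lin_ext (D 0) ` free_mod (B (Suc 0))" using that aug by blast
      then show ?thesis by blast
    qed
    show "\<exists>y\<in>free_mod (B (Suc (Suc j))). lin_ext (D (Suc j)) y = u"
      if "u \<in> free_mod (B (Suc j))" "lin_ext (D j) u = 0" for u j
    proof -
      have "u \<in> lin_ext (D (Suc j)) ` free_mod (B (Suc (Suc j)))" using that ker by blast
      then show ?thesis by blast
    qed
  qed
qed

text \<open>The usual lifting: values on basis vectors are chosen degree by degree, using freeness
  of the source and exactness of the target.\<close>

lemma chain_map_exists:
  fixes D :: "nat \<Rightarrow> 'b \<Rightarrow> ('b \<Rightarrow>\<^sub>0 'r)" and E :: "nat \<Rightarrow> 'c \<Rightarrow> ('c \<Rightarrow>\<^sub>0 'r)"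
  assumes "complex_upto n B D \<eta>" "exact_upto n A E \<theta>"
  shows "\<exists>f. (\<forall>j\<le>n. \<forall>b\<in>B j. f j b \<in> free_mod (A j)) \<and>
    (\<forall>b\<in>B 0. augmentation \<rho> \<theta> (f 0 b) = \<eta> b) \<and>
    (\<forall>j<n. \<forall>b\<in>B (Suc j). lin_ext (E j) (f (Suc j) b) = lin_ext (f j) (D j b))"
  using assms
proof (induction n)
  case 0
  then have "\<exists>y. y \<in> free_mod (A 0) \<and> augmentation \<rho> \<theta> y = \<eta> b" for b
    by (auto simp: exact_upto_def)
  then obtain f0 where "\<And>b. f0 b \<in> free_mod (A 0) \<and> augmentation \<rho> \<theta> (f0 b) = \<eta> b" by metis
  then show ?case by (intro exI[of _ "\<lambda>_. f0"]) simp
next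
  case (Suc n)
  have "complex_upto n B D \<eta>" "exact_upto n A E \<theta>"
    using Suc.prems complex_upto_mono exact_upto_mono by (meson le_Suc_eq order_refl)+
  from Suc.IH[OF this] obtain f where f: "\<And>j b. j \<le> n \<Longrightarrow> b \<in> B j \<Longrightarrow> f j b \<in> free_mod (A j)"
    "\<And>b. b \<in> B 0 \<Longrightarrow> augmentation \<rho> \<theta> (f 0 b) = \<eta> b"
    "\<And>j b. j < n \<Longrightarrow> b \<in> B (Suc j) \<Longrightarrow> lin_ext (E j) (f (Suc j) b) = lin_ext (f j) (D j b)" by metis
  have "\<exists>y. y \<in> free_mod (A (Suc n)) \<and> lin_ext (E n) y = lin_ext (f n) (D n b)" if b: "b \<in> B (Suc n)" for b
  proof (rule exact_upto_step[OF Suc.prems(2)])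
    have Db: "D n b \<in> free_mod (B n)" using Suc.prems(1) b by (simp add: complex_upto_def)
    then show "lin_ext (f n) (D n b) \<in> free_mod (A n)"
      by (rule lin_ext_free_mod) (simp add: f(1))
    show "augmentation \<rho> \<theta> (lin_ext (f n) (D n b)) = 0" if n: "n = 0"
    proof -
      have "augmentation \<rho> \<theta> (lin_ext (f 0) (D 0 b)) = augmentation \<rho> \<eta> (D 0 b)"
        using Db f(2) n by (intro augmentation_lin_ext[of _ "B 0"]) auto
      then show ?thesis using Suc.prems(1) b n by (simp add: complex_upto_def)
    qed
    show "lin_ext (E m) (lin_ext (f n) (D n b)) = 0" if n: "n = Suc m" for m
    proof -
      have "lin_ext (E m) (lin_ext (f n) (D n b)) = lin_ext (\<lambda>b. lin_ext (E m) (f n b)) (D n b)"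
        by (rule lin_ext_lin_ext)
      also have "\<dots> = lin_ext (\<lambda>b. lin_ext (f m) (D m b)) (D n b)"
        using Db by (rule lin_ext_cong_free_mod) (simp add: f(3) n)
      also have "\<dots> = lin_ext (f m) (lin_ext (D m) (D n b))" by (rule lin_ext_lin_ext[symmetric])
      also have "lin_ext (D m) (D n b) = 0"
        using Suc.prems(1) b n by (simp add: complex_upto_def)
      finally show ?thesis by simp
    qed
  qed
  then obtain f' where f': "\<And>b. b \<in> B (Suc n) \<Longrightarrow> f' b \<in> free_mod (A (Suc n)) \<and> lin_ext (E n) (f' b) = lin_ext (f n) (D n b)"
    by metis
  show ?case
    by (rule exI[of _ "f(Suc n := f')"]) (use f f' in \<open>auto simp: le_Suc_eq less_Suc_eq\<close>)
qed

text \<open>In each degree \<open>\<phi> - s d\<close> is a cycle and can be lifted. The lift lies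
  one degree higher, which is why exactness up to \<open>Suc n\<close> enters.\<close>

lemma null_homotopy_exists:
  fixes D :: "nat \<Rightarrow> 'b \<Rightarrow> ('b \<Rightarrow>\<^sub>0 'r)"
  assumes "complex_upto n B D \<eta>" "exact_upto (Suc n) B D \<eta>"
    and "\<And>j b. j \<le> n \<Longrightarrow> b \<in> B j \<Longrightarrow> \<phi> j b \<in> free_mod (B j)"
    and "\<And>b. b \<in> B 0 \<Longrightarrow> augmentation \<rho> \<eta> (\<phi> 0 b) = 0"
    and "\<And>j b. j < n \<Longrightarrow> b \<in> B (Suc j) \<Longrightarrow> lin_ext (D j) (\<phi> (Suc j) b) = lin_ext (\<phi> j) (D j b)"
  shows "\<exists>s. (\<forall>j\<le>n. \<forall>b\<in>B j. s j b \<in> free_mod (B (Suc j))) \<and>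
    (\<forall>b\<in>B 0. \<phi> 0 b = lin_ext (D 0) (s 0 b)) \<and>
    (\<forall>j<n. \<forall>b\<in>B (Suc j). \<phi> (Suc j) b = lin_ext (D (Suc j)) (s (Suc j) b) + lin_ext (s j) (D j b))"
  using assms
proof (induction n)
  case 0
  have "\<exists>y. y \<in> free_mod (B (Suc 0)) \<and> lin_ext (D 0) y = \<phi> 0 b" if "b \<in> B 0" for b
    using that by (intro exact_upto_step[OF 0(2)] 0(3,4)) auto
  then obtain s0 where "\<And>b. b \<in> B 0 \<Longrightarrow> s0 b \<in> free_mod (B (Suc 0)) \<and> lin_ext (D 0) (s0 b) = \<phi> 0 b" by metis
  then show ?case by (intro exI[of _ "\<lambda>_. s0"]) simp
next
  case (Suc n)
  have "complex_upto n B D \<eta>" "exact_upto (Suc n) B D \<eta>"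
    using Suc.prems(1,2) complex_upto_mono exact_upto_mono by (meson le_Suc_eq order_refl)+
  then have "\<exists>s. (\<forall>j\<le>n. \<forall>b\<in>B j. s j b \<in> free_mod (B (Suc j))) \<and>
    (\<forall>b\<in>B 0. \<phi> 0 b = lin_ext (D 0) (s 0 b)) \<and>
    (\<forall>j<n. \<forall>b\<in>B (Suc j). \<phi> (Suc j) b = lin_ext (D (Suc j)) (s (Suc j) b) + lin_ext (s j) (D j b))"
    using Suc.prems(3,4,5) by (intro Suc.IH) auto
  then obtain s where s: "\<And>j b. j \<le> n \<Longrightarrow> b \<in> B j \<Longrightarrow> s j b \<in> free_mod (B (Suc j))"
    "\<And>b. b \<in> B 0 \<Longrightarrow> \<phi> 0 b = lin_ext (D 0) (s 0 b)"
    "\<And>j b. j < n \<Longrightarrow> b \<in> B (Suc j) \<Longrightarrow> \<phi> (Suc j) b = lin_ext (D (Suc j)) (s (Suc j) b) + lin_ext (s j) (D j b)"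
    by metis
  have "\<exists>y. y \<in> free_mod (B (Suc (Suc n))) \<and> lin_ext (D (Suc n)) y = \<phi> (Suc n) b - lin_ext (s n) (D n b)"
    if b: "b \<in> B (Suc n)" for b
  proof (rule exact_upto_step[OF Suc.prems(2)])
    have Db: "D n b \<in> free_mod (B n)" using Suc.prems(1) b by (simp add: complex_upto_def)
    have "lin_ext (s n) (D n b) \<in> free_mod (B (Suc n))"
      using Db by (rule lin_ext_free_mod) (simp add: s(1))
    then show "\<phi> (Suc n) b - lin_ext (s n) (D n b) \<in> free_mod (B (Suc n))"
      using Suc.prems(3)[of "Suc n" b] b by (simp add: free_mod_diff)
    \<comment> \<open>That is, \<open>d s d = \<phi> d\<close>: the homotopy equation one degree
      lower, composed with \<open>d\<close>, loses its term containing \<open>d d\<close>.\<close>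
    have "lin_ext (\<lambda>b. lin_ext (D n) (s n b)) (D n b) = lin_ext (\<phi> n) (D n b)"
    proof (cases n)
      case 0
      then show ?thesis using Db s(2) by (intro lin_ext_cong_free_mod[of _ "B n"]) auto
    next
      case (Suc m)
      have "lin_ext (\<phi> n) (D n b) = lin_ext (\<lambda>b. lin_ext (D n) (s n b) + lin_ext (s m) (D m b)) (D n b)"
        using Db s(3) Suc by (intro lin_ext_cong_free_mod[of _ "B n"]) auto
      also have "\<dots> = lin_ext (\<lambda>b. lin_ext (D n) (s n b)) (D n b) + lin_ext (s m) (lin_ext (D m) (D n b))"
        by (simp add: lin_ext_fun_add lin_ext_lin_ext)
      also have "lin_ext (D m) (D n b) = 0"
        using Suc.prems(1) b Suc by (simp add: complex_upto_def)
      finally show ?thesis by simp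
    qed
    then have "lin_ext (D n) (\<phi> (Suc n) b - lin_ext (s n) (D n b)) = 0"
      using Suc.prems(5)[of n b] b by (simp add: lin_ext_diff lin_ext_lin_ext)
    then show "lin_ext (D m) (\<phi> (Suc n) b - lin_ext (s n) (D n b)) = 0" if "Suc n = Suc m" for m
      using that by simp
  qed simp
  then obtain s' where s': "\<And>b. b \<in> B (Suc n) \<Longrightarrow> s' b \<in> free_mod (B (Suc (Suc n))) \<and>
      lin_ext (D (Suc n)) (s' b) = \<phi> (Suc n) b - lin_ext (s n) (D n b)"
    by metis
  show ?case
    by (rule exI[of _ "s(Suc n := s')"]) (use s s' in \<open>auto simp: le_Suc_eq less_Suc_eq\<close>)
qed

section \<open>A bound for Tor from a partial resolution\<close>

abbreviation base_change :: "('b \<Rightarrow> ('e \<Rightarrow>\<^sub>0 'r)) \<Rightarrow> ('b \<Rightarrow>\<^sub>0 'k) \<Rightarrow> ('e \<Rightarrow>\<^sub>0 'k)" where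
  "base_change f \<equiv> lin_ext (\<lambda>b. Poly_Mapping.map \<rho> (f b))"

lemma map_free_mod: "u \<in> free_mod B \<Longrightarrow> Poly_Mapping.map \<rho> u \<in> free_mod B"
  by (auto simp: free_mod_iff rho_zero) (metis rho_zero)

lemma map_add: "Poly_Mapping.map \<rho> (u + w) = Poly_Mapping.map \<rho> u + Poly_Mapping.map \<rho> w"
  by (rule poly_mapping_eqI) (simp add: lookup_add rho_zero rho_add)

lemma base_change_compose: "base_change g (base_change f z) = base_change (\<lambda>b. lin_ext g (f b)) z"
  by (simp add: lin_ext_lin_ext map_lin_ext[OF rho_add rho_mult])

lemma base_change_zero: "(\<And>b. b \<in> B \<Longrightarrow> f b = 0) \<Longrightarrow> z \<in> free_mod B \<Longrightarrow> base_change f z = 0"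
  using lin_ext_cong_free_mod[of z B "\<lambda>b. Poly_Mapping.map \<rho> (f b)" "\<lambda>b. 0"]
  by (simp add: poly_mapping_eq_iff fun_eq_iff rho_zero)

text \<open>Comparison maps \<open>f\<close> to the partial resolution and \<open>g\<close> back
  satisfy \<open>g f - 1 = d s + s d\<close>. After tensoring, a cycle killed by \<open>f\<close> is
  a boundary, so \<open>f\<close> embeds the homology in this degree into the vector space on
  \<open>A (Suc m)\<close>.\<close>

lemma quot_dim_tensor_le:
  fixes D :: "nat \<Rightarrow> 'b \<Rightarrow> ('b \<Rightarrow>\<^sub>0 'r)" and E :: "nat \<Rightarrow> 'c \<Rightarrow> ('c \<Rightarrow>\<^sub>0 'r)"
  assumes F: "free_resolution \<rho> B D \<eta>"
    and G: "complex_upto (Suc m) A E \<theta>" "exact_upto (Suc m) A E \<theta>" "finite (A (Suc m))"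
  shows "quot_dim smul {u \<in> free_mod (B (Suc m)). tensor_diff \<rho> D (Suc m) u = 0}
    (tensor_diff \<rho> D (Suc (Suc m)) ` free_mod (B (Suc (Suc m)))) \<le> card (A (Suc m))"
proof -
  let ?n = "Suc m"
  note FC = free_resolution_complex[OF F] and FE = free_resolution_exact[OF F]
  obtain f where f: "\<And>j b. j \<le> ?n \<Longrightarrow> b \<in> B j \<Longrightarrow> f j b \<in> free_mod (A j)"
    "\<And>b. b \<in> B 0 \<Longrightarrow> augmentation \<rho> \<theta> (f 0 b) = \<eta> b"
    "\<And>j b. j < ?n \<Longrightarrow> b \<in> B (Suc j) \<Longrightarrow> lin_ext (E j) (f (Suc j) b) = lin_ext (f j) (D j b)"
    using chain_map_exists[OF FC G(2)] by metis
  obtain g where g: "\<And>j b. j \<le> ?n \<Longrightarrow> b \<in> A j \<Longrightarrow> g j b \<in> free_mod (B j)"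
    "\<And>b. b \<in> A 0 \<Longrightarrow> augmentation \<rho> \<eta> (g 0 b) = \<theta> b"
    "\<And>j b. j < ?n \<Longrightarrow> b \<in> A (Suc j) \<Longrightarrow> lin_ext (D j) (g (Suc j) b) = lin_ext (g j) (E j b)"
    using chain_map_exists[OF G(1) FE] by metis
  define \<phi> where "\<phi> = (\<lambda>j b. lin_ext (g j) (f j b) - Poly_Mapping.single b 1)"
  have DB: "D j b \<in> free_mod (B j)" if "b \<in> B (Suc j)" for j b
    using F that by (simp add: free_resolution_def)
  have "\<exists>s. (\<forall>j\<le>?n. \<forall>b\<in>B j. s j b \<in> free_mod (B (Suc j))) \<and>
    (\<forall>b\<in>B 0. \<phi> 0 b = lin_ext (D 0) (s 0 b)) \<and>
    (\<forall>j<?n. \<forall>b\<in>B (Suc j). \<phi> (Suc j) b = lin_ext (D (Suc j)) (s (Suc j) b) + lin_ext (s j) (D j b))"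
  proof (rule null_homotopy_exists[OF FC FE])
    show "\<phi> j b \<in> free_mod (B j)" if "j \<le> ?n" "b \<in> B j" for j b
      unfolding \<phi>_def
      by (intro free_mod_diff free_mod_single that lin_ext_free_mod[OF f(1)]) (use that g(1) in auto)
    show "augmentation \<rho> \<eta> (\<phi> 0 b) = 0" if "b \<in> B 0" for b
      using that augmentation_lin_ext[of "f 0 b" "A 0" \<eta> "g 0" \<theta>] f(1,2) g(2)
      by (simp add: \<phi>_def augmentation_diff augmentation_single rho_one)
    show "lin_ext (D j) (\<phi> (Suc j) b) = lin_ext (\<phi> j) (D j b)" if j: "j < ?n" "b \<in> B (Suc j)" for j b
    proof -
      have "lin_ext (D j) (lin_ext (g (Suc j)) (f (Suc j) b)) = lin_ext (\<lambda>a. lin_ext (g j) (E j a)) (f (Suc j) b)"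
        using f(1)[of "Suc j" b] j g(3) by (subst lin_ext_lin_ext, intro lin_ext_cong_free_mod[of _ "A (Suc j)"]) auto
      also have "\<dots> = lin_ext (g j) (lin_ext (f j) (D j b))"
        using f(3) j by (simp add: lin_ext_lin_ext[symmetric])
      also have "\<dots> = lin_ext (\<phi> j) (D j b) + D j b"
        using lin_ext_fun_add[of "\<phi> j" "\<lambda>b. Poly_Mapping.single b 1" "D j b"]
        by (simp add: lin_ext_lin_ext lin_ext_ident \<phi>_def)
      finally show ?thesis by (simp add: \<phi>_def[of] lin_ext_diff)
    qed
  qed
  then obtain s where s: "\<And>j b. j \<le> ?n \<Longrightarrow> b \<in> B j \<Longrightarrow> s j b \<in> free_mod (B (Suc j))"
    "\<And>b. b \<in> B ?n \<Longrightarrow> \<phi> ?n b = lin_ext (D ?n) (s ?n b) + lin_ext (s m) (D m b)"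
    by (metis lessI)
  let ?V = "{u \<in> free_mod (B ?n). tensor_diff \<rho> D ?n u = 0}"
  let ?W = "tensor_diff \<rho> D (Suc ?n) ` free_mod (B (Suc ?n))"
  interpret V: vector_space "smul :: 'k \<Rightarrow> ('b \<Rightarrow>\<^sub>0 'k) \<Rightarrow> _" by (rule vector_space_smul)
  have lin: "Vector_Spaces.linear (smul :: 'k \<Rightarrow> ('x \<Rightarrow>\<^sub>0 'k) \<Rightarrow> _) (smul :: 'k \<Rightarrow> ('y \<Rightarrow>\<^sub>0 'k) \<Rightarrow> _) (lin_ext h)" for h
    by (intro_locales; (intro vector_space_smul module_smul)?)
      (auto intro!: module_hom_axioms.intro simp: lin_ext_add lin_ext_smul vector_space_smul)
  have Bsub: "V.subspace ?W"
    unfolding tensor_diff_def nat.case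
    by (rule module_hom.subspace_image[OF lin[unfolded linear_iff_module_hom] free_mod_subspace])
  have Vsub: "V.subspace ?V"
    unfolding tensor_diff_def nat.case
    by (rule V.subspaceI) (auto simp: lin_ext_add lin_ext_smul free_mod_add free_mod_smul)
  have DD: "lin_ext (D m) (D ?n b) = 0" if "b \<in> B (Suc ?n)" for b
    using FC[of "Suc ?n"] that by (simp add: complex_upto_def)
  have sub: "?W \<subseteq> ?V"
  proof (clarify, intro conjI)
    fix y :: "'b \<Rightarrow>\<^sub>0 'k" assume y: "y \<in> free_mod (B (Suc ?n))"
    then show "tensor_diff \<rho> D (Suc ?n) y \<in> free_mod (B ?n)"
      unfolding tensor_diff_def nat.case by (rule lin_ext_free_mod) (intro map_free_mod DB)
    show "tensor_diff \<rho> D ?n (tensor_diff \<rho> D (Suc ?n) y) = 0"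
      unfolding tensor_diff_def nat.case base_change_compose using DD y by (rule base_change_zero)
  qed
  show ?thesis
  proof (rule order_trans[OF V.quot_dim_le[OF Bsub sub Vsub vector_space_smul lin, of "\<lambda>b. Poly_Mapping.map \<rho> (f ?n b)"
        "(\<lambda>a. Poly_Mapping.single a 1) ` A ?n"]])
    fix z assume z: "z \<in> ?V" "base_change (f ?n) z = 0"
    then have zB: "z \<in> free_mod (B ?n)" and dz: "base_change (D m) z = 0"
      by (auto simp: tensor_diff_def)
    have "base_change (\<lambda>b. lin_ext (g ?n) (f ?n b)) z =
        base_change (\<lambda>b. Poly_Mapping.single b 1 + (lin_ext (D ?n) (s ?n b) + lin_ext (s m) (D m b))) z"
      using zB
    proof (rule lin_ext_cong_free_mod)
      fix b assume "b \<in> B ?n"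
      then show "Poly_Mapping.map \<rho> (lin_ext (g ?n) (f ?n b)) =
          Poly_Mapping.map \<rho> (Poly_Mapping.single b 1 + (lin_ext (D ?n) (s ?n b) + lin_ext (s m) (D m b)))"
        using s(2)[of b] by (simp add: \<phi>_def algebra_simps)
    qed
    also have "\<dots> = z + (base_change (D ?n) (base_change (s ?n) z) + base_change (s m) (base_change (D m) z))"
      by (simp only: map_add lin_ext_fun_add base_change_compose)
        (simp add: rho_zero rho_one lin_ext_ident)
    \<comment> \<open>The left-hand side is 0 because \<open>f\<close> kills \<open>z\<close>, and
      the term \<open>s d\<close> is 0 because \<open>z\<close> is a cycle.\<close>
    finally have "z = - base_change (D ?n) (base_change (s ?n) z)"
      using z(2) dz by (simp add: base_change_compose[symmetric] eq_neg_iff_add_eq_0)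
    then have "z = tensor_diff \<rho> D (Suc ?n) (- base_change (s ?n) z)"
      by (simp add: tensor_diff_def lin_ext_uminus)
    moreover have "- base_change (s ?n) z \<in> free_mod (B (Suc ?n))"
      using zB by (intro free_mod_uminus) (rule lin_ext_free_mod, auto intro: map_free_mod s(1))
    ultimately show "z \<in> ?W" by (rule image_eqI)
  next
    have "base_change (f ?n) ` ?V \<subseteq> free_mod (A ?n)"
      using f(1) by (auto intro!: lin_ext_free_mod map_free_mod)
    then show "base_change (f ?n) ` ?V \<subseteq> module.span smul ((\<lambda>a. Poly_Mapping.single a 1) ` A ?n)"
      by (simp add: span_singles_eq_free_mod[OF G(3)])
  qed (use G(3) card_image_le in auto)
qed

end

section \<open>Existence of free resolutions of the residue field\<close>

text \<open>Makes the definite description explicit: the constant coefficient is independent of the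
  representative, since the monomial 1 is not in the ideal.\<close>

lemma residue_eq: "residue quot_map r = std_coeff r 0"
proof -
  have *: "std_coeff (quot_map p) 0 = const_coeff p" for p :: "(var, 'a) mpoly"
    by (simp add: std_coeff_quot_map in_a_def)
  obtain p where "r = quot_map p" using quot_map_surj by blast
  then have "\<exists>p. quot_map p = r \<and> const_coeff p = std_coeff r 0" by (auto simp: *)
  moreover have "c = std_coeff r 0" if "\<exists>p. quot_map p = r \<and> const_coeff p = c" for c
    using that by (auto simp: * simp flip: *)
  ultimately show ?thesis unfolding residue_def by (rule the_equality)
qed

lemma residue_quot_map: "residue quot_map (quot_map p) = const_coeff p"
  by (simp add: residue_eq std_coeff_quot_map in_a_def)

interpretation residue: ring_to_field "residue (quot_map :: (var, 'k::field) mpoly \<Rightarrow> 'k quot_ring)"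
proof
  fix x y :: "'k quot_ring"
  obtain p where p: "x = quot_map p" using quot_map_surj by blast
  obtain p' where p': "y = quot_map p'" using quot_map_surj by blast
  show "residue quot_map (x * y) = residue quot_map x * residue quot_map y"
    by (simp add: p p' quot_map_mult[symmetric] residue_quot_map const_coeff_times)
next
  show "residue (quot_map :: (var, 'k::field) mpoly \<Rightarrow> 'k quot_ring) 1 = 1"
    using residue_quot_map[of 1] by simp
qed (simp add: residue_eq std_coeff_add)

lemma residue_cq [simp]: "residue quot_map (cq c) = c"
  by (simp add: residue_quot_map)

lemma cq_add: "cq (c + d) = cq c + cq d"
  by (simp add: single_add quot_map_add)

lemma cq_mult: "cq (c * d) = cq c * cq d"
  by (simp add: mult_single flip: quot_map_mult)

lemma vector_space_kscale: "vector_space (\<lambda>c::'k::field. smul (cq c) :: ('b \<Rightarrow>\<^sub>0 'k quot_ring) \<Rightarrow> _)"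
  by standard (simp_all add: smul_add_left smul_add_right cq_add cq_mult)

text \<open>\<open>W\<close> is exhausted by its intersections with the spans of finitely many
  \<open>e i\<close>. These are finite-dimensional, so the union of their finite bases is countable,
  even if the field is not.\<close>

lemma (in vector_space) countable_generating_set:
  fixes e :: "nat \<Rightarrow> 'b"
  assumes e: "span (range e) = UNIV" and W: "subspace W"
  shows "\<exists>g :: nat \<Rightarrow> 'b. range g \<subseteq> W \<and> W \<subseteq> span (range g)"
proof -
  have "\<exists>B. B \<subseteq> W \<inter> span (e ` {..<n}) \<and> independent B \<and> W \<inter> span (e ` {..<n}) \<subseteq> span B" for n :: nat
    using maximal_independent_subset[of "W \<inter> span (e ` {..<n})"] by metis
  then obtain B where B: "\<And>n::nat. B n \<subseteq> W \<inter> span (e ` {..<n})" "\<And>n. independent (B n)"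
    "\<And>n. W \<inter> span (e ` {..<n}) \<subseteq> span (B n)" by metis
  have fin: "finite (B n)" for n
    using independent_span_bound[of "e ` {..<n}" "B n"] B(1,2)[of n] by auto
  define S where "S = insert 0 (\<Union>n. B n)"
  have "countable S" unfolding S_def using fin by (simp add: countable_finite)
  then have S: "range (from_nat_into S) = S" by (intro range_from_nat_into) (auto simp: S_def)
  have mono: "span (e ` {..<n}) \<subseteq> span (e ` {..<m})" if "n \<le> m" for n m :: nat
    using that by (intro span_mono image_mono) auto
  have "\<exists>n. x \<in> span (e ` {..<n})" for x
  proof -
    have "x \<in> span (range e)" using e by simp
    then show ?thesis
    proof (induction rule: span_induct_alt)
      case base
      show ?case by (simp add: span_zero)
    next
      case (step c x y)
      obtain i where i: "x = e i" using step by blast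
      obtain n where n: "y \<in> span (e ` {..<n})" using step by blast
      have "y \<in> span (e ` {..<max n (Suc i)})" using n mono[of n "max n (Suc i)"] by auto
      moreover have "x \<in> span (e ` {..<max n (Suc i)})" unfolding i by (intro span_base imageI) auto
      ultimately show ?case by (intro exI[of _ "max n (Suc i)"] span_add span_scale)
    qed
  qed
  then have "W \<subseteq> span S"
  proof (intro subsetI)
    fix x assume x: "x \<in> W" "\<And>x. \<exists>n. x \<in> span (e ` {..<n})"
    then obtain n where "x \<in> span (e ` {..<n})" by blast
    then have "x \<in> span (B n)" using x(1) B(3)[of n] by blast
    moreover have "B n \<subseteq> S" by (auto simp: S_def)
    ultimately show "x \<in> span S" using span_mono by blast
  qed
  moreover have "S \<subseteq> W" using B(1) subspace_0[OF W] by (auto simp: S_def)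
  ultimately show ?thesis using S by (intro exI[of _ "from_nat_into S"]) simp
qed

lemma countable_var_monomials: "countable (UNIV :: var monomial set)"
proof -
  let ?f = "\<lambda>(a, b, c, d, e). pow X1 a + pow X2 b + pow Y1 c + pow Y2 d + pow Z e"
  have "u \<in> range ?f" for u
  proof
    show "u = ?f (ex u X1, ex u X2, ex u Y1, ex u Y2, ex u Z)"
      by (simp add: mono_eq_iff all_var ex_single)
  qed simp
  then have "UNIV = range ?f" by blast
  then show ?thesis by (metis countable_image countableI_type)
qed

lemma free_module_countably_spanned:
  "\<exists>e :: nat \<Rightarrow> (nat \<Rightarrow>\<^sub>0 'k::field quot_ring). module.span (\<lambda>c. smul (cq c)) (range e) = UNIV"
proof -
  interpret vector_space "\<lambda>c::'k. smul (cq c) :: (nat \<Rightarrow>\<^sub>0 'k quot_ring) \<Rightarrow> _" by (rule vector_space_kscale)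
  let ?m = "\<lambda>(n, u). Poly_Mapping.single n (quot_map (mono_poly u) :: 'k quot_ring)"
  define S where "S = ?m ` (UNIV \<times> UNIV :: (nat \<times> var monomial) set)"
  have "countable S" unfolding S_def using countable_var_monomials by (intro countable_image countable_SIGMA) auto
  then have S: "range (from_nat_into S) = S" by (intro range_from_nat_into) (auto simp: S_def)
  have "Poly_Mapping.single n (quot_map p) \<in> span S" for n and p :: "(var, 'k) mpoly"
  proof (induction p rule: poly_mapping_linear_induct)
    case (single u c)
    have "Poly_Mapping.single u c = const_poly c * mono_poly u" by (simp add: mult_single)
    then have "Poly_Mapping.single n (quot_map (Poly_Mapping.single u c)) = smul (cq c) (?m (n, u))"
      by (simp add: quot_map_mult)
    moreover have "?m (n, u) \<in> S" unfolding S_def by blast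
    ultimately show ?case by (metis span_base span_scale)
  next
    case (add p p')
    then show ?case by (simp add: quot_map_add single_add span_add)
  qed
  then have single: "Poly_Mapping.single n r \<in> span S" for n r by (metis quot_map_surj)
  have "u \<in> span S" for u
    by (induction u rule: poly_mapping_linear_induct) (auto intro: single span_add)
  then show ?thesis using S by (intro exI[of _ "from_nat_into S"]) auto
qed

text \<open>Takes the place of Hilbert's basis theorem: \<open>R\<close> has countable dimension
  over the field, hence so has a free module of countable rank, and vectors spanning a submodule
  over the field also generate it over \<open>R\<close>.\<close>

lemma submodule_countably_generated:
  fixes W :: "(nat \<Rightarrow>\<^sub>0 'k::field quot_ring) set"
  assumes W: "0 \<in> W" "\<And>u w. u \<in> W \<Longrightarrow> w \<in> W \<Longrightarrow> u + w \<in> W" "\<And>c u. u \<in> W \<Longrightarrow> smul c u \<in> W"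
  shows "\<exists>g :: nat \<Rightarrow> _. range (lin_ext g) = W"
proof -
  interpret vector_space "\<lambda>c::'k. smul (cq c) :: (nat \<Rightarrow>\<^sub>0 'k quot_ring) \<Rightarrow> _" by (rule vector_space_kscale)
  obtain e :: "nat \<Rightarrow> (nat \<Rightarrow>\<^sub>0 'k quot_ring)" where "span (range e) = UNIV"
    using free_module_countably_spanned by blast
  moreover have "subspace W" by (rule subspaceI) (use W in auto)
  ultimately obtain g :: "nat \<Rightarrow> _" where g: "range g \<subseteq> W" "W \<subseteq> span (range g)"
    using countable_generating_set by blast
  have sumW: "(\<Sum>a\<in>A. f a) \<in> W" if "\<And>a. a \<in> A \<Longrightarrow> f a \<in> W" for f and A :: "nat set"
    using that by (induction A rule: infinite_finite_induct) (auto simp: W)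
  have "lin_ext g u \<in> W" for u
    unfolding lin_ext_def by (intro sumW W(3)) (use g in auto)
  moreover have "span (range g) \<subseteq> range (lin_ext g)"
  proof (rule span_minimal)
    show "range g \<subseteq> range (lin_ext g)"
      by (auto intro: image_eqI[of _ _ "Poly_Mapping.single n 1" for n])
    show "subspace (range (lin_ext g))"
    proof (rule subspaceI)
      show "0 \<in> range (lin_ext g)" by (rule image_eqI[of _ _ 0]) auto
      show "x + y \<in> range (lin_ext g)" if "x \<in> range (lin_ext g)" "y \<in> range (lin_ext g)" for x y
        using that by (auto simp flip: lin_ext_add)
      show "smul (cq c) x \<in> range (lin_ext g)" if "x \<in> range (lin_ext g)" for x c
        using that by (auto simp flip: lin_ext_smul)
    qed
  qed
  ultimately show ?thesis using g(2) by (intro exI[of _ g]) blast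
qed

lemma free_resolution_exists:
  "\<exists>(B :: nat \<Rightarrow> nat set) D \<eta>. free_resolution (residue (quot_map :: (var, 'k::field) mpoly \<Rightarrow> 'k quot_ring)) B D \<eta>"
proof -
  let ?\<rho> = "residue (quot_map :: (var, 'k) mpoly \<Rightarrow> 'k quot_ring)"
  define \<eta> :: "nat \<Rightarrow> 'k" where "\<eta> = (\<lambda>n. if n = 0 then 1 else 0)"
  have "\<exists>g :: nat \<Rightarrow> _. range (lin_ext g) = {u. augmentation ?\<rho> \<eta> u = 0}"
    by (rule submodule_countably_generated) (auto simp: residue.augmentation_add residue.augmentation_smul)
  then obtain g0 :: "nat \<Rightarrow> (nat \<Rightarrow>\<^sub>0 'k quot_ring)" where g0: "range (lin_ext g0) = {u. augmentation ?\<rho> \<eta> u = 0}" by blast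
  have syz_ex: "\<exists>g :: nat \<Rightarrow> _. range (lin_ext g) = {u. lin_ext f u = 0}" for f :: "nat \<Rightarrow> (nat \<Rightarrow>\<^sub>0 'k quot_ring)"
    by (rule submodule_countably_generated) (auto simp: lin_ext_add lin_ext_smul)
  define syz where "syz f = (SOME g :: nat \<Rightarrow> (nat \<Rightarrow>\<^sub>0 'k quot_ring). range (lin_ext g) = {u. lin_ext f u = 0})"
    for f :: "nat \<Rightarrow> (nat \<Rightarrow>\<^sub>0 'k quot_ring)"
  have syz: "range (lin_ext (syz f)) = {u. lin_ext f u = 0}" for f
    unfolding syz_def by (rule someI_ex[OF syz_ex])
  define D where "D = rec_nat g0 (\<lambda>_. syz)"
  have D: "D 0 = g0" "\<And>j. D (Suc j) = syz (D j)" by (simp_all add: D_def)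
  have "free_resolution ?\<rho> (\<lambda>_. UNIV) D \<eta>"
    unfolding free_resolution_def
  proof (intro conjI allI)
    have "c \<in> range (augmentation ?\<rho> \<eta>)" for c
      by (rule image_eqI[of _ _ "Poly_Mapping.single 0 (cq c)"]) (simp_all add: residue.augmentation_single \<eta>_def)
    then show "augmentation ?\<rho> \<eta> ` free_mod UNIV = UNIV" by auto
  qed (use g0 syz in \<open>simp_all add: D\<close>)
  then show ?thesis by blast
qed

lemma tor_dim_le:
  fixes A :: "nat \<Rightarrow> 'c set" and E :: "nat \<Rightarrow> 'c \<Rightarrow> ('c \<Rightarrow>\<^sub>0 'k::field quot_ring)"
  assumes "residue.complex_upto (Suc m) A E \<theta>" "residue.exact_upto (Suc m) A E \<theta>" "finite (A (Suc m))"
  shows "tor_dim (residue (quot_map :: (var, 'k) mpoly \<Rightarrow> 'k quot_ring)) (Suc m) \<le> card (A (Suc m))"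
proof -
  let ?\<rho> = "residue (quot_map :: (var, 'k) mpoly \<Rightarrow> 'k quot_ring)"
  let ?P = "\<lambda>(B :: nat \<Rightarrow> nat set, D, \<eta>). free_resolution ?\<rho> B D \<eta>"
  obtain B D \<eta> where e: "(SOME x. ?P x) = (B, D, \<eta>)" by (metis prod_cases3)
  have "\<exists>x. ?P x" using free_resolution_exists[where 'k = 'k] by auto
  then have "?P (SOME x. ?P x)" by (rule someI_ex)
  then have F: "free_resolution ?\<rho> B D \<eta>" by (simp add: e)
  show ?thesis
    using residue.quot_dim_tensor_le[OF F assms] unfolding tor_dim_def e by (simp add: Let_def)
qed

section \<open>Homology of the Koszul complex\<close>

definition mon :: "nat \<Rightarrow> nat \<Rightarrow> nat \<Rightarrow> nat \<Rightarrow> nat \<Rightarrow> var monomial" where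
  "mon a b c d e = pow X1 a + pow X2 b + pow Y1 c + pow Y2 d + pow Z e"

lemma ex_mon: "ex (mon a b c d e) i = (case i of X1 \<Rightarrow> a | X2 \<Rightarrow> b | Y1 \<Rightarrow> c | Y2 \<Rightarrow> d | Z \<Rightarrow> e)"
  by (cases i) (simp_all add: mon_def ex_single)

lemma mon_eq_iff [simp]: "mon a b c d e = mon a' b' c' d' e' \<longleftrightarrow> a = a' \<and> b = b' \<and> c = c' \<and> d = d' \<and> e = e'"
  by (simp add: mono_eq_iff all_var ex_mon)

lemma mon_add [simp]: "mon a b c d e + mon a' b' c' d' e' = mon (a + a') (b + b') (c + c') (d + d') (e + e')"
  by (simp add: mono_eq_iff all_var ex_mon)

lemma mon_add_ev [simp]:
  "mon a b c d e + ev X1 = mon (a + 1) b c d e" "mon a b c d e + ev X2 = mon a (b + 1) c d e"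
  "mon a b c d e + ev Y1 = mon a b (c + 1) d e" "mon a b c d e + ev Y2 = mon a b c (d + 1) e"
  "mon a b c d e + ev Z = mon a b c d (e + 1)"
  by (simp_all add: mono_eq_iff all_var ex_mon ex_single)

lemma mon_diff_ev [simp]:
  "mon a b c d e - ev X1 = mon (a - 1) b c d e" "mon a b c d e - ev X2 = mon a (b - 1) c d e"
  "mon a b c d e - ev Y1 = mon a b (c - 1) d e" "mon a b c d e - ev Y2 = mon a b c (d - 1) e"
  "mon a b c d e - ev Z = mon a b c d (e - 1)"
  by (simp_all add: mono_eq_iff all_var ex_mon ex_single)

lemma mon_surj: "u = mon (ex u X1) (ex u X2) (ex u Y1) (ex u Y2) (ex u Z)"
  by (simp add: mono_eq_iff all_var ex_mon)

definition cell :: "var set \<Rightarrow> var monomial \<Rightarrow> 'k::field kos" where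
  "cell I u = Poly_Mapping.single I (quot_map (mono_poly u))"

lemma coef_cell: "coef (cell I u) J v = (if I = J \<and> u = v \<and> \<not> in_a u then 1 else 0)"
  by (auto simp: coef_def cell_def lookup_single when_def std_coeff_quot_map)

lemma cell_in_a: "in_a u \<Longrightarrow> cell I u = 0"
  by (rule coef_eqI) (simp add: coef_cell)

lemma cell_kdeg: "card I = n \<Longrightarrow> cell I u \<in> kdeg n"
  by (simp add: cell_def kdeg_single)

lemma dK_cell: "dK (cell I u :: 'k::field kos) = (\<Sum>i\<in>I. smul (pos_sign i I) (cell (I - {i}) (u + ev i)))"
proof -
  have "smul (xq i) (partial i (cell I u :: 'k kos)) = (if i \<in> I then smul (pos_sign i I) (cell (I - {i}) (u + ev i)) else 0)" for i
    by (auto simp: cell_def partial_single mult_single quot_map_mult[symmetric] mult_ac add.commute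
        mult.assoc[symmetric] simp del: mult.assoc)
  then show ?thesis by (simp add: kdiff_def sum.If_cases)
qed

lemma kmul_cell: "kmul (cell I u) (cell J v) =
    (if I \<inter> J = {} then smul (shuffle_sign I J) (cell (I \<union> J) (u + v)) else 0)"
  by (simp add: cell_def kmul_single quot_map_mult[symmetric] mult_single mult.commute)

lemma coef_dK_mon:
  "coef (dK z) I u = (if in_a u then 0 else
     \<Sum>i\<in>{X1, X2, Y1, Y2, Z}. if i \<in> I \<or> ex u i = 0 then 0 else pos_sign i I * coef z (insert i I) (u - ev i))"
proof -
  have "(\<Sum>i\<in>- I. if ex u i = 0 then 0 else pos_sign i I * coef z (insert i I) (u - ev i)) =
    (\<Sum>i\<in>UNIV. if i \<in> I \<or> ex u i = 0 then 0 else pos_sign i I * coef z (insert i I) (u - ev i))"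
    by (rule sum.mono_neutral_cong_left) auto
  then show ?thesis by (simp only: coef_dK UNIV_var)
qed

abbreviation kscale :: "'k::field \<Rightarrow> 'k kos \<Rightarrow> 'k kos" where
  "kscale c \<equiv> smul (cq c)"

abbreviation kcycles :: "nat \<Rightarrow> 'k::field kos set" where
  "kcycles n \<equiv> {z \<in> kdeg n. dK z = 0}"

abbreviation kboundaries :: "nat \<Rightarrow> 'k::field kos set" where
  "kboundaries n \<equiv> dK ` kdeg (Suc n)"

lemma koszul_betti_eq:
  "koszul_betti (quot_map :: (var, 'k::field) mpoly \<Rightarrow> 'k quot_ring) n =
     quot_dim kscale (kcycles n :: 'k kos set) (kboundaries n)"
  by (simp add: koszul_betti_def cycles_def boundaries_def component_koszul diff_koszul)

interpretation kos: vector_space "kscale :: 'k::field \<Rightarrow> 'k kos \<Rightarrow> 'k kos"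
  by (rule vector_space_kscale)

lemma subspace_kcycles: "kos.subspace (kcycles n :: 'k::field kos set)"
  by (rule kos.subspaceI) (auto simp: kdiff_add kdiff_smul kdeg_add kdeg_smul)

lemma subspace_kboundaries: "kos.subspace (kboundaries n :: 'k::field kos set)"
proof (rule kos.subspaceI)
  show "0 \<in> kboundaries n" by (rule image_eqI[of _ _ 0]) auto
  show "x + y \<in> kboundaries n" if "x \<in> kboundaries n" "y \<in> kboundaries n" for x y :: "'k kos"
    using that by (auto intro: kdeg_add simp flip: kdiff_add)
  show "kscale c x \<in> kboundaries n" if "x \<in> kboundaries n" for x :: "'k kos" and c
    using that by (auto intro: kdeg_smul simp flip: kdiff_smul)
qed

lemma kboundaries_subset: "kboundaries n \<subseteq> kcycles n"
  by (auto intro: kdiff_mem_kdeg)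

lemma finite_bounded_monomials: "finite {u :: var monomial. \<forall>i. ex u i \<le> 3}"
proof -
  have "{u :: var monomial. \<forall>i. ex u i \<le> 3} \<subseteq>
      (\<lambda>(a, b, c, d, e). mon a b c d e) ` ({..3} \<times> {..3} \<times> {..3} \<times> {..3} \<times> {..3})"
  proof
    fix u :: "var monomial" assume "u \<in> {u. \<forall>i. ex u i \<le> 3}"
    then show "u \<in> (\<lambda>(a, b, c, d, e). mon a b c d e) ` ({..3} \<times> {..3} \<times> {..3} \<times> {..3} \<times> {..3})"
      using mon_surj[of u] by (intro image_eqI[of _ _ "(ex u X1, ex u X2, ex u Y1, ex u Y2, ex u Z)"]) auto
  qed
  then show ?thesis by (rule finite_subset) (intro finite_imageI finite_cartesian_product finite_atMost)
qed

text \<open>By \<open>bounded_representative\<close>, the finitely many cells with exponents at most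
  3 suffice. They are in general not cycles, but only a bound for the span is required.\<close>

lemma kcycles_finite_mod_boundaries:
  "\<exists>F. finite F \<and> (kcycles n :: 'k::field kos set) \<subseteq> kos.span (kboundaries n \<union> F)"
proof (intro exI conjI subsetI)
  let ?U = "{u :: var monomial. \<forall>i. ex u i \<le> 3}"
  let ?F = "(\<lambda>(I, u). cell I u :: 'k kos) ` (UNIV \<times> ?U)"
  show "finite ?F" using finite_bounded_monomials by auto
  fix z :: "'k kos" assume "z \<in> kcycles n"
  then have "dK z = 0" "z \<in> kdeg n" by auto
  then obtain b w where z: "z = dK b + w" "b \<in> kdeg (Suc n)" "supported (\<lambda>I u. \<forall>i. ex u i \<le> 3) w"
    by (rule bounded_representative)
  have "w = (\<Sum>(I, u)\<in>UNIV \<times> ?U. kscale (coef w I u) (cell I u))"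
  proof (rule coef_eqI)
    fix J v
    have "coef (\<Sum>(I, u)\<in>UNIV \<times> ?U. kscale (coef w I u) (cell I u)) J v =
        (\<Sum>x\<in>UNIV \<times> ?U. if x = (J, v) then coef w J v else 0)"
      unfolding coef_sum by (intro sum.cong refl) (auto simp: coef_cq coef_cell split: if_splits)
    also have "\<dots> = (if v \<in> ?U then coef w J v else 0)" using finite_bounded_monomials by simp
    also have "\<dots> = coef w J v" using z(3) by (auto simp: supported_def)
    finally show "coef w J v = coef (\<Sum>(I, u)\<in>UNIV \<times> ?U. kscale (coef w I u) (cell I u)) J v" ..
  qed
  also have "\<dots> \<in> kos.span (kboundaries n \<union> ?F)"
  proof (rule kos.span_sum)
    fix x assume x: "x \<in> (UNIV :: var set set) \<times> ?U"
    obtain I u where Iu: "x = (I, u)" by (cases x)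
    have "cell I u \<in> ?F" using x Iu by (intro image_eqI[of _ _ x]) auto
    then have "cell I u \<in> kos.span (kboundaries n \<union> ?F)" by (intro kos.span_base UnI2)
    then show "(case x of (I, u) \<Rightarrow> kscale (coef w I u) (cell I u)) \<in> kos.span (kboundaries n \<union> ?F)"
      by (simp only: Iu prod.case kos.span_scale)
  qed
  finally have "w \<in> kos.span (kboundaries n \<union> ?F)" .
  moreover have "dK b \<in> kos.span (kboundaries n \<union> ?F)" using z(2) by (intro kos.span_base) auto
  ultimately show "z \<in> kos.span (kboundaries n \<union> ?F)" using z(1) by (simp add: kos.span_add)
qed

lemma homology_basis_extend:
  assumes "C0 \<subseteq> (kcycles n :: 'k::field kos set)" "\<And>c. c \<in> C0 \<Longrightarrow> c \<notin> kos.span (kboundaries n \<union> (C0 - {c}))"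
  obtains C where "C0 \<subseteq> C" "basis_modulo kscale (kcycles n) (kboundaries n) C" "finite C"
    "card C = koszul_betti (quot_map :: (var, 'k) mpoly \<Rightarrow> 'k quot_ring) n"
proof -
  obtain C where C: "C0 \<subseteq> C" "basis_modulo kscale (kcycles n) (kboundaries n) C"
    using kos.basis_modulo_extend[OF subspace_kboundaries kboundaries_subset subspace_kcycles assms] by blast
  obtain F where F: "finite F" "(kcycles n :: 'k kos set) \<subseteq> kos.span (kboundaries n \<union> F)"
    using kcycles_finite_mod_boundaries by blast
  have fin: "finite C"
    by (rule kos.basis_modulo_finite[OF subspace_kboundaries subspace_kcycles C(2) F])
  then have "card C = koszul_betti (quot_map :: (var, 'k) mpoly \<Rightarrow> 'k quot_ring) n"
    unfolding koszul_betti_eq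
    by (simp add: kos.quot_dim_eq_card[OF subspace_kboundaries subspace_kcycles C(2)])
  with C fin show thesis by (intro that)
qed

lemma homology_basis_decompose:
  assumes C: "basis_modulo kscale (kcycles n) (kboundaries n) C" "finite C" and a: "a \<in> kcycles n"
  shows "\<exists>t\<in>kdeg (Suc n). \<exists>c. a = dK t + (\<Sum>v\<in>C. kscale (c v) v)"
proof -
  have "a \<in> kos.span (kboundaries n \<union> C)" using C(1) a by (simp add: basis_modulo_def)
  then obtain x y where xy: "a = x + y" "x \<in> kos.span (kboundaries n)" "y \<in> kos.span C"
    unfolding kos.span_Un by blast
  have "x \<in> kboundaries n"
    using xy(2) kos.span_eq_iff[THEN iffD2, OF subspace_kboundaries] by blast
  then obtain t where "x = dK t" "t \<in> kdeg (Suc n)" by auto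
  moreover obtain c where "y = (\<Sum>v\<in>C. kscale (c v) v)" using xy(3) kos.span_finite[OF C(2)] by auto
  ultimately show ?thesis using xy(1) by blast
qed

lemma homology_basis_independent:
  assumes C: "basis_modulo kscale (kcycles n) (kboundaries n) C" "finite C"
    and eq: "(\<Sum>v\<in>C. kscale (c v) v) = dK t" and v: "v \<in> C"
  shows "c v = 0"
proof (rule ccontr)
  assume nz: "c v \<noteq> 0"
  have CZ: "C \<subseteq> kcycles n" and ind: "v \<notin> kos.span (kboundaries n \<union> (C - {v}))"
    using C(1) v by (auto simp: basis_modulo_def)
  have "dK t \<in> kdeg n" unfolding eq[symmetric] using CZ by (intro kdeg_sum kdeg_smul) auto
  \<comment> \<open>\<open>t\<close> is an arbitrary chain, while \<open>kboundaries n\<close>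
    contains boundaries of chains of degree \<open>Suc n\<close>.\<close>
  then obtain t' where t': "t' \<in> kdeg (Suc n)" "dK t = dK t'"
    by (rule boundary_in_degree[OF _ is_boundary_dK]) 
  have "kscale (c v) v = dK t' - (\<Sum>w\<in>C - {v}. kscale (c w) w)"
    using eq t'(2) sum.remove[OF C(2) v, of "\<lambda>v. kscale (c v) v"] by (simp add: eq_diff_eq)
  also have "\<dots> \<in> kos.span (kboundaries n \<union> (C - {v}))"
    using t'(1) by (intro kos.span_diff kos.span_sum kos.span_scale kos.span_base) auto
  finally have "kscale (inverse (c v)) (kscale (c v) v) \<in> kos.span (kboundaries n \<union> (C - {v}))"
    by (rule kos.span_scale)
  moreover have "kscale (inverse (c v)) (kscale (c v) v) = v"
    using nz by (simp flip: cq_mult)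
  ultimately show False using ind by simp
qed

text \<open>Non-membership is certified by a linear form. The forms used below are cocycles living
  in a single multidegree.\<close>

lemma not_in_span_by_functional:
  assumes f: "\<And>x y. f (x + y) = f x + f y" "\<And>a x. f (kscale a x) = a * f x"
    and "\<And>s. s \<in> S \<Longrightarrow> f s = (0 :: 'k::field)" "f v \<noteq> 0"
  shows "v \<notin> kos.span S"
proof
  assume "v \<in> kos.span S"
  then have "f v = 0"
  proof (induction rule: kos.span_induct_alt)
    case base
    show ?case using f(2)[of 0 0] by simp
  next
    case (step c x y)
    then show ?case using f assms(3) by simp
  qed
  with assms(4) show False by simp
qed

section \<open>Explicit cycles for the Massey product\<close>

definition "zb = (cell {Y1} (mon 0 0 0 2 0) :: 'k::field kos)"
definition "zc = (cell {Z} (mon 0 0 0 0 2) :: 'k::field kos)"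
definition "za = (cell {X1} (mon 0 2 0 0 0) :: 'k::field kos)"
text \<open>A representative, up to sign, of the Massey product of \<open>za\<close>,
  \<open>zb\<close> and \<open>zc\<close>: the chain \<open>qab\<close> bounds \<open>za zb\<close>,
  the product \<open>zb zc\<close> is 0 already on chains, and \<open>qab zc\<close> is
  \<open>h0\<close>.\<close>

definition "h0 = (cell {X2, Y1, Y2, Z} (mon 1 1 0 1 2) :: 'k::field kos)"
definition "qab = (cell {X2, Y1, Y2} (mon 1 1 0 1 0) - cell {X1, X2, Y1} (mon 0 1 0 2 0) :: 'k::field kos)"

lemma pos_sign_singleton: "pos_sign i {j} = (if j < i then - 1 else 1)"
proof -
  have "{m \<in> {j}. m < i} = (if j < i then {j} else {})" by auto
  then show ?thesis by (simp add: pos_sign_def)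
qed

lemma pos_sign_empty: "pos_sign i {} = 1"
  by (simp add: pos_sign_def)

lemmas sign_simps = pos_sign_insert pos_sign_singleton pos_sign_empty less_var_def

lemma in_a_mon: "in_a (mon a b c d e) \<longleftrightarrow> 1 \<le> a \<and> 2 \<le> b \<or> 1 \<le> c \<and> 2 \<le> d \<or> 3 \<le> e \<or>
     1 \<le> a \<and> 1 \<le> b \<and> 1 \<le> c \<and> 1 \<le> d \<or> 2 \<le> d \<and> 2 \<le> e \<or> 2 \<le> b \<and> 2 \<le> e \<or>
     1 \<le> a \<and> 1 \<le> c \<and> 1 \<le> e \<or> 2 \<le> b \<and> 2 \<le> d \<and> 1 \<le> e"
  by (simp add: in_a_def ex_mon)

lemma za_cycle: "za \<in> kcycles 1"
  by (simp add: za_def cell_kdeg dK_cell cell_in_a in_a_mon)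

lemma zb_cycle: "zb \<in> kcycles 1"
  by (simp add: zb_def cell_kdeg dK_cell cell_in_a in_a_mon)

lemma zc_cycle: "zc \<in> kcycles 1"
  by (simp add: zc_def cell_kdeg dK_cell cell_in_a in_a_mon)

lemma h0_cycle: "h0 \<in> kcycles 4"
  by (simp add: h0_def cell_kdeg dK_cell cell_in_a in_a_mon)

lemma qab_kdeg: "qab \<in> kdeg 3"
  by (simp add: qab_def kdeg_diff cell_kdeg)

lemma zb_zc: "kmul zb zc = 0"
  by (simp add: zb_def zc_def kmul_cell cell_in_a in_a_mon)

lemma shuffle_sign_simps:
  "shuffle_sign {X1} {Y1} = 1" "shuffle_sign {X2, Y1, Y2} {Z} = 1" "shuffle_sign {X1, X2, Y1} {Z} = 1"
proof -
  have "{(m, m'). m \<in> {X1} \<and> m' \<in> {Y1} \<and> m' < m} = {}" "{(m, m'). m \<in> {X2, Y1, Y2} \<and> m' \<in> {Z} \<and> m' < m} = {}"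
    "{(m, m'). m \<in> {X1, X2, Y1} \<and> m' \<in> {Z} \<and> m' < m} = {}" by (auto simp: less_var_def)
  then show "shuffle_sign {X1} {Y1} = 1" "shuffle_sign {X2, Y1, Y2} {Z} = 1" "shuffle_sign {X1, X2, Y1} {Z} = 1"
    by (simp_all only: shuffle_sign_def card.empty power_0)
qed

lemma dK_qab: "dK qab = kmul za (zb :: 'k::field kos)"
proof -
  have s: "{X2, Y1, Y2} - {Y2} = {X2, Y1}" "{X1, X2, Y1} - {X1} = {X2, Y1}" "{X1, X2, Y1} - {X2} = {X1, Y1}" by auto
  have n: "X1 \<notin> {X2, Y1}" "X1 \<notin> {X2}" "X2 \<notin> {Y1, Y2}" "X2 \<notin> {Y1}" "Y1 \<notin> {Y2}" by simp_all
  have 1: "dK (cell {X2, Y1, Y2} (mon 1 1 0 1 0)) = (cell {X2, Y1} (mon 1 1 0 2 0) :: 'k kos)"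
    by (simp add: dK_cell cell_in_a in_a_mon sign_simps s; (simp add: numeral_2_eq_2)?)
  have 2: "dK (cell {X1, X2, Y1} (mon 0 1 0 2 0)) = (cell {X2, Y1} (mon 1 1 0 2 0) - cell {X1, Y1} (mon 0 2 0 2 0) :: 'k kos)"
    by (simp add: dK_cell cell_in_a in_a_mon sign_simps s smul_minus_left; (simp add: numeral_2_eq_2)?)
  have 3: "kmul za zb = (cell {X1, Y1} (mon 0 2 0 2 0) :: 'k kos)"
    by (simp add: za_def zb_def kmul_cell shuffle_sign_simps, simp add: numeral_2_eq_2 insert_commute)
  show ?thesis by (simp only: qab_def kdiff_diff 1 2 3) simp
qed

lemma qab_zc: "kmul qab zc = h0"
  by (simp add: qab_def zc_def h0_def kmul_diff_left kmul_cell cell_in_a in_a_mon shuffle_sign_simps insert_commute,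
      simp add: numeral_2_eq_2)

lemma zb_zc_independent:
  "x \<in> {zb, zc} \<Longrightarrow> x \<notin> kos.span (kboundaries 1 \<union> ({zb, zc} - {x} :: 'k::field kos set))"
proof -
  have b: "zb \<notin> kos.span (kboundaries 1 \<union> {zc} :: 'k kos set)"
  proof (rule not_in_span_by_functional)
    \<comment> \<open>The two cells of multidegree \<open>y1 y2^2\<close> in degree 1. The only cell
      above them is \<open>y2 e_Y1 e_Y2\<close>, whose boundary has opposite coefficients
      there.\<close>
    let ?f = "\<lambda>w :: 'k kos. coef w {Y1} (mon 0 0 0 2 0) + coef w {Y2} (mon 0 0 1 1 0)"
    show "?f s = 0" if "s \<in> kboundaries 1 \<union> {zc}" for s
      using that by (auto simp: coef_dK_mon in_a_mon ex_mon sign_simps zc_def coef_cell insert_commute, simp add: One_nat_def)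
    show "?f zb \<noteq> 0" by (simp add: zb_def coef_cell in_a_mon)
  qed (auto simp: coef_add coef_cq algebra_simps)
  have c: "zc \<notin> kos.span (kboundaries 1 \<union> {zb} :: 'k kos set)"
  proof (rule not_in_span_by_functional)
    \<comment> \<open>No cell of degree 2 has multidegree \<open>z^3\<close>.\<close>
    let ?f = "\<lambda>w :: 'k kos. coef w {Z} (mon 0 0 0 0 2)"
    show "?f s = 0" if "s \<in> kboundaries 1 \<union> {zb}" for s
      using that by (auto simp: coef_dK_mon in_a_mon ex_mon sign_simps zb_def coef_cell)
    show "?f zc \<noteq> 0" by (simp add: zc_def coef_cell in_a_mon)
  qed (auto simp: coef_add coef_cq)
  have ne: "zb \<noteq> (zc :: 'k kos)"
  proof
    assume "zb = (zc :: 'k kos)"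
    then have "coef zb {Z} (mon 0 0 0 0 2) = coef (zc :: 'k kos) {Z} (mon 0 0 0 0 2)" by simp
    then show False by (simp add: zb_def zc_def coef_cell in_a_mon)
  qed
  then have d: "{zb, zc} - {zb} = {zc :: 'k kos}" "{zb, zc} - {zc} = {zb :: 'k kos}" by auto
  show "x \<notin> kos.span (kboundaries 1 \<union> ({zb, zc} - {x}))" if "x \<in> {zb, zc}" for x :: "'k kos"
    using that
  proof (elim insertE emptyE)
    assume x: "x = zb"
    show ?thesis unfolding x d by (rule b)
  next
    assume x: "x = zc"
    show ?thesis unfolding x d by (rule c)
  qed
qed

lemma h0_not_boundary: "h0 \<notin> kos.span (kboundaries 4 :: 'k::field kos set)"
proof (rule not_in_span_by_functional)
  \<comment> \<open>Both cells have multidegree \<open>x1 x2^2 y1 y2^2 z^3\<close>. The only cell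
    above them is \<open>x2 y2 z^2\<close> times the top form; its boundary is their sum, the other
    three terms lying in the ideal.\<close>
  let ?f = "\<lambda>w :: 'k kos. coef w {X2, Y1, Y2, Z} (mon 1 1 0 1 2) - coef w {X1, X2, Y2, Z} (mon 0 1 1 1 2)"
  show "?f s = 0" if "s \<in> kboundaries 4" for s
    using that by (auto simp: coef_dK_mon in_a_mon ex_mon sign_simps insert_commute)
  have "{X2, Y1, Y2, Z} \<noteq> {X1, X2, Y2, Z}" by auto
  then show "?f h0 \<noteq> 0" by (simp add: h0_def coef_cell in_a_mon)
qed (auto simp: coef_add coef_cq algebra_simps)

definition kone :: "'k::field kos" where
  "kone = Poly_Mapping.single {} 1"

lemma kone_cycle: "kone \<in> kcycles 0"
  by (simp add: kone_def kdeg_single kdiff_kdeg_0)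

lemma coef_kone: "coef kone {} 0 = 1"
  by (simp add: kone_def coef_def std_coeff_quot_map in_a_def flip: quot_map_one)

lemma coef_dK_const: "coef (dK z) {} 0 = 0"
  by (simp add: coef_dK)

text \<open>In degree 0 no cell contains any \<open>e_i\<close>, so elimination of all variables
  leaves only constants. The constant is read off because boundaries have no constant
  coefficient.\<close>

lemma kcycles_0:
  assumes "a \<in> (kdeg 0 :: 'k::field kos set)"
  shows "\<exists>t\<in>kdeg (Suc 0). a = dK t + kscale (coef a {} 0) kone"
proof -
  have "\<exists>b w. a = dK b + w \<and> b \<in> kdeg (Suc 0) \<and> w \<in> kdeg 0 \<and> supported (\<lambda>I u. \<forall>i\<in>D. i \<notin> I \<and> ex u i = 0) w"
    if "finite D" for D :: "var set"
    using that
  proof (induction D)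
    case empty
    show ?case using assms by (intro exI[of _ 0] exI[of _ a]) (simp add: supported_def)
  next
    case (insert i D)
    then obtain b w where w: "a = dK b + w" "b \<in> kdeg (Suc 0)" "w \<in> kdeg 0"
      "supported (\<lambda>I u. \<forall>i\<in>D. i \<notin> I \<and> ex u i = 0) w" by blast
    obtain b' w0 w1 where e: "w = dK b' + w0 + w1" "b' \<in> kdeg (Suc 0)" "w0 \<in> kdeg 0" "w1 \<in> kdeg 0"
      "supported (\<lambda>I u. (\<forall>i\<in>D. i \<notin> I \<and> ex u i = 0) \<and> \<not> in_a u \<and> i \<notin> I \<and> ex u i = 0) w0"
      "supported (\<lambda>I u. (\<forall>i\<in>D. i \<notin> I \<and> ex u i = 0) \<and> \<not> in_a u \<and> i \<in> I \<and> in_a (u + ev i)) w1"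
      by (rule eliminate[OF kdiff_kdeg_0[OF w(3)] w(3,4), of i]) (use insert.hyps in \<open>auto simp: ex_single\<close>)
    have "w1 = 0"
    proof (rule coef_eqI, rule ccontr)
      fix I u assume "coef w1 I u \<noteq> coef 0 I u"
      then have nz: "coef w1 I u \<noteq> 0" by simp
      then have "card I = 0" using e(4) kdeg_iff_coef by blast
      then have "I = {}" by simp
      then show False using supportedD[OF e(6) nz] by simp
    qed
    moreover have "supported (\<lambda>I u. \<forall>i\<in>insert i D. i \<notin> I \<and> ex u i = 0) w0"
      using e(5) by (rule supported_mono) auto
    ultimately show ?case
      using w(1,2) e(1,2,3) by (intro exI[of _ "b + b'"] exI[of _ w0]) (simp add: kdiff_add kdeg_add add.assoc)
  qed
  from this[OF finite, of UNIV] obtain b w where w: "a = dK b + w" "b \<in> kdeg (Suc 0)" "w \<in> kdeg 0"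
    "supported (\<lambda>I u. \<forall>i\<in>UNIV. i \<notin> I \<and> ex u i = 0) w" by blast
  have weq: "w = kscale (coef a {} 0) kone"
  proof (rule coef_eqI)
    fix I u
    show "coef w I u = coef (kscale (coef a {} 0) kone) I u"
    proof (cases "I = {} \<and> u = 0")
      case True
      then show ?thesis by (simp add: coef_cq coef_kone w(1) coef_add coef_dK_const)
    next
      case False
      have "coef w I u = 0"
      proof (rule ccontr)
        assume "coef w I u \<noteq> 0"
        from supportedD[OF w(4) this] have "I = {}" "u = 0" by (auto simp: mono_eq_iff)
        then show False using False by simp
      qed
      moreover have "coef (kone :: 'k kos) I u = 0"
      proof -
        have k: "kone = (cell {} 0 :: 'k kos)" by (simp add: kone_def cell_def)
        show ?thesis unfolding k coef_cell using False by auto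
      qed
      ultimately show ?thesis by (simp add: coef_cq)
    qed
  qed
  have "a = dK b + kscale (coef a {} 0) kone"
    by (rule trans[OF w(1) arg_cong[OF weq, where f = "\<lambda>x. dK b + x"]])
  with w(2) show ?thesis by (intro bexI)
qed

section \<open>The initial part of a resolution of the residue field\<close>

text \<open>A letter is a homology class, given by its degree and a representing cycle. As a
  generator of the tensor algebra it has this degree plus 1.\<close>

type_synonym 'k word = "(nat \<times> 'k kos) list"

text \<open>The element \<open>a \<otimes> ws\<close> of the Koszul complex tensored with the tensor
  algebra; \<open>wcomp\<close> reads off the coefficient of a word.\<close>

definition place :: "'k::field word \<Rightarrow> 'k kos \<Rightarrow> (var set \<times> 'k word \<Rightarrow>\<^sub>0 'k quot_ring)" where
  "place ws = lin_ext (\<lambda>I. Poly_Mapping.single (I, ws) 1)"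

definition wcomp :: "'k::field word \<Rightarrow> (var set \<times> 'k word \<Rightarrow>\<^sub>0 'k quot_ring) \<Rightarrow> 'k kos" where
  "wcomp ws = lin_ext (\<lambda>(I, ws'). if ws' = ws then Poly_Mapping.single I 1 else 0)"

definition weight :: "'k::field word \<Rightarrow> nat" where
  "weight ws = (\<Sum>x\<leftarrow>ws. Suc (fst x))"

lemma weight_simps [simp]: "weight [] = 0" "weight (x # ws) = Suc (fst x) + weight ws"
  by (simp_all add: weight_def)

lemma lookup_comp: "Poly_Mapping.lookup (wcomp ws u) I = Poly_Mapping.lookup u (I, ws)"
proof (induction u rule: poly_mapping_linear_induct)
  case (single b c)
  obtain J ws' where "b = (J, ws')" by (cases b)
  then show ?case by (simp add: wcomp_def lookup_single when_def)
qed (simp add: wcomp_def lin_ext_add lookup_add)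

lemma lookup_place: "Poly_Mapping.lookup (place ws a) (I, ws') = (if ws' = ws then Poly_Mapping.lookup a I else 0)"
  by (induction a rule: poly_mapping_linear_induct)
    (auto simp: place_def lin_ext_add lookup_add lookup_single when_def)

lemma comp_eqI: "(\<And>ws. wcomp ws u = wcomp ws w) \<Longrightarrow> u = w"
  by (rule poly_mapping_eqI) (metis lookup_comp surj_pair)

lemma comp_zero [simp]: "wcomp ws 0 = 0"
  by (simp add: wcomp_def)

lemma comp_add: "wcomp ws (u + w) = wcomp ws u + wcomp ws w"
  by (simp add: wcomp_def lin_ext_add)

lemma comp_diff: "wcomp ws (u - w) = wcomp ws u - wcomp ws w"
  by (simp add: wcomp_def lin_ext_diff)

lemma comp_sum: "wcomp ws (\<Sum>a\<in>A. f a) = (\<Sum>a\<in>A. wcomp ws (f a))"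
  by (simp add: wcomp_def lin_ext_sum)

lemma comp_place: "wcomp ws (place ws' a) = (if ws = ws' then a else 0)"
  by (rule poly_mapping_eqI) (simp add: lookup_comp lookup_place)

lemma place_zero [simp]: "place ws 0 = 0"
  by (simp add: place_def)

lemma place_add: "place ws (a + b) = place ws a + place ws b"
  by (simp add: place_def lin_ext_add)

lemma place_uminus: "place ws (- a) = - place ws a"
  by (simp add: place_def lin_ext_uminus)

lemma place_smul: "place ws (smul c a) = smul c (place ws a)"
  by (simp add: place_def lin_ext_smul)

lemma place_single: "place ws (Poly_Mapping.single I c) = Poly_Mapping.single (I, ws) c"
  by (simp add: place_def)

lemma kone_kdeg [simp]: "kone \<in> kdeg 0"
  and dK_kone [simp]: "dK kone = 0"
  using kone_cycle by auto

text \<open>The cycles in \<open>C n\<close> represent a basis of the homology in degree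
  \<open>n\<close>, and \<open>\<gamma>\<close> bounds products of letters, up to sign. Two letters
  of degrees \<open>k\<close> and \<open>l\<close> have weight \<open>k + l + 2\<close>, so
  \<open>k + l \<le> 3\<close> covers everything up to degree 5.\<close>

locale homology_bases =
  fixes C :: "nat \<Rightarrow> 'k::field kos set" and \<gamma> :: "'k kos \<Rightarrow> 'k kos \<Rightarrow> 'k kos"
  assumes finite_C: "n \<le> 4 \<Longrightarrow> finite (C n)"
    and C_cycle: "n \<le> 4 \<Longrightarrow> v \<in> C n \<Longrightarrow> v \<in> kdeg n \<and> dK v = 0"
    and decompose: "n \<le> 4 \<Longrightarrow> a \<in> kdeg n \<Longrightarrow> dK a = 0 \<Longrightarrow>
      \<exists>t\<in>kdeg (Suc n). \<exists>c. a = dK t + (\<Sum>v\<in>C n. kscale (c v) v)"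
    and independent: "n \<le> 4 \<Longrightarrow> (\<Sum>v\<in>C n. kscale (c v) v) = dK t \<Longrightarrow> v \<in> C n \<Longrightarrow> c v = 0"
    and C_0: "C 0 = {kone}"
    and gamma: "v \<in> C k \<Longrightarrow> w \<in> C l \<Longrightarrow> 1 \<le> k \<Longrightarrow> 1 \<le> l \<Longrightarrow> k + l \<le> 3 \<Longrightarrow>
      \<gamma> v w \<in> kdeg (Suc (k + l)) \<and> dK (\<gamma> v w) = - kmul (involute v) w"
begin

definition letters :: "(nat \<times> 'k kos) set" where
  "letters = Sigma {1..4} C"

text \<open>A letter has weight at least 2, so longer words have weight at least 6 and do not occur
  in degrees up to 5.\<close>

definition words :: "'k word set" where
  "words = {ws. set ws \<subseteq> letters \<and> length ws \<le> 2}"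

definition basis :: "nat \<Rightarrow> (var set \<times> 'k word) set" where
  "basis j = {(I, ws). ws \<in> words \<and> card I + weight ws = j}"

text \<open>The part of the differential that consumes letters: the first letter is multiplied into
  the Koszul factor, and \<open>\<gamma>\<close> corrects the failure of \<open>d d = 0\<close> on
  words of two letters.\<close>

fun tail :: "'k word \<Rightarrow> 'k kos \<Rightarrow> (var set \<times> 'k word \<Rightarrow>\<^sub>0 'k quot_ring)" where
  "tail [] a = 0"
| "tail [x] a = place [] (kmul (involute a) (snd x))"
| "tail (x # y # ws) a = place [y] (kmul (involute a) (snd x)) + place [] (kmul (involute a) (\<gamma> (snd x) (snd y)))"

fun bdry :: "var set \<times> 'k word \<Rightarrow> (var set \<times> 'k word \<Rightarrow>\<^sub>0 'k quot_ring)" where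
  "bdry (I, ws) = place ws (dK (Poly_Mapping.single I 1)) + tail ws (Poly_Mapping.single I 1)"

abbreviation dG :: "(var set \<times> 'k word \<Rightarrow>\<^sub>0 'k quot_ring) \<Rightarrow> (var set \<times> 'k word \<Rightarrow>\<^sub>0 'k quot_ring)" where
  "dG \<equiv> lin_ext bdry"

lemma finite_letters: "finite letters"
  unfolding letters_def by (rule finite_SigmaI) (auto intro: finite_C)

lemma finite_words: "finite words"
  unfolding words_def by (rule finite_lists_length_le[OF finite_letters])

lemma words_cases:
  assumes "ws \<in> words"
  obtains "ws = []" | x where "ws = [x]" "x \<in> letters" | x y where "ws = [x, y]" "x \<in> letters" "y \<in> letters"
  using assms by (cases ws rule: remdups_adj.cases) (auto simp: words_def numeral_2_eq_2)

lemma tail_add: "tail ws (a + b) = tail ws a + tail ws b"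
  by (cases ws rule: remdups_adj.cases) (simp_all add: involute_add kmul_add_left place_add)

lemma tail_smul: "tail ws (smul c a) = smul c (tail ws a)"
  by (cases ws rule: remdups_adj.cases)
    (simp_all add: involute_smul kmul_smul_left place_smul smul_add_right)

lemma tail_zero [simp]: "tail ws 0 = 0"
  using tail_smul[of ws 0 0] by simp

lemma dG_place: "dG (place ws a) = place ws (dK a) + tail ws a"
proof (induction a rule: poly_mapping_linear_induct)
  case (single I c)
  have "Poly_Mapping.single I c = smul c (Poly_Mapping.single I 1)" by simp
  then have "place ws (dK (Poly_Mapping.single I c)) + tail ws (Poly_Mapping.single I c) = smul c (bdry (I, ws))"
    by (simp only: kdiff_smul place_smul tail_smul bdry.simps smul_add_right)
  then show ?case by (simp add: place_single)
qed (simp add: place_add lin_ext_add kdiff_add tail_add)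

lemma place_free_mod: "a \<in> kdeg n \<Longrightarrow> ws \<in> words \<Longrightarrow> place ws a \<in> free_mod (basis (n + weight ws))"
  unfolding place_def kdeg_def by (erule lin_ext_free_mod) (auto intro: free_mod_single simp: basis_def)

lemma nil_words [simp]: "[] \<in> words"
  by (simp add: words_def)

lemma letters_iff: "x \<in> letters \<longleftrightarrow> 1 \<le> fst x \<and> fst x \<le> 4 \<and> snd x \<in> C (fst x)"
  by (cases x) (auto simp: letters_def)

lemma singleton_words: "x \<in> letters \<Longrightarrow> [x] \<in> words"
  by (simp add: words_def)

lemma tail_free_mod:
  assumes a: "a \<in> kdeg n" and ws: "ws \<in> words" and w: "n + weight ws = Suc j" "j \<le> 4"
  shows "tail ws a \<in> free_mod (basis j)"
  using ws
proof (cases rule: words_cases)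
  case 1
  then show ?thesis by simp
next
  case (2 x)
  have "kmul (involute a) (snd x) \<in> kdeg (n + fst x)"
    using C_cycle[of "fst x" "snd x"] 2(2) a by (intro kmul_mem_kdeg involute_mem_kdeg) (auto simp: letters_iff)
  from place_free_mod[OF this nil_words] show ?thesis using w 2(1) by simp
next
  case (3 x y)
  have "kmul (involute a) (snd x) \<in> kdeg (n + fst x)"
    using C_cycle[of "fst x" "snd x"] 3(2) a by (intro kmul_mem_kdeg involute_mem_kdeg) (auto simp: letters_iff)
  from place_free_mod[OF this singleton_words[OF 3(3)]]
  have "place [y] (kmul (involute a) (snd x)) \<in> free_mod (basis j)" using w 3(1) by (simp add: add_ac)
  moreover have "kmul (involute a) (\<gamma> (snd x) (snd y)) \<in> kdeg (n + Suc (fst x + fst y))"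
    using gamma[of "snd x" "fst x" "snd y" "fst y"] 3 w a
    by (intro kmul_mem_kdeg involute_mem_kdeg) (auto simp: letters_iff)
  from place_free_mod[OF this nil_words]
  have "place [] (kmul (involute a) (\<gamma> (snd x) (snd y))) \<in> free_mod (basis j)"
    using w 3(1) by (simp add: add_ac)
  ultimately show ?thesis using 3(1) by (simp add: free_mod_add)
qed

lemma dG_place_free_mod:
  assumes "a \<in> kdeg n" "ws \<in> words" "n + weight ws = Suc j" "j \<le> 4"
  shows "dG (place ws a) \<in> free_mod (basis j)"
proof -
  have "place ws (dK a) \<in> free_mod (basis j)"
  proof (cases n)
    case 0
    then show ?thesis using assms(1) by (simp add: kdiff_kdeg_0)
  next
    case (Suc m)
    then have "dK a \<in> kdeg m" using assms(1) by (simp add: kdiff_mem_kdeg)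
    from place_free_mod[OF this assms(2)] show ?thesis using assms(3) Suc by simp
  qed
  then show ?thesis using tail_free_mod[OF assms] by (simp add: dG_place free_mod_add)
qed

lemma bdry_eq: "bdry (I, ws) = dG (place ws (Poly_Mapping.single I 1))"
  by (simp add: place_single)

lemma bdry_free_mod: "b \<in> basis (Suc j) \<Longrightarrow> j \<le> 4 \<Longrightarrow> bdry b \<in> free_mod (basis j)"
proof (cases b)
  case (Pair I ws)
  assume "b \<in> basis (Suc j)" "j \<le> 4"
  then show ?thesis
    unfolding Pair bdry_eq by (intro dG_place_free_mod[of _ "card I"]) (auto simp: basis_def kdeg_single)
qed

text \<open>For two letters, multiplying in one after the other leaves \<open>a x y\<close> up to
  sign, which the differential of the \<open>\<gamma>\<close>-term cancels. The bound on the weight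
  puts the letters in the range of \<open>gamma\<close>.\<close>

lemma dG_dG_place:
  assumes ws: "ws \<in> words" and w: "weight ws \<le> 5"
  shows "dG (dG (place ws a)) = 0"
  using ws
proof (cases rule: words_cases)
  case 1
  then show ?thesis by (simp add: dG_place lin_ext_add)
next
  case (2 x)
  then have "dK (snd x) = 0" using C_cycle by (auto simp: letters_iff)
  then have "dK (kmul (involute a) (snd x)) = - kmul (involute (dK a)) (snd x)"
    by (simp add: kdiff_kmul kdiff_involute kmul_uminus_left)
  then show ?thesis using 2 by (simp add: dG_place lin_ext_add place_uminus)
next
  case (3 x y)
  have "dK (snd x) = 0" using 3 C_cycle by (auto simp: letters_iff)
  then have 1: "dK (kmul (involute a) (snd x)) = - kmul (involute (dK a)) (snd x)"
    by (simp add: kdiff_kmul kdiff_involute kmul_uminus_left)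
  have "dK (\<gamma> (snd x) (snd y)) = - kmul (involute (snd x)) (snd y)"
    using gamma[of "snd x" "fst x" "snd y" "fst y"] 3 w by (auto simp: letters_iff)
  then have 2: "dK (kmul (involute a) (\<gamma> (snd x) (snd y))) =
      - kmul (involute (dK a)) (\<gamma> (snd x) (snd y)) - kmul a (kmul (involute (snd x)) (snd y))"
    by (simp add: kdiff_kmul kdiff_involute kmul_uminus_left kmul_uminus_right)
  show ?thesis
    by (simp add: 3(1) dG_place lin_ext_add place_uminus place_add[symmetric] 1 2 involute_kmul kmul_assoc)
qed

lemma comp_outside:
  assumes "u \<in> free_mod (basis j)" "\<not> (ws \<in> words \<and> weight ws \<le> j)"
  shows "wcomp ws u = 0"
proof (rule poly_mapping_eqI)
  fix I
  have "(I, ws) \<notin> basis j" using assms(2) by (auto simp: basis_def)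
  then show "Poly_Mapping.lookup (wcomp ws u) I = Poly_Mapping.lookup 0 I"
    using assms(1) by (auto simp: lookup_comp free_mod_iff)
qed

lemma comp_kdeg:
  assumes "u \<in> free_mod (basis j)"
  shows "wcomp ws u \<in> kdeg (j - weight ws)"
  unfolding kdeg_def free_mod_iff lookup_comp
proof (intro allI impI)
  fix I assume "Poly_Mapping.lookup u (I, ws) \<noteq> 0"
  then have "(I, ws) \<in> basis j" using assms by (simp add: free_mod_iff)
  then show "I \<in> {I. card I = j - weight ws}" by (auto simp: basis_def)
qed

lemma sum_place_comp:
  assumes "u \<in> free_mod (basis j)"
  shows "u = (\<Sum>ws\<in>words. place ws (wcomp ws u))"
proof (rule comp_eqI)
  fix ws
  show "wcomp ws u = wcomp ws (\<Sum>ws\<in>words. place ws (wcomp ws u))"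
    using comp_outside[OF assms, of ws] finite_words by (auto simp: comp_sum comp_place)
qed

lemma dG_dG:
  assumes "u \<in> free_mod (basis j)" "j \<le> 5"
  shows "dG (dG u) = 0"
proof -
  have "dG (dG (place ws (wcomp ws u))) = 0" if "ws \<in> words" for ws
    using dG_dG_place[OF that] comp_outside[OF assms(1), of ws] assms(2) by (cases "weight ws \<le> 5") auto
  then show ?thesis
    by (subst sum_place_comp[OF assms(1)]) (simp add: lin_ext_sum)
qed

lemma comp_tail:
  assumes "ws' \<in> words" "length ws' > Suc (length ws) \<Longrightarrow> a = 0"
  shows "wcomp ws (tail ws' a) = (if \<exists>x. ws' = x # ws then kmul (involute a) (snd (hd ws')) else 0)"
  using assms(1)
proof (cases rule: words_cases)
  case (3 x y)
  then show ?thesis using assms(2) by (cases "ws = []") (auto simp: comp_add comp_place)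
qed (auto simp: comp_place)

text \<open>The \<open>\<gamma>\<close>-terms drop two letters at once. If no words that long occur,
  they do not reach \<open>ws\<close>, and the differential looks as if \<open>\<gamma>\<close> were
  absent.\<close>

lemma comp_dG:
  assumes u: "u \<in> free_mod (basis j)" and short: "\<And>ws'. length ws' > Suc (length ws) \<Longrightarrow> wcomp ws' u = 0"
  shows "wcomp ws (dG u) = dK (wcomp ws u) + (\<Sum>x\<in>letters. kmul (involute (wcomp (x # ws) u)) (snd x))"
proof -
  let ?g = "\<lambda>ws'. if \<exists>x. ws' = x # ws then kmul (involute (wcomp ws' u)) (snd (hd ws')) else 0"
  have "wcomp ws (dG u) = (\<Sum>ws'\<in>words. wcomp ws (place ws' (dK (wcomp ws' u)) + tail ws' (wcomp ws' u)))"
    by (subst sum_place_comp[OF u]) (simp only: lin_ext_sum comp_sum dG_place)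
  also have "\<dots> = (\<Sum>ws'\<in>words. (if ws' = ws then dK (wcomp ws u) else 0) + ?g ws')"
  proof (rule sum.cong[OF refl])
    fix ws' assume "ws' \<in> words"
    from comp_tail[OF this short, of ws] show "wcomp ws (place ws' (dK (wcomp ws' u)) + tail ws' (wcomp ws' u)) =
        (if ws' = ws then dK (wcomp ws u) else 0) + ?g ws'"
      by (simp only: comp_add comp_place) auto
  qed
  also have "\<dots> = dK (wcomp ws u) + (\<Sum>ws'\<in>words. ?g ws')"
    using comp_outside[OF u, of ws] finite_words by (auto simp: sum.distrib)
  also have "(\<Sum>ws'\<in>words. ?g ws') = (\<Sum>ws'\<in>words \<union> (\<lambda>x. x # ws) ` letters. ?g ws')"
    by (rule sum.mono_neutral_left) (use finite_words finite_letters comp_outside[OF u] in auto)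
  also have "\<dots> = (\<Sum>ws'\<in>(\<lambda>x. x # ws) ` letters. ?g ws')"
    by (rule sum.mono_neutral_right) (use finite_words finite_letters in \<open>auto simp: words_def\<close>)
  also have "\<dots> = (\<Sum>x\<in>letters. kmul (involute (wcomp (x # ws) u)) (snd x))"
    by (subst sum.reindex) (auto simp: inj_on_def)
  finally show ?thesis .
qed

lemma sum_letters_degree:
  assumes "1 \<le> k" "k \<le> 4"
  shows "(\<Sum>x\<in>letters. if fst x = k then g (snd x) else 0) = (\<Sum>v\<in>C k. g v)"
proof -
  have "(\<Sum>x\<in>letters. if fst x = k then g (snd x) else 0) = (\<Sum>i\<in>{1..4}. \<Sum>v\<in>C i. if i = k then g v else 0)"
    unfolding letters_def using finite_C by (subst sum.Sigma) (auto intro!: sum.cong)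
  also have "\<dots> = (\<Sum>i\<in>{1..4}. if i = k then \<Sum>v\<in>C k. g v else 0)"
    by (intro sum.cong refl) auto
  finally show ?thesis using assms by simp
qed

lemma kmul_kscale_kone: "kmul (involute (kscale c kone)) v = kscale c v"
  by (simp add: kone_def involute_single kmul_smul_left involute_smul del: smul_single)

section \<open>Exactness in low degrees\<close>

definition short :: "nat \<Rightarrow> (var set \<times> 'k word \<Rightarrow>\<^sub>0 'k quot_ring) \<Rightarrow> bool" where
  "short m u \<longleftrightarrow> (\<forall>ws. m \<le> length ws \<longrightarrow> wcomp ws u = 0)"

text \<open>The coefficients of the longest words are cycles, hence boundaries plus combinations of
  basis cycles. Boundaries are removed by placing a bounding chain on the same word; a basis cycle
  of positive degree is hit by the word with that cycle prepended as a letter. Only scalars remain.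
  They vanish because \<open>dG u' = 0\<close>, read on words one letter shorter, is a linear
  relation between homology classes.\<close>

lemma reduce_length:
  assumes j: "j \<le> 4" and l: "l \<le> 2" and u: "u \<in> free_mod (basis j)" and du: "dG u = 0"
    and aug: "j = 0 \<Longrightarrow> coef (wcomp [] u) {} 0 = 0" and short: "short (Suc l) u"
  shows "\<exists>y\<in>free_mod (basis (Suc j)). short l (u - dG y)"
proof -
  define S where "S = {ws \<in> words. length ws = l \<and> weight ws \<le> j}"
  have finS: "finite S" using finite_words by (simp add: S_def)
  have long: "wcomp ws u = 0" if "l < length ws" for ws using short that by (simp add: short_def)
  have "dK (wcomp ws u) = 0" if "length ws = l" for ws
  proof -
    have "wcomp ws (dG u) = dK (wcomp ws u) + (\<Sum>x\<in>letters. kmul (involute (wcomp (x # ws) u)) (snd x))"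
      using u by (rule comp_dG) (use long that in auto)
    then show ?thesis using that by (simp add: du long)
  qed
  then have ex: "\<exists>t\<in>kdeg (Suc (j - weight ws)). \<exists>c. wcomp ws u = dK t + (\<Sum>v\<in>C (j - weight ws). kscale (c v) v)"
    if "ws \<in> S" for ws
    using j that by (intro decompose comp_kdeg[OF u]) (auto simp: S_def)
  define t where "t ws = (SOME t. t \<in> kdeg (Suc (j - weight ws)) \<and>
    (\<exists>c. wcomp ws u = dK t + (\<Sum>v\<in>C (j - weight ws). kscale (c v) v)))" for ws
  define c where "c ws = (SOME c. wcomp ws u = dK (t ws) + (\<Sum>v\<in>C (j - weight ws). kscale (c v) v))" for ws
  have t: "t ws \<in> kdeg (Suc (j - weight ws)) \<and>
      (\<exists>c. wcomp ws u = dK (t ws) + (\<Sum>v\<in>C (j - weight ws). kscale (c v) v))" if "ws \<in> S" for ws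
    unfolding t_def by (rule someI_ex) (use ex[OF that] in \<open>simp only: Bex_def\<close>)
  have tc1: "t ws \<in> kdeg (Suc (j - weight ws))" if "ws \<in> S" for ws
    by (rule t[OF that, THEN conjunct1])
  have tc2: "wcomp ws u = dK (t ws) + (\<Sum>v\<in>C (j - weight ws). kscale (c ws v) v)" if "ws \<in> S" for ws
    unfolding c_def by (rule someI_ex[OF t[OF that, THEN conjunct2]])
  note tc = tc1 tc2
  let ?p = "\<lambda>ws v. place ((j - weight ws, v) # ws) (kscale (c ws v) kone)"
  define y where "y = (\<Sum>ws\<in>S. place ws (t ws) + (if weight ws < j then \<Sum>v\<in>C (j - weight ws). ?p ws v else 0))"
  \<comment> \<open>Words of length 2 have weight at least 4, so for \<open>j \<le> 4\<close> a
    third letter never has to be prepended.\<close>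
  have l2: "l < 2" if "ws \<in> S" "weight ws < j" for ws
  proof (rule ccontr)
    assume "\<not> l < 2"
    then have "length ws = 2" "ws \<in> words" using l that by (auto simp: S_def)
    then show False using that(2) j by (cases rule: words_cases[OF \<open>ws \<in> words\<close>]) (auto simp: letters_iff)
  qed
  have y: "y \<in> free_mod (basis (Suc j))"
    unfolding y_def
  proof (intro free_mod_sum free_mod_add)
    fix ws assume ws: "ws \<in> S"
    then have ws': "ws \<in> words" "weight ws \<le> j" by (auto simp: S_def)
    from place_free_mod[OF tc(1)[OF ws] ws'(1)] ws'(2)
    show "place ws (t ws) \<in> free_mod (basis (Suc j))" by simp
    show "(if weight ws < j then \<Sum>v\<in>C (j - weight ws). ?p ws v else 0) \<in> free_mod (basis (Suc j))"
    proof (cases "weight ws < j")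
      case True
      have "?p ws v \<in> free_mod (basis (Suc j))" if v: "v \<in> C (j - weight ws)" for v
      proof -
        have "(j - weight ws, v) # ws \<in> words"
          using ws v l2[OF ws True] True j by (auto simp: S_def words_def letters_iff)
        from place_free_mod[OF _ this, of "kscale (c ws v) kone" 0] show ?thesis
          using True by (simp add: kdeg_smul)
      qed
      then show ?thesis using True by (simp add: free_mod_sum)
    qed simp
  qed
  define g where "g ws ws' = wcomp ws (if weight ws' < j then \<Sum>v\<in>C (j - weight ws'). ?p ws' v else 0)" for ws ws'
  have comp_y: "wcomp ws y = (\<Sum>ws'\<in>S. (if ws = ws' then t ws' else 0) + g ws ws')" for ws
    by (simp only: y_def comp_sum comp_add comp_place g_def)
  have g_eq: "g ws ws' = (if weight ws' < j then
      \<Sum>v\<in>C (j - weight ws'). if ws = (j - weight ws', v) # ws' then kscale (c ws' v) kone else 0 else 0)" for ws ws'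
    by (cases "weight ws' < j") (simp_all only: g_def if_True if_False comp_sum comp_place comp_zero)
  have g_other: "g ws ws' = 0" if "length ws \<noteq> Suc (length ws')" for ws ws'
  proof -
    have "ws \<noteq> (n, v) # ws'" for n v using that by auto
    then show ?thesis by (simp add: g_eq)
  qed
  have g_Cons: "g ((k, v) # ws) ws' = (if ws' = ws then if weight ws < j \<and> k = j - weight ws \<and> v \<in> C k
      then kscale (c ws v) kone else 0 else 0)" for k v ws ws'
  proof (cases "ws' = ws \<and> weight ws < j \<and> k = j - weight ws")
    case True
    then have "g ((k, v) # ws) ws' = (\<Sum>v'\<in>C k. if v = v' then kscale (c ws v') kone else 0)"
      by (simp add: g_eq)
    then show ?thesis using True finite_C[of k] j by simp
  next
    case False
    then show ?thesis by (auto simp: g_eq intro: sum.neutral)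
  qed
  have comp_y0: "wcomp ws y = (if ws \<in> S then t ws else 0)" if "length ws = l" for ws
  proof -
    have "wcomp ws y = (\<Sum>ws'\<in>S. if ws = ws' then t ws' else 0)"
      unfolding comp_y using that by (intro sum.cong refl) (simp add: g_other S_def)
    then show ?thesis using finS by simp
  qed
  have comp_y1: "wcomp ((k, v) # ws) y = (if ws \<in> S \<and> weight ws < j \<and> k = j - weight ws \<and> v \<in> C k then kscale (c ws v) kone else 0)"
    if "length ws = l" for k v ws
  proof -
    have ne: "(k, v) # ws \<noteq> ws'" if "ws' \<in> S" for ws' using that \<open>length ws = l\<close> by (auto simp: S_def)
    have "wcomp ((k, v) # ws) y = (\<Sum>ws'\<in>S. if ws' = ws then if weight ws < j \<and> k = j - weight ws \<and> v \<in> C k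
      then kscale (c ws v) kone else 0 else 0)"
      unfolding comp_y by (intro sum.cong refl) (simp only: g_Cons ne if_False add_0)
    then show ?thesis by (auto simp: sum.delta[OF finS])
  qed
  have comp_y2: "wcomp ws y = 0" if "Suc l < length ws" for ws
    unfolding comp_y
  proof (intro sum.neutral ballI)
    fix ws' assume "ws' \<in> S"
    then have "ws \<noteq> ws'" "length ws \<noteq> Suc (length ws')" using that by (auto simp: S_def)
    then show "(if ws = ws' then t ws' else 0) + g ws ws' = 0" by (simp add: g_other)
  qed
  define u' where "u' = u - dG y"
  have comp_dGy: "wcomp ws (dG y) = (if ws \<in> S then dK (t ws) + (if weight ws < j then \<Sum>v\<in>C (j - weight ws). kscale (c ws v) v else 0) else 0)"
    if len: "length ws = l" for ws
  proof -
    have "wcomp ws (dG y) = dK (wcomp ws y) + (\<Sum>x\<in>letters. kmul (involute (wcomp (x # ws) y)) (snd x))"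
      using y by (rule comp_dG) (use comp_y2 len in auto)
    also have "(\<Sum>x\<in>letters. kmul (involute (wcomp (x # ws) y)) (snd x)) =
        (if ws \<in> S \<and> weight ws < j then \<Sum>v\<in>C (j - weight ws). kscale (c ws v) v else 0)"
    proof (cases "ws \<in> S \<and> weight ws < j")
      case True
      have "kmul (involute (wcomp (x # ws) y)) (snd x) = (if fst x = j - weight ws then kscale (c ws (snd x)) (snd x) else 0)"
        if "x \<in> letters" for x
        using True that comp_y1[OF len, of "fst x" "snd x"] by (auto simp: kmul_kscale_kone letters_iff)
      then have "(\<Sum>x\<in>letters. kmul (involute (wcomp (x # ws) y)) (snd x)) =
          (\<Sum>x\<in>letters. if fst x = j - weight ws then kscale (c ws (snd x)) (snd x) else 0)"
        by (intro sum.cong refl)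
      also have "\<dots> = (\<Sum>v\<in>C (j - weight ws). kscale (c ws v) v)"
        using True j by (intro sum_letters_degree) auto
      finally show ?thesis using True by simp
    next
      case False
      have "kmul (involute (wcomp (x # ws) y)) (snd x) = 0" for x
        using False comp_y1[OF len, of "fst x" "snd x"] by (cases x) auto
      then show ?thesis unfolding if_not_P[OF False] by simp
    qed
    finally show ?thesis using comp_y0[OF len] by auto
  qed
  have long': "wcomp ws u' = 0" if "l < length ws" for ws
  proof -
    have "wcomp ws (dG y) = dK (wcomp ws y) + (\<Sum>x\<in>letters. kmul (involute (wcomp (x # ws) y)) (snd x))"
      using y by (rule comp_dG) (use comp_y2 that in auto)
    also have "\<dots> = dK (wcomp ws y)" using that comp_y2 by simp
    also have "\<dots> = 0"
    proof (cases "length ws = Suc l")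
      case True
      then obtain k v ws0 where ws: "ws = (k, v) # ws0" "length ws0 = l" by (cases ws) auto
      then show ?thesis using comp_y1[of ws0 k v] by (simp add: kdiff_smul)
    next
      case False
      then show ?thesis using that comp_y2[of ws] by simp
    qed
    finally show ?thesis using long[OF that] by (simp add: u'_def comp_diff)
  qed
  \<comment> \<open>What is left sits on words of full weight, where the Koszul degree is 0 and
    \<open>kone\<close> is the only basis cycle.\<close>
  have comp_u': "wcomp ws u' = (if ws \<in> S \<and> weight ws = j then kscale (c ws kone) kone else 0)"
    if len: "length ws = l" for ws
  proof (cases "ws \<in> S")
    case True
    then show ?thesis
      using tc(2)[OF True] comp_dGy[OF len] C_0 by (auto simp: u'_def comp_diff S_def)
  next
    case False
    then have "wcomp ws u = 0" using len by (intro comp_outside[OF u]) (auto simp: S_def)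
    then show ?thesis using False comp_dGy[OF len] by (simp add: u'_def comp_diff)
  qed
  have dGy: "dG y \<in> free_mod (basis j)"
    using y by (rule lin_ext_free_mod) (rule bdry_free_mod[OF _ j])
  then have u': "u' \<in> free_mod (basis j)" using u by (simp add: u'_def free_mod_diff)
  have du': "dG u' = 0" using dG_dG[OF y] j by (simp add: u'_def lin_ext_diff du)
  have "wcomp ws u' = 0" if len: "length ws = l" for ws
  proof (cases "ws \<in> S \<and> weight ws = j")
    case True
    show ?thesis
    proof (cases ws)
      \<comment> \<open>There is no shorter word to provide a relation; the augmentation hypothesis
        takes its place.\<close>
      case Nil
      then have "j = 0" "l = 0" using True len by auto
      have "coef (wcomp [] u') {} 0 = coef (wcomp [] u) {} 0 - coef (dK (t [])) {} 0"
        using comp_dGy[of "[]"] Nil True \<open>j = 0\<close> \<open>l = 0\<close> by (simp add: u'_def comp_diff coef_diff)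
      then have "c [] kone = 0"
        using comp_u'[of "[]"] True Nil aug \<open>j = 0\<close> \<open>l = 0\<close> by (simp add: coef_dK_const coef_cq coef_kone)
      then show ?thesis using comp_u'[OF len] Nil by simp
    next
      case (Cons x ws0)
      have x: "x \<in> letters" "1 \<le> fst x" "fst x \<le> 4" "snd x \<in> C (fst x)"
        using True Cons by (auto simp: S_def words_def letters_iff)
      have len0: "Suc (length ws0) = l" using len Cons by simp
      \<comment> \<open>The relation involves all words \<open>(fst x, v) # ws0\<close> at once,
        with \<open>v\<close> running through the basis in the degree of the first letter.\<close>
      let ?c = "\<lambda>v. if (fst x, v) # ws0 \<in> S then c ((fst x, v) # ws0) kone else 0"
      have "wcomp ws0 (dG u') = dK (wcomp ws0 u') + (\<Sum>z\<in>letters. kmul (involute (wcomp (z # ws0) u')) (snd z))"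
        using u' by (rule comp_dG) (use long' len0 in auto)
      also have "(\<Sum>z\<in>letters. kmul (involute (wcomp (z # ws0) u')) (snd z)) =
          (\<Sum>z\<in>letters. if fst z = fst x then kscale (?c (snd z)) (snd z) else 0)"
      proof (rule sum.cong[OF refl])
        fix z assume "z \<in> letters"
        have "weight (z # ws0) = j \<longleftrightarrow> fst z = fst x" using True Cons by auto
        then show "kmul (involute (wcomp (z # ws0) u')) (snd z) = (if fst z = fst x then kscale (?c (snd z)) (snd z) else 0)"
          using comp_u'[of "z # ws0"] len0 by (cases z) (auto simp: kmul_kscale_kone)
      qed
      also have "\<dots> = (\<Sum>v\<in>C (fst x). kscale (?c v) v)" using x by (intro sum_letters_degree)
      finally have "(\<Sum>v\<in>C (fst x). kscale (?c v) v) = dK (- wcomp ws0 u')"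
        by (simp add: du' kdiff_uminus eq_neg_iff_add_eq_0 add.commute)
      from independent[OF x(3) this x(4)] have "c ws kone = 0" using True Cons by simp
      then show ?thesis using comp_u'[OF len] by simp
    qed
  next
    case False
    then show ?thesis using comp_u'[OF len] by auto
  qed
  then have "short l u'" using long' by (auto simp: short_def le_less)
  then show ?thesis using y u'_def by blast
qed

lemma coef_comp_dG_nil:
  assumes "y \<in> free_mod (basis (Suc 0))"
  shows "coef (wcomp [] (dG y)) {} 0 = 0"
proof -
  have zero: "wcomp ws y = 0" if "ws \<noteq> []" for ws
    using that by (intro comp_outside[OF assms]) (cases ws; auto simp: words_def letters_iff)
  have "wcomp [] (dG y) = dK (wcomp [] y) + (\<Sum>x\<in>letters. kmul (involute (wcomp [x] y)) (snd x))"
    using assms by (rule comp_dG) (rule zero, auto)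
  then show ?thesis by (simp add: zero coef_dK_const)
qed

text \<open>Words have at most two letters, so three reductions of the length lead to 0; after
  \<open>n\<close> of them only words of fewer than \<open>3 - n\<close> letters are left.\<close>

lemma exact:
  assumes j: "j \<le> 4" and u: "u \<in> free_mod (basis j)" "dG u = 0" "j = 0 \<Longrightarrow> coef (wcomp [] u) {} 0 = 0"
  shows "\<exists>y\<in>free_mod (basis (Suc j)). dG y = u"
proof -
  have "\<exists>y\<in>free_mod (basis (Suc j)). short (3 - n) (u - dG y)" if "n \<le> 3" for n
    using that
  proof (induction n)
    case 0
    have "short 3 u"
      unfolding short_def by (intro allI impI comp_outside[OF u(1)]) (auto simp: words_def)
    then show ?case by (intro bexI[of _ 0]) simp_all
  next
    case (Suc n)
    then obtain y where y: "y \<in> free_mod (basis (Suc j))" "short (Suc (2 - n)) (u - dG y)"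
      by (auto simp: Suc_diff_le numeral_3_eq_3 numeral_2_eq_2)
    have "dG y \<in> free_mod (basis j)" using y(1) by (rule lin_ext_free_mod) (rule bdry_free_mod[OF _ j])
    moreover have "dG (u - dG y) = 0" using dG_dG[OF y(1)] j by (simp add: lin_ext_diff u(2))
    moreover have "coef (wcomp [] (u - dG y)) {} 0 = 0" if "j = 0"
      using u(3) that coef_comp_dG_nil[of y] y(1) by (simp add: comp_diff coef_diff)
    ultimately obtain y' where "y' \<in> free_mod (basis (Suc j))" "short (2 - n) (u - dG y - dG y')"
      using reduce_length[OF j, of "2 - n" "u - dG y"] u(1) y(2) by (auto simp: free_mod_diff)
    then have "y + y' \<in> free_mod (basis (Suc j))" "short (3 - Suc n) (u - dG (y + y'))"
      using y(1) by (simp_all add: free_mod_add lin_ext_add diff_diff_add numeral_3_eq_3 numeral_2_eq_2)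
    then show ?case by blast
  qed
  from this[of 3] obtain y where y: "y \<in> free_mod (basis (Suc j))" "short 0 (u - dG y)" by auto
  have "u - dG y = 0" by (rule comp_eqI) (use y(2) in \<open>simp add: short_def\<close>)
  then show ?thesis using y(1) by auto
qed

end

section \<open>The failure of the Golod property\<close>

lemma card_UNIV_var: "card (UNIV :: var set) = 5"
  unfolding UNIV_var by simp

lemma card_var_subsets: "card {I :: var set. card I = m} = 5 choose m"
  using n_subsets[of "UNIV :: var set" m] by (simp add: card_UNIV_var)

context homology_bases
begin

definition theta :: "var set \<times> 'k word \<Rightarrow> 'k" where
  "theta b = (if b = ({}, []) then 1 else 0)"

lemma augmentation_theta: "augmentation (residue quot_map) theta u = coef (wcomp [] u) {} 0"
proof -
  have "augmentation (residue quot_map) theta u =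
      (\<Sum>b\<in>insert ({}, []) (Poly_Mapping.keys u). residue quot_map (Poly_Mapping.lookup u b) * theta b)"
    by (rule residue.augmentation_superset) auto
  also have "\<dots> = (\<Sum>b\<in>{({}, [])}. residue quot_map (Poly_Mapping.lookup u b) * theta b)"
    by (rule sum.mono_neutral_right) (auto simp: theta_def)
  also have "\<dots> = coef (wcomp [] u) {} 0"
    by (simp add: theta_def coef_def lookup_comp residue_eq)
  finally show ?thesis .
qed

lemma complex_basis: "residue.complex_upto 5 basis (\<lambda>_. bdry) theta"
  unfolding residue.complex_upto_def
proof (intro conjI allI impI ballI)
  show "bdry b \<in> free_mod (basis j)" if "j < 5" "b \<in> basis (Suc j)" for j b
    using that by (intro bdry_free_mod) auto
  show "augmentation (residue quot_map) theta (bdry b) = 0" if "b \<in> basis (Suc 0)" for b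
    using coef_comp_dG_nil[OF free_mod_single[OF that, of 1]] by (simp add: augmentation_theta)
  show "dG (bdry b) = 0" if "Suc j < 5" "b \<in> basis (Suc (Suc j))" for j b
    using dG_dG[OF free_mod_single[OF that(2), of 1]] that(1) by simp
qed

lemma exact_basis: "residue.exact_upto 5 basis (\<lambda>_. bdry) theta"
  unfolding residue.exact_upto_def
proof (intro conjI allI impI ballI)
  show "\<exists>y\<in>free_mod (basis 0). augmentation (residue quot_map) theta y = c" for c
    by (rule bexI[of _ "Poly_Mapping.single ({}, []) (cq c)"])
      (auto simp: residue.augmentation_single theta_def basis_def intro: free_mod_single)
  show "\<exists>y\<in>free_mod (basis (Suc 0)). dG y = u"
    if "u \<in> free_mod (basis 0)" "augmentation (residue quot_map) theta u = 0" for u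
  proof (rule exact)
    have "wcomp ws u \<in> kdeg 0" for ws using comp_kdeg[OF that(1), of ws] by simp
    have zero: "wcomp ws u = 0" if "ws \<noteq> []" for ws
      using that by (intro comp_outside[OF \<open>u \<in> free_mod (basis 0)\<close>]) (cases ws; auto)
    have "wcomp ws (dG u) = 0" for ws
    proof -
      have "wcomp ws (dG u) = dK (wcomp ws u) + (\<Sum>x\<in>letters. kmul (involute (wcomp (x # ws) u)) (snd x))"
        using that(1) by (rule comp_dG) (rule zero, auto)
      then show ?thesis by (simp add: zero kdiff_kdeg_0[OF \<open>\<And>ws. wcomp ws u \<in> kdeg 0\<close>])
    qed
    then show "dG u = 0" by (intro comp_eqI) simp
    show "coef (wcomp [] u) {} 0 = 0" using that(2) by (simp add: augmentation_theta)
  qed (use that in auto)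
  show "\<exists>y\<in>free_mod (basis (Suc (Suc j))). dG y = u"
    if "Suc j < 5" "u \<in> free_mod (basis (Suc j))" "dG u = 0" for j u
    using that by (intro exact) auto
qed

text \<open>The binomial coefficients count the index sets: a letter of degree \<open>k\<close>
  leaves \<open>4 - k\<close> exterior generators, two letters of degrees \<open>k\<close> and
  \<open>l\<close> leave \<open>3 - k - l\<close>.\<close>

lemma card_basis_5:
  "card (basis 5) \<le> 1 + 10 * card (C 1) + 10 * card (C 2) + 5 * card (C 3) + card (C 4) +
     5 * card (C 1) * card (C 1) + 2 * card (C 1) * card (C 2)"
  "finite (basis 5)"
proof -
  let ?S = "\<lambda>m. {I :: var set. card I = m}"
  let ?u0 = "(\<lambda>I. (I, [])) ` ?S 5 :: (var set \<times> 'k word) set"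
  let ?u1 = "\<lambda>k. (\<lambda>(I, v). (I, [(k, v)])) ` (?S (4 - k) \<times> C k)"
  let ?u2 = "\<lambda>k l. (\<lambda>(I, v, w). (I, [(k, v), (l, w)])) ` (?S (3 - k - l) \<times> C k \<times> C l)"
  let ?U = "?u0 \<union> ?u1 1 \<union> ?u1 2 \<union> ?u1 3 \<union> ?u1 4 \<union> ?u2 1 1 \<union> ?u2 1 2 \<union> ?u2 2 1"
  have sub: "basis 5 \<subseteq> ?U"
  proof
    fix b assume b: "b \<in> basis 5"
    obtain I ws where Iws: "b = (I, ws)" by (cases b)
    then have ws: "ws \<in> words" and w: "card I + weight ws = 5" using b by (auto simp: basis_def)
    from ws show "b \<in> ?U"
    proof (cases rule: words_cases)
      case 1
      then show ?thesis using w by (auto simp: Iws)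
    next
      case (2 x)
      then have "fst x = 1 \<or> fst x = 2 \<or> fst x = 3 \<or> fst x = 4" "snd x \<in> C (fst x)" "card I = 4 - fst x"
        using w by (auto simp: letters_iff)
      then have "b \<in> ?u1 (fst x)" "fst x = 1 \<or> fst x = 2 \<or> fst x = 3 \<or> fst x = 4"
        using 2(1) by (cases x, auto simp: Iws intro!: image_eqI[of _ _ "(I, snd x)"])+
      then show ?thesis by (elim disjE) simp_all
    next
      case (3 x y)
      then have "fst x = 1 \<and> fst y = 1 \<or> fst x = 1 \<and> fst y = 2 \<or> fst x = 2 \<and> fst y = 1"
        "snd x \<in> C (fst x)" "snd y \<in> C (fst y)" "card I = 3 - fst x - fst y"
        using w by (auto simp: letters_iff)
      then have "b \<in> ?u2 (fst x) (fst y)" "fst x = 1 \<and> fst y = 1 \<or> fst x = 1 \<and> fst y = 2 \<or> fst x = 2 \<and> fst y = 1"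
        using 3(1) by (cases x, cases y, auto simp: Iws intro!: image_eqI[of _ _ "(I, snd x, snd y)"])+
      then show ?thesis by (elim disjE) simp_all
    qed
  qed
  have fin1: "finite (?u1 k)" if "k \<le> 4" for k using finite_C[OF that] by simp
  have fin2: "finite (?u2 k l)" if "k \<le> 4" "l \<le> 4" for k l using that by (simp add: finite_C)
  have fin: "finite ?U" by (intro finite_UnI fin1 fin2) auto
  then show "finite (basis 5)" using sub finite_subset by blast
  have card1: "card (?u1 k) \<le> (5 choose (4 - k)) * card (C k)" if "k \<le> 4" for k
    using card_image_le[of "?S (4 - k) \<times> C k" "\<lambda>(I, v). (I, [(k, v)])"] finite_C[OF that]
    by (simp add: card_cartesian_product card_var_subsets)
  have card2: "card (?u2 k l) \<le> (5 choose (3 - k - l)) * (card (C k) * card (C l))" if "k \<le> 4" "l \<le> 4" for k l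
    using card_image_le[of "?S (3 - k - l) \<times> C k \<times> C l" "\<lambda>(I, v, w). (I, [(k, v), (l, w)])"] that
    by (simp add: card_cartesian_product card_var_subsets finite_C)
  have card0: "card ?u0 \<le> 5 choose 5"
    using card_image_le[of "?S 5" "\<lambda>I. (I, []) :: var set \<times> 'k word"] by (simp add: card_var_subsets)
  have choose: "5 choose 5 = (1 :: nat)" "5 choose 3 = (10 :: nat)" "5 choose 2 = (10 :: nat)"
    "5 choose 1 = (5 :: nat)" "5 choose 0 = (1 :: nat)"
    by (simp_all add: eval_nat_numeral One_nat_def)
  have "card (basis 5) \<le> card ?U" using card_mono[OF fin sub] .
  also have "\<dots> \<le> card ?u0 + card (?u1 1) + card (?u1 2) + card (?u1 3) + card (?u1 4) + card (?u2 1 1) + card (?u2 1 2) + card (?u2 2 1)"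
    by (intro order_trans[OF card_Un_le] add_right_mono order_refl)
  also have "\<dots> \<le> 1 + 10 * card (C 1) + 10 * card (C 2) + 5 * card (C 3) + card (C 4) +
     5 * (card (C 1) * card (C 1)) + card (C 1) * card (C 2) + card (C 2) * card (C 1)"
    using card0 card1[of 1] card1[of 2] card1[of 3] card1[of 4] card2[of 1 1] card2[of 1 2] card2[of 2 1]
    by (intro add_mono) (simp_all add: choose)
  finally show "card (basis 5) \<le> 1 + 10 * card (C 1) + 10 * card (C 2) + 5 * card (C 3) + card (C 4) +
     5 * card (C 1) * card (C 1) + 2 * card (C 1) * card (C 2)" by (simp add: algebra_simps)
qed

text \<open>The Massey product shows up here: it makes the generator belonging to \<^const>\<open>h0\<close> redundant.\<close>

lemma h0_redundant:
  assumes zb: "zb \<in> C 1" and zc: "zc \<in> C 1" and h0: "h0 \<in> C 4"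
  shows "\<exists>y\<in>free_mod (basis 5). Poly_Mapping.lookup y ({}, [(4, h0)]) = 0 \<and> dG y = bdry ({}, [(4, h0)])"
proof -
  have zaZ: "za \<in> kdeg 1" "dK za = 0" and zbZ: "zb \<in> kdeg 1" "dK zb = 0" using za_cycle zb_cycle by auto
  have g: "\<gamma> zb zc \<in> kdeg 3" "dK (\<gamma> zb zc) = - kmul (involute zb) zc"
    using gamma[OF zb zc] by (auto simp: numeral_3_eq_3 One_nat_def numeral_2_eq_2)
  \<comment> \<open>As \<open>zb zc\<close> vanishes on chains, \<open>\<gamma> zb zc\<close> is a
    cycle whatever choice was made, and its product with \<open>za\<close> bounds by triviality of
    products.\<close>
  have "dK (\<gamma> zb zc) = 0"
    unfolding g(2) involute_kdeg[OF zbZ(1)] by (simp add: kmul_smul_left zb_zc)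
  then have "is_boundary (kmul za (\<gamma> zb zc))"
    using g(1) zaZ by (intro is_boundary_kmul[of za 1 _ 3]) auto
  moreover have "kmul za (\<gamma> zb zc) \<in> kdeg 4" using kmul_mem_kdeg[OF zaZ(1) g(1)] by simp
  ultimately obtain t where t: "t \<in> kdeg 5" "kmul za (\<gamma> zb zc) = dK t"
    using boundary_in_degree[of "kmul za (\<gamma> zb zc)" 4] by auto
  have letters: "(1, zb) \<in> letters" "(1, zc) \<in> letters" using zb zc by (simp_all add: letters_iff)
  \<comment> \<open>The boundary of \<open>za\<close> on the word \<open>zb, zc\<close> is
    \<open>- za zb\<close> on the word \<open>zc\<close>, minus \<open>za \<gamma>(zb, zc)\<close>
    on the empty word. The chains \<open>qab\<close> and \<open>t\<close> cancel these two, and what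
    remains is \<open>qab zc = h0\<close>.\<close>
  define y where "y = - place [(1, zb), (1, zc)] za - place [(1, zc)] qab - place [] t"
  have "place [(1, zb), (1, zc)] za \<in> free_mod (basis 5)"
    using place_free_mod[OF zaZ(1), of "[(1, zb), (1, zc)]"] letters by (simp add: words_def)
  moreover have "place [(1, zc)] qab \<in> free_mod (basis 5)"
    using place_free_mod[OF qab_kdeg, of "[(1, zc)]"] letters by (simp add: words_def)
  moreover have "place [] t \<in> free_mod (basis 5)"
    using place_free_mod[OF t(1) nil_words] by simp
  ultimately have "y \<in> free_mod (basis 5)" by (simp add: y_def free_mod_diff free_mod_uminus)
  moreover have "Poly_Mapping.lookup y ({}, [(4, h0)]) = 0"
    by (simp add: y_def lookup_minus lookup_place)
  moreover have "dG y = bdry ({}, [(4, h0)])"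
  proof -
    have iza: "involute za = - za" using involute_kdeg[OF zaZ(1)] by (simp add: smul_minus_left)
    have iq: "involute qab = - (qab :: 'k kos)" using involute_kdeg[OF qab_kdeg] by (simp add: smul_minus_left)
    have "bdry ({}, [(4, h0)]) = place [] h0"
    proof -
      have d: "dK (Poly_Mapping.single {} 1 :: 'k kos) = 0" using dK_kone by (simp add: kone_def)
      show ?thesis unfolding bdry.simps d by (simp add: involute_single)
    qed
    moreover have "dG (place [(1, zb), (1, zc)] za) = - place [(1, zc)] (kmul za zb) - place [] (kmul za (\<gamma> zb zc))"
      by (simp add: dG_place zaZ(2) iza kmul_uminus_left place_uminus)
    moreover have "dG (place [(1, zc)] qab) = place [(1, zc)] (kmul za zb) - place [] (kmul qab zc)"
      by (simp add: dG_place iq dK_qab kmul_uminus_left place_uminus)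
    moreover have "dG (place [] t) = place [] (dK t)"
      by (simp add: dG_place)
    ultimately show ?thesis
      unfolding y_def lin_ext_diff lin_ext_uminus by (simp add: t(2) qab_zc)
  qed
  ultimately show ?thesis by blast
qed

text \<open>The boundary of the generator for \<open>h0\<close> is a combination of boundaries of
  the others, so omitting it keeps exactness below degree 5 and improves the bound by one.\<close>

lemma tor_dim_5_less:
  assumes "zb \<in> C 1" "zc \<in> C 1" "h0 \<in> C 4"
  shows "tor_dim (residue (quot_map :: (var, 'k) mpoly \<Rightarrow> 'k quot_ring)) 5 < card (basis 5)"
proof -
  let ?h = "({}, [(4, h0)]) :: var set \<times> 'k word"
  obtain y0 where y0: "y0 \<in> free_mod (basis 5)" "Poly_Mapping.lookup y0 ?h = 0" "dG y0 = bdry ?h"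
    using h0_redundant[OF assms] by blast
  have h: "?h \<in> basis j \<longleftrightarrow> j = 5" for j
    using assms(3) by (auto simp: basis_def words_def letters_iff)
  define A where "A j = basis j - {?h}" for j
  have A: "A j = basis j" if "j \<noteq> 5" for j using h[of j] that by (auto simp: A_def)
  have "residue.complex_upto 5 A (\<lambda>_. bdry) theta"
    unfolding residue.complex_upto_def
  proof (intro conjI allI impI ballI)
    show "bdry b \<in> free_mod (A j)" if "j < 5" "b \<in> A (Suc j)" for j b
      using that by (subst A) (auto simp: A_def intro: bdry_free_mod)
  qed (use complex_basis in \<open>auto simp: residue.complex_upto_def A_def\<close>)
  moreover have "residue.exact_upto 5 A (\<lambda>_. bdry) theta"
    unfolding residue.exact_upto_def
  proof (intro conjI allI impI ballI)
    show "\<exists>y\<in>free_mod (A 0). augmentation (residue quot_map) theta y = c" for c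
      using exact_basis by (simp add: A residue.exact_upto_def)
    show "\<exists>y\<in>free_mod (A (Suc 0)). dG y = u"
      if "u \<in> free_mod (A 0)" "augmentation (residue quot_map) theta u = 0" for u
      using exact_basis that by (simp add: A residue.exact_upto_def)
    show "\<exists>y\<in>free_mod (A (Suc (Suc j))). dG y = u"
      if j: "Suc j < 5" and u: "u \<in> free_mod (A (Suc j))" "dG u = 0" for j u
    proof -
      obtain y where y: "y \<in> free_mod (basis (Suc (Suc j)))" "dG y = u"
        using exact[of "Suc j" u] j u by (auto simp: A)
      show ?thesis
      proof (cases "Suc (Suc j) = 5")
        case False
        then show ?thesis using y by (auto simp: A)
      next
        case True
        let ?r = "Poly_Mapping.lookup y ?h"
        \<comment> \<open>Trades the generator for \<open>h0\<close> against \<open>y0\<close>,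
          which has the same boundary.\<close>
        let ?y = "y - Poly_Mapping.single ?h ?r + smul ?r y0"
        have "?y \<in> free_mod (basis 5)"
          using y(1) y0(1) True h[of 5] by (intro free_mod_add free_mod_diff free_mod_smul free_mod_single) auto
        moreover have "Poly_Mapping.lookup ?y ?h = 0" by (simp add: lookup_add lookup_minus y0(2))
        ultimately have "?y \<in> free_mod (A 5)" by (auto simp: A_def free_mod_iff)
        moreover have "dG ?y = u" by (simp add: lin_ext_add lin_ext_diff lin_ext_smul y(2) y0(3) del: bdry.simps)
        ultimately show ?thesis unfolding True by blast
      qed
    qed
  qed
  moreover have "finite (A 5)" using card_basis_5(2) by (simp add: A_def)
  ultimately have "tor_dim (residue (quot_map :: (var, 'k) mpoly \<Rightarrow> 'k quot_ring)) 5 \<le> card (A 5)"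
    using tor_dim_le[of 4 A "\<lambda>_. bdry" theta] by simp
  also have "card (A 5) < card (basis 5)"
    unfolding A_def using card_basis_5(2) h[of 5] by (intro psubset_card_mono) auto
  finally show ?thesis .
qed

end

text \<open>Clearing the denominator gives a recursion for the coefficients. The denominator has no
  linear term, so \<open>p 4\<close> does not enter the formula for \<open>p 5\<close>.\<close>

lemma golod_coefficient_5:
  assumes g: "golod (quot_map :: (var, 'k::field) mpoly \<Rightarrow> 'k quot_ring)"
    and h: "\<And>j. h j = koszul_betti (quot_map :: (var, 'k) mpoly \<Rightarrow> 'k quot_ring) j"
  shows "tor_dim (residue (quot_map :: (var, 'k) mpoly \<Rightarrow> 'k quot_ring)) 5 =
    1 + 10 * h 1 + 10 * h 2 + 5 * h 3 + h 4 + 5 * h 1 * h 1 + 2 * h 1 * h 2"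
proof -
  define p where "p j = (of_nat (tor_dim (residue (quot_map :: (var, 'k) mpoly \<Rightarrow> 'k quot_ring)) j) :: rat)" for j
  define D where "D = (1 - Abs_fps (\<lambda>i. if 2 \<le> i then of_nat (h (i - 1)) else 0) :: rat fps)"
  have "Abs_fps p = (1 + fps_X) ^ 5 / D"
    using g unfolding golod_def p_def D_def h card_UNIV_var by simp
  moreover have "is_unit D" by (simp add: fps_is_unit_iff D_def)
  ultimately have eq: "Abs_fps p * D = (1 + fps_X) ^ 5"
    by (metis dvd_div_mult_self unit_imp_dvd)
  have c: "(\<Sum>i=0..n. p i * fps_nth D (n - i)) = of_nat (5 choose n)" for n
  proof -
    have "fps_nth (Abs_fps p * D) n = fps_nth ((1 + fps_X) ^ 5 :: rat fps) n" by (simp only: eq)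
    moreover have "fps_nth ((1 + fps_X) ^ 5 :: rat fps) n = of_nat (5 choose n)"
      using fps_binomial_of_nat[of 5, where ?'a = rat] binomial_gbinomial[of 5 n, where ?'a = rat]
      by (simp flip: fps_binomial_nth)
    ultimately show ?thesis by (simp add: fps_mult_nth)
  qed
  have D: "fps_nth D 0 = 1" "fps_nth D 1 = 0" "fps_nth D (Suc 0) = 0" "fps_nth D 2 = - of_nat (h 1)" "fps_nth D 3 = - of_nat (h 2)" "fps_nth D 4 = - of_nat (h 3)" "fps_nth D 5 = - of_nat (h 4)"
    by (simp_all add: D_def One_nat_def)
  have choose: "5 choose 5 = (1 :: nat)" "5 choose 4 = (5 :: nat)" "5 choose 3 = (10 :: nat)" "5 choose 2 = (10 :: nat)"
    "5 choose 1 = (5 :: nat)" "5 choose 0 = (1 :: nat)"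
    by (simp_all add: eval_nat_numeral One_nat_def)
  have sets: "{0..0} = {0::nat}" "{0..1} = {0, 1::nat}" "{0..2} = {0, 1, 2::nat}" "{0..3} = {0, 1, 2, 3::nat}"
    "{0..4} = {0, 1, 2, 3, 4::nat}" "{0..5} = {0, 1, 2, 3, 4, 5::nat}" by auto
  have p0: "p 0 = 1" using c[of 0] by (simp only: sets) (simp add: D)
  have p1: "p 1 = 5" using c[of 1] by (simp only: sets choose) (simp add: D)
  have p2: "p 2 = 10 + of_nat (h 1)" using c[of 2] by (simp only: sets choose) (simp add: D p0)
  have p3: "p 3 = 10 + 5 * of_nat (h 1) + of_nat (h 2)"
    using c[of 3] by (simp only: sets choose) (simp add: D p0 p1 algebra_simps)
  have "p 5 = 1 + of_nat (h 1) * p 3 + of_nat (h 2) * p 2 + of_nat (h 3) * p 1 + of_nat (h 4) * p 0"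
    using c[of 5] by (simp only: sets choose) (simp add: D algebra_simps)
  then have "p 5 = of_nat (1 + 10 * h 1 + 10 * h 2 + 5 * h 3 + h 4 + 5 * h 1 * h 1 + 2 * h 1 * h 2)"
    by (simp add: p0 p1 p2 p3 algebra_simps)
  then show ?thesis unfolding p_def by (simp only: of_nat_eq_iff)
qed

text \<open>The homology bases are free to choose; taking \<open>zb\<close> and \<open>zc\<close> in
  degree 1 and \<open>h0\<close> in degree 4 makes the redundant generator one of the basis, while
  the count depends on the Betti numbers alone.\<close>

lemma not_golod: "\<not> golod (quot_map :: (var, 'k::field) mpoly \<Rightarrow> 'k quot_ring)"
proof
  assume g: "golod (quot_map :: (var, 'k) mpoly \<Rightarrow> 'k quot_ring)"
  let ?h = "koszul_betti (quot_map :: (var, 'k) mpoly \<Rightarrow> 'k quot_ring)"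
  let ?basis = "\<lambda>n C. basis_modulo kscale (kcycles n :: 'k kos set) (kboundaries n) C \<and> finite C \<and> card C = ?h n"
  have "{zb, zc :: 'k kos} \<subseteq> kcycles 1" using zb_cycle zc_cycle by auto
  then obtain C1 where C1: "{zb, zc} \<subseteq> C1" "?basis 1 C1"
    by (rule homology_basis_extend[OF _ zb_zc_independent]) blast+
  obtain C2 where C2: "?basis 2 C2" by (rule homology_basis_extend[of "{}" 2]) auto
  obtain C3 where C3: "?basis 3 C3" by (rule homology_basis_extend[of "{}" 3]) auto
  obtain C4 where C4: "{h0} \<subseteq> C4" "?basis 4 C4"
    by (rule homology_basis_extend[of "{h0 :: 'k kos}" 4]) (use h0_cycle h0_not_boundary in auto)
  define C where "C = (\<lambda>n :: nat. if n = 0 then {kone :: 'k kos} else if n = 1 then C1 else if n = 2 then C2 else if n = 3 then C3 else C4)"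
  have C: "?basis n (C n)" if "1 \<le> n" "n \<le> 4" for n
  proof -
    have "n = 1 \<or> n = 2 \<or> n = 3 \<or> n = 4" using that by auto
    then show ?thesis using C1 C2 C3 C4 by (auto simp: C_def)
  qed
  have C_cycle: "v \<in> kdeg n \<and> dK v = 0" if "n \<le> 4" "v \<in> C n" for n v
  proof (cases "n = 0")
    case True
    then show ?thesis using that(2) by (simp add: C_def)
  next
    case False
    then have "C n \<subseteq> kcycles n" using C[of n] that(1) by (simp add: basis_modulo_def)
    then show ?thesis using that(2) by auto
  qed
  have C_nonzero: "v \<noteq> 0" if "1 \<le> n" "n \<le> 4" "v \<in> C n" for n v
  proof -
    have "v \<notin> kos.span (kboundaries n \<union> (C n - {v}))"
      using C[OF that(1,2)] that(3) by (simp add: basis_modulo_def)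
    then show ?thesis using kos.span_zero by metis
  qed
  \<comment> \<open>\<open>\<gamma>\<close> receives the cycles without their degrees, which is
    unambiguous because a nonzero chain is homogeneous of at most one degree.\<close>
  have degree_unique: "m = n" if "1 \<le> m" "m \<le> 4" "n \<le> 4" "v \<in> C m" "v \<in> C n" for m n v
  proof (rule ccontr)
    assume "m \<noteq> n"
    have "v = 0"
    proof (rule coef_eqI, rule ccontr)
      fix I u assume "coef v I u \<noteq> coef 0 I u"
      then have "coef v I u \<noteq> 0" by simp
      moreover have "v \<in> kdeg m" "v \<in> kdeg n" using C_cycle that by auto
      ultimately have "card I = m" "card I = n" unfolding kdeg_iff_coef by blast+
      then show False using \<open>m \<noteq> n\<close> by simp
    qed
    then show False using C_nonzero that by blast
  qed
  define good where "good v w t \<longleftrightarrow> (\<forall>k l. v \<in> C k \<longrightarrow> w \<in> C l \<longrightarrow> 1 \<le> k \<longrightarrow> 1 \<le> l \<longrightarrow> k + l \<le> 3 \<longrightarrow>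
    t \<in> kdeg (Suc (k + l)) \<and> dK t = - kmul (involute v) w)" for v w t :: "'k kos"
  have "\<exists>t. good v w t" for v w
  proof (cases "\<exists>k l. v \<in> C k \<and> w \<in> C l \<and> 1 \<le> k \<and> 1 \<le> l \<and> k + l \<le> 3")
    case False
    then show ?thesis unfolding good_def by blast
  next
    case True
    then obtain k l where kl: "v \<in> C k" "w \<in> C l" "1 \<le> k" "1 \<le> l" "k + l \<le> 3" by blast
    have v: "v \<in> kdeg k" "dK v = 0" and w: "w \<in> kdeg l" "dK w = 0"
      using C_cycle[of k v] C_cycle[of l w] kl by simp_all
    have "dK (involute v) = 0" by (simp add: kdiff_involute v)
    then have "is_boundary (kmul (involute v) w)"
      using v w kl by (intro is_boundary_kmul[of _ k _ l] involute_mem_kdeg) auto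
    moreover have "kmul (involute v) w \<in> kdeg (k + l)" using v w by (intro kmul_mem_kdeg involute_mem_kdeg)
    ultimately obtain t where t: "t \<in> kdeg (Suc (k + l))" "kmul (involute v) w = dK t"
      by (metis boundary_in_degree)
    have "good v w (- t)"
      unfolding good_def
    proof (intro allI impI)
      fix k' l' assume "v \<in> C k'" "w \<in> C l'" "1 \<le> k'" "1 \<le> l'" "k' + l' \<le> 3"
      then have "k' = k" "l' = l" using degree_unique[of k' k v] degree_unique[of l' l w] kl by auto
      then show "- t \<in> kdeg (Suc (k' + l')) \<and> dK (- t) = - kmul (involute v) w"
        using t by (simp add: kdeg_uminus kdiff_uminus)
    qed
    then show ?thesis ..
  qed
  then have good: "good v w (SOME t. good v w t)" for v w by (rule someI_ex)
  interpret homology_bases C "\<lambda>v w. SOME t. good v w t"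
  proof
    fix n :: nat assume n: "n \<le> 4"
    show "finite (C n)" using C[of n] n by (cases "n = 0") (auto simp: C_def)
    show "v \<in> kdeg n \<and> dK v = 0" if "v \<in> C n" for v using C_cycle n that by blast
    show "\<exists>t\<in>kdeg (Suc n). \<exists>c. a = dK t + (\<Sum>v\<in>C n. kscale (c v) v)" if a: "a \<in> kdeg n" "dK a = 0" for a
    proof (cases "n = 0")
      case True
      then obtain t where "t \<in> kdeg (Suc n)" "a = dK t + kscale (coef a {} 0) kone"
        using kcycles_0[of a] a(1) by auto
      then show ?thesis using True by (intro bexI[of _ t] exI[of _ "\<lambda>_. coef a {} 0"]) (simp_all add: C_def)
    next
      case False
      then show ?thesis using C[of n] n a by (intro homology_basis_decompose) auto
    qed
    show "c v = 0" if c: "(\<Sum>v\<in>C n. kscale (c v) v) = dK t" "v \<in> C n" for c t v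
    proof (cases "n = 0")
      case True
      then have "v = kone" "kscale (c kone) kone = dK t" using c by (simp_all add: C_def)
      moreover have "coef (kscale (c kone) kone) {} 0 = c kone" by (simp add: coef_cq coef_kone)
      ultimately show ?thesis by (metis coef_dK_const)
    next
      case False
      then have "?basis n (C n)" using C n by simp
      then show ?thesis using homology_basis_independent[of n "C n" c t v] c by blast
    qed
  next
    show "C 0 = {kone}" by (simp add: C_def)
  next
    fix v w k l assume "v \<in> C k" "w \<in> C l" "1 \<le> k" "1 \<le> l" "k + l \<le> 3"
    then show "(SOME t. good v w t) \<in> kdeg (Suc (k + l)) \<and> dK (SOME t. good v w t) = - kmul (involute v) w"
      using good[of v w] unfolding good_def[of v w "SOME t. good v w t"] by blast
  qed
  have "tor_dim (residue (quot_map :: (var, 'k) mpoly \<Rightarrow> 'k quot_ring)) 5 < card (basis 5)"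
    by (rule tor_dim_5_less) (use C1 C4 in \<open>auto simp: C_def\<close>)
  also have "\<dots> \<le> 1 + 10 * ?h 1 + 10 * ?h 2 + 5 * ?h 3 + ?h 4 + 5 * ?h 1 * ?h 1 + 2 * ?h 1 * ?h 2"
    using card_basis_5(1) C[of 1] C[of 2] C[of 3] C[of 4] by simp
  also have "\<dots> = tor_dim (residue (quot_map :: (var, 'k) mpoly \<Rightarrow> 'k quot_ring)) 5"
    using golod_coefficient_5[OF g] by simp
  finally show False by simp
qed

theorem theorem3p1:
  fixes r :: "var monomial rel"
  assumes "strict_linear_order_on (min_gens (ideal_a :: (var, 'k::field) mpoly set)) r"
  shows "trivial_homology_product (koszul (quot_map :: (var, 'k) mpoly \<Rightarrow> 'k quot_ring)) \<and>
    \<not> golod (quot_map :: (var, 'k) mpoly \<Rightarrow> 'k quot_ring) \<and>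
    (let T = taylor_k (ideal_a :: (var, 'k) mpoly set) r;
         e = (\<lambda>I. Poly_Mapping.single I (1 :: 'k));
         \<mu> = massey T [hclass T (e {m_a}), hclass T (e {m_b}), hclass T (e {m_c})]
     in \<mu> \<noteq> {} \<and> \<mu> \<noteq> {hclass T 0})"
proof -
  have "strict_linear_order_on gens r" using assms by (simp add: min_gens_ideal_a)
  then have "\<exists>x\<in>massey (taylor_alg r) [hclass (taylor_alg r) (Poly_Mapping.single {m_a} (1 :: 'k)),
      hclass (taylor_alg r) (Poly_Mapping.single {m_b} 1), hclass (taylor_alg r) (Poly_Mapping.single {m_c} 1)].
      x \<noteq> hclass (taylor_alg r) 0"
    by (rule massey_taylor)
  \<comment> \<open>One nonzero class in the Massey product excludes both the empty set and the set
    consisting of 0.\<close>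
  then show ?thesis
    unfolding taylor_k_def min_gens_ideal_a Let_def
    using trivial_homology_product_koszul not_golod by blast
qed

end
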